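(* Let $(\Sigma,D,T)$ be a torsion free affine surface equipped with a parallel $(1,1)$-tensor field $T$ (i.e. $DT=0$). Let $\Phi$ be an arbitrary symmetric $(0,2)$-tensor field on $\Sigma$. Then the Bach tensor of the modified Riemannian extension $(T^*\Sigma,g_{D,\Phi,T})$ vanishes if and only if $T$ is either a multiple of the identity or nilpotent.
   Context: A torsion free affine surface $(\Sigma,D)$ is a smooth surface $\Sigma$ with a torsion free affine connection $D$, with Christoffel symbols ${}^D\Gamma_{ij}{}^k$. Let $\pi\colon T^*\Sigma\to\Sigma$ be the cotangent bundle. Local coordinates $(x^i)$ on $\Sigma$ induce coordinates $(x^i,x_{i'})$ on $T^*\Sigma$ by writing a covector as $\omega=\sum x_{i'}dx^i$. For a vector field $X$ on $\Sigma$, the evaluation $\iota X\colon T^*\Sigma\to\mathbb{R}$ is $\iota X(p,\omega)=\omega(X_p)$, and the complete lift $X^C$ is the vector field on $T^*\Sigma$ determined by $X^C(\iota Z)=\iota[X,Z]$ for all vector fields $Z$ on $\Sigma$. For a $(1,1)$-tensor field $T$ on $\Sigma$, $\iota T$ is the one-form on $T^*\Sigma$ with $\iota T(X^C)=\iota(TX)$. The Riemannian extension $g_D$ is the neutral signature metric on $T^*\Sigma$ with $g_D(X^C,Y^C)=-\iota(D_XY+D_YX)$. The modified Riemannian extension is the neutral signature metric $$g_{D,\Phi,T}=\iota T\circ\iota T+g_D+\pi^*\Phi,$$ where $\omega_1\circ\omega_2=\frac12(\omega_1\otimes\omega_2+\omega_2\otimes\omega_1)$. In induced coordinates, with $T\partial_i=T_i^k\partial_k$,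 $$g_{D,\Phi,T}=2\,dx^i\circ dx_{i'}+\{\tfrac12x_{r'}x_{s'}(T_i^rT_j^s+T_j^rT_i^s)-2x_{k'}{}^D\Gamma_{ij}{}^k+\Phi_{ij}\}\,dx^i\circ dx^j .$$ The Bach tensor of a four-dimensional pseudo-Riemannian manifold with Weyl tensor $W$ and Ricci tensor $\rho$ is $\mathfrak{B}_{ij}=\nabla^k\nabla^\ell W_{kij\ell}+\frac12\rho^{k\ell}W_{kij\ell}$.
   Formalization: The surface is assumed connected; otherwise T could be the identity on one component and a nonzero nilpotent on another, so that the Bach tensor vanishes while T is neither a multiple of the identity nor nilpotent. *)

theory Defs
  imports "HOL-Analysis.Analysis"
begin

section \<open>Smooth functions and smooth manifolds\<close>

definition pd :: "'n \<Rightarrow> (real^'n \<Rightarrow> real) \<Rightarrow> real^'n \<Rightarrow> real" where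
  "pd i f x = frechet_derivative f (at x) (axis i 1)"

primrec C_k_on :: "nat \<Rightarrow> (real^'n) set \<Rightarrow> (real^'n \<Rightarrow> real) \<Rightarrow> bool" where
  "C_k_on 0 S f = continuous_on S f"
| "C_k_on (Suc k) S f = (f differentiable_on S \<and> (\<forall>i. C_k_on k S (pd i f)))"

text \<open>Only used for open \<open>S\<close>, where the derivatives at points of \<open>S\<close> are intrinsic to \<open>S\<close>.\<close>

definition smooth_on :: "(real^'n) set \<Rightarrow> (real^'n \<Rightarrow> real) \<Rightarrow> bool" where
  "smooth_on S f \<longleftrightarrow> (\<forall>k. C_k_on k S f)"

text \<open>A chart is a pair of a domain and a coordinate map; values of the coordinate map outside the
  domain are irrelevant. The topology of a manifold is the one determined by its atlas.\<close>

type_synonym ('a, 'n) chart = "'a set \<times> ('a \<Rightarrow> real^'n)"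

definition coord_change :: "('a, 'n::finite) chart \<Rightarrow> ('a, 'n::finite) chart \<Rightarrow> real^'n \<Rightarrow> real^'n" where
  "coord_change c d = snd d \<circ> inv_into (fst c) (snd c)"

definition smooth_atlas :: "('a, 'n::finite) chart set \<Rightarrow> bool" where
  "smooth_atlas A \<longleftrightarrow>
     (\<forall>c\<in>A. inj_on (snd c) (fst c) \<and> open (snd c ` fst c)) \<and>
     (\<forall>c\<in>A. \<forall>d\<in>A. open (snd c ` (fst c \<inter> fst d)) \<and>
        (\<forall>a. smooth_on (snd c ` (fst c \<inter> fst d)) (\<lambda>x. coord_change c d x $ a)))"

definition points :: "('a, 'n::finite) chart set \<Rightarrow> 'a set" where
  "points A = \<Union>(fst ` A)"

definition atlas_topology :: "('a, 'n::finite) chart set \<Rightarrow> 'a topology" where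
  "atlas_topology A =
     topology (\<lambda>W. W \<subseteq> points A \<and> (\<forall>c\<in>A. open (snd c ` (W \<inter> fst c))))"

lemma openin_atlas_topology:
  assumes "smooth_atlas A"
  shows "openin (atlas_topology A) W \<longleftrightarrow> W \<subseteq> points A \<and> (\<forall>c\<in>A. open (snd c ` (W \<inter> fst c)))"
proof -
  have inj: "inj_on (snd c) (fst c)" if "c \<in> A" for c
    using assms that by (auto simp: smooth_atlas_def)
  have "istopology (\<lambda>W. W \<subseteq> points A \<and> (\<forall>c\<in>A. open (snd c ` (W \<inter> fst c))))"
    unfolding istopology_def
  proof (intro conjI allI impI ballI; (elim conjE)?)
    fix S T c assume "c \<in> A" and S: "\<forall>c\<in>A. open (snd c ` (S \<inter> fst c))"
      and T: "\<forall>c\<in>A. open (snd c ` (T \<inter> fst c))"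
    have "snd c ` (S \<inter> T \<inter> fst c) = snd c ` (S \<inter> fst c) \<inter> snd c ` (T \<inter> fst c)"
      using inj[OF \<open>c \<in> A\<close>] by (auto simp: inj_on_def)
    then show "open (snd c ` (S \<inter> T \<inter> fst c))"
      using S T \<open>c \<in> A\<close> by auto
  next
    fix K c assume "c \<in> A"
      and K: "\<forall>S\<in>K. S \<subseteq> points A \<and> (\<forall>c\<in>A. open (snd c ` (S \<inter> fst c)))"
    have "snd c ` (\<Union>K \<inter> fst c) = (\<Union>S\<in>K. snd c ` (S \<inter> fst c))" by auto
    then show "open (snd c ` (\<Union>K \<inter> fst c))"
      using K \<open>c \<in> A\<close> by auto
  qed auto
  then show ?thesis
    unfolding atlas_topology_def by (simp add: topology_inverse')
qed

definition smooth_manifold :: "('a, 'n::finite) chart set \<Rightarrow> bool" where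
  "smooth_manifold A \<longleftrightarrow> smooth_atlas A \<and>
     Hausdorff_space (atlas_topology A) \<and> second_countable (atlas_topology A)"

definition connected_manifold :: "('a, 'n::finite) chart set \<Rightarrow> bool" where
  "connected_manifold A \<longleftrightarrow> smooth_manifold A \<and> connected_space (atlas_topology A)"


section \<open>Tensor fields and affine connections\<close>

text \<open>A geometric object on a manifold is given by its components in every chart of the atlas, as
  functions of the coordinates, subject to the transformation law under coordinate changes. Only
  the values on the coordinate ranges of the charts are relevant. If \<open>x\<close> and \<open>y\<close> are the
  coordinates of \<open>c\<close> and \<open>d\<close>, then \<open>jac c d x i a\<close> is the partial derivative
  of \<open>y\<^sup>a\<close> in direction \<open>x\<^sup>i\<close>, and \<open>hess c d x i j a\<close> the corresponding second derivative.\<close>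

definition jac :: "('a, 'n::finite) chart \<Rightarrow> ('a, 'n::finite) chart \<Rightarrow> real^'n \<Rightarrow> 'n \<Rightarrow> 'n \<Rightarrow> real" where
  "jac c d x i a = pd i (\<lambda>u. coord_change c d u $ a) x"

definition hess :: "('a, 'n::finite) chart \<Rightarrow> ('a, 'n::finite) chart \<Rightarrow> real^'n \<Rightarrow> 'n \<Rightarrow> 'n \<Rightarrow> 'n \<Rightarrow> real" where
  "hess c d x i j a = pd i (\<lambda>u. jac c d u j a) x"

text \<open>Component conventions: \<open>\<Phi> c x i j\<close> is \<open>\<Phi>\<^sub>i\<^sub>j\<close>; \<open>T c x i k\<close> is \<open>T\<^sub>i\<^sup>k\<close>, where
  \<open>T \<partial>\<^sub>i = \<Sum>k. T\<^sub>i\<^sup>k \<partial>\<^sub>k\<close>; \<open>\<Gamma> c x i j k\<close> is \<open>\<Gamma>\<^sub>i\<^sub>j\<^sup>k\<close>, where \<open>D\<^bsub>\<partial>\<^sub>i\<^esub> \<partial>\<^sub>j = \<Sum>k. \<Gamma>\<^sub>i\<^sub>j\<^sup>k \<partial>\<^sub>k\<close>.\<close>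

definition symmetric_02_tensor ::
  "('a, 'n::finite) chart set \<Rightarrow> (('a, 'n::finite) chart \<Rightarrow> real^'n \<Rightarrow> 'n \<Rightarrow> 'n \<Rightarrow> real) \<Rightarrow> bool" where
  "symmetric_02_tensor A \<Phi> \<longleftrightarrow>
     (\<forall>c\<in>A. \<forall>i j. smooth_on (snd c ` fst c) (\<lambda>x. \<Phi> c x i j)) \<and>
     (\<forall>c\<in>A. \<forall>x\<in>snd c ` fst c. \<forall>i j. \<Phi> c x i j = \<Phi> c x j i) \<and>
     (\<forall>c\<in>A. \<forall>d\<in>A. \<forall>p\<in>fst c \<inter> fst d. \<forall>i j.
        \<Phi> c (snd c p) i j =
          (\<Sum>a\<in>UNIV. \<Sum>b\<in>UNIV. jac c d (snd c p) i a * jac c d (snd c p) j b * \<Phi> d (snd d p) a b))"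

definition tensor_11 ::
  "('a, 'n::finite) chart set \<Rightarrow> (('a, 'n::finite) chart \<Rightarrow> real^'n \<Rightarrow> 'n \<Rightarrow> 'n \<Rightarrow> real) \<Rightarrow> bool" where
  "tensor_11 A T \<longleftrightarrow>
     (\<forall>c\<in>A. \<forall>i k. smooth_on (snd c ` fst c) (\<lambda>x. T c x i k)) \<and>
     (\<forall>c\<in>A. \<forall>d\<in>A. \<forall>p\<in>fst c \<inter> fst d. \<forall>i a.
        (\<Sum>k\<in>UNIV. T c (snd c p) i k * jac c d (snd c p) k a) =
        (\<Sum>b\<in>UNIV. jac c d (snd c p) i b * T d (snd d p) b a))"

definition torsion_free_connection ::
  "('a, 'n::finite) chart set \<Rightarrow> (('a, 'n::finite) chart \<Rightarrow> real^'n \<Rightarrow> 'n \<Rightarrow> 'n \<Rightarrow> 'n \<Rightarrow> real) \<Rightarrow> bool" where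
  "torsion_free_connection A \<Gamma> \<longleftrightarrow>
     (\<forall>c\<in>A. \<forall>i j k. smooth_on (snd c ` fst c) (\<lambda>x. \<Gamma> c x i j k)) \<and>
     (\<forall>c\<in>A. \<forall>x\<in>snd c ` fst c. \<forall>i j k. \<Gamma> c x i j k = \<Gamma> c x j i k) \<and>
     (\<forall>c\<in>A. \<forall>d\<in>A. \<forall>p\<in>fst c \<inter> fst d. \<forall>i j a.
        (\<Sum>k\<in>UNIV. \<Gamma> c (snd c p) i j k * jac c d (snd c p) k a) =
        hess c d (snd c p) i j a +
        (\<Sum>b\<in>UNIV. \<Sum>e\<in>UNIV.
           jac c d (snd c p) i b * jac c d (snd c p) j e * \<Gamma> d (snd d p) b e a))"

text \<open>Components \<open>(D\<^bsub>\<partial>\<^sub>k\<^esub> T)\<^sub>i\<^sup>j\<close> in one chart.\<close>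

definition cov_deriv_11 ::
  "(real^'n \<Rightarrow> 'n \<Rightarrow> 'n \<Rightarrow> 'n \<Rightarrow> real) \<Rightarrow> (real^'n \<Rightarrow> 'n \<Rightarrow> 'n \<Rightarrow> real) \<Rightarrow>
   real^'n \<Rightarrow> 'n \<Rightarrow> 'n \<Rightarrow> 'n \<Rightarrow> real" where
  "cov_deriv_11 \<Gamma> T x k i j = pd k (\<lambda>u. T u i j) x
     + (\<Sum>l\<in>UNIV. \<Gamma> x k l j * T x i l) - (\<Sum>l\<in>UNIV. \<Gamma> x k i l * T x l j)"

definition parallel_11 ::
  "('a, 'n::finite) chart set \<Rightarrow> (('a, 'n::finite) chart \<Rightarrow> real^'n \<Rightarrow> 'n \<Rightarrow> 'n \<Rightarrow> 'n \<Rightarrow> real) \<Rightarrow>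
   (('a, 'n::finite) chart \<Rightarrow> real^'n \<Rightarrow> 'n \<Rightarrow> 'n \<Rightarrow> real) \<Rightarrow> bool" where
  "parallel_11 A \<Gamma> T \<longleftrightarrow>
     (\<forall>c\<in>A. \<forall>x\<in>snd c ` fst c. \<forall>k i j. cov_deriv_11 (\<Gamma> c) (T c) x k i j = 0)"

text \<open>The endomorphism \<open>v \<mapsto> T v\<close> of the tangent space, in coordinates.\<close>

definition endo :: "('n \<Rightarrow> 'n \<Rightarrow> real) \<Rightarrow> real^'n \<Rightarrow> real^'n" where
  "endo M v = (\<chi> k. \<Sum>i\<in>UNIV. v $ i * M i k)"

definition multiple_of_identity ::
  "('a, 'n::finite) chart set \<Rightarrow> (('a, 'n::finite) chart \<Rightarrow> real^'n \<Rightarrow> 'n \<Rightarrow> 'n \<Rightarrow> real) \<Rightarrow> bool" where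
  "multiple_of_identity A T \<longleftrightarrow>
     (\<exists>r::real. \<forall>c\<in>A. \<forall>x\<in>snd c ` fst c. \<forall>v. endo (T c x) v = r *\<^sub>R v)"

definition nilpotent_11 ::
  "('a, 'n::finite) chart set \<Rightarrow> (('a, 'n::finite) chart \<Rightarrow> real^'n \<Rightarrow> 'n \<Rightarrow> 'n \<Rightarrow> real) \<Rightarrow> bool" where
  "nilpotent_11 A T \<longleftrightarrow>
     (\<exists>m::nat. \<forall>c\<in>A. \<forall>x\<in>snd c ` fst c. \<forall>v. (endo (T c x) ^^ m) v = 0)"


section \<open>The cotangent bundle\<close>

text \<open>A covector at \<open>p\<close> is given by its components in every chart around \<open>p\<close> (normalised to \<open>0\<close> in
  all other charts). The chart of the cotangent bundle induced by \<open>c\<close> has the coordinates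
  \<open>x\<^sup>i\<close> (index \<open>Inl i\<close>) and \<open>x\<^sub>i\<^sub>'\<close> (index \<open>Inr i\<close>).\<close>

definition covector_at ::
  "('a, 'n::finite) chart set \<Rightarrow> 'a \<Rightarrow> (('a, 'n::finite) chart \<Rightarrow> real^'n) \<Rightarrow> bool" where
  "covector_at A p \<omega> \<longleftrightarrow>
     (\<forall>c\<in>A. \<forall>d\<in>A. p \<in> fst c \<longrightarrow> p \<in> fst d \<longrightarrow>
        (\<forall>i. \<omega> c $ i = (\<Sum>a\<in>UNIV. jac c d (snd c p) i a * \<omega> d $ a))) \<and>
     (\<forall>c. \<not> (c \<in> A \<and> p \<in> fst c) \<longrightarrow> \<omega> c = 0)"

definition cotangent_bundle ::
  "('a, 'n::finite) chart set \<Rightarrow> ('a \<times> (('a, 'n::finite) chart \<Rightarrow> real^'n)) set" where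
  "cotangent_bundle A = {(p, \<omega>). p \<in> points A \<and> covector_at A p \<omega>}"

definition induced_chart ::
  "('a, 'n::finite) chart set \<Rightarrow> ('a, 'n::finite) chart \<Rightarrow>
   ('a \<times> (('a, 'n::finite) chart \<Rightarrow> real^'n), 'n + 'n) chart" where
  "induced_chart A c =
     ({(p, \<omega>). (p, \<omega>) \<in> cotangent_bundle A \<and> p \<in> fst c},
      \<lambda>(p, \<omega>). \<chi> k. case k of Inl i \<Rightarrow> snd c p $ i | Inr i \<Rightarrow> \<omega> c $ i)"

definition base_pt :: "real^('n + 'n) \<Rightarrow> real^'n" where
  "base_pt z = (\<chi> i. z $ Inl i)"

definition fibre :: "real^('n + 'n) \<Rightarrow> real^'n" where
  "fibre z = (\<chi> i. z $ Inr i)"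


section \<open>The modified Riemannian extension\<close>

text \<open>All formulas are in the induced coordinates of one chart.\<close>

definition iota_11 ::
  "(real^'n \<Rightarrow> 'n \<Rightarrow> 'n \<Rightarrow> real) \<Rightarrow> real^('n + 'n) \<Rightarrow> 'n + 'n \<Rightarrow> real" where
  "iota_11 T z a =
     (case a of Inl i \<Rightarrow> (\<Sum>r\<in>UNIV. fibre z $ r * T (base_pt z) i r) | Inr i \<Rightarrow> 0)"

definition sym_prod :: "('m \<Rightarrow> real) \<Rightarrow> ('m \<Rightarrow> real) \<Rightarrow> 'm \<Rightarrow> 'm \<Rightarrow> real" where
  "sym_prod \<alpha> \<beta> a b = (\<alpha> a * \<beta> b + \<beta> a * \<alpha> b) / 2"

definition riemannian_extension ::
  "(real^'n \<Rightarrow> 'n \<Rightarrow> 'n \<Rightarrow> 'n \<Rightarrow> real) \<Rightarrow> real^('n + 'n) \<Rightarrow> 'n + 'n \<Rightarrow> 'n + 'n \<Rightarrow> real" where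
  "riemannian_extension \<Gamma> z a b =
     (case (a, b) of
        (Inl i, Inl j) \<Rightarrow> - 2 * (\<Sum>k\<in>UNIV. fibre z $ k * \<Gamma> (base_pt z) i j k)
      | (Inl i, Inr j) \<Rightarrow> (if i = j then 1 else 0)
      | (Inr i, Inl j) \<Rightarrow> (if i = j then 1 else 0)
      | (Inr i, Inr j) \<Rightarrow> 0)"

definition pullback_02 ::
  "(real^'n \<Rightarrow> 'n \<Rightarrow> 'n \<Rightarrow> real) \<Rightarrow> real^('n + 'n) \<Rightarrow> 'n + 'n \<Rightarrow> 'n + 'n \<Rightarrow> real" where
  "pullback_02 \<Phi> z a b =
     (case (a, b) of (Inl i, Inl j) \<Rightarrow> \<Phi> (base_pt z) i j | _ \<Rightarrow> 0)"

definition modified_riemannian_extension ::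
  "(real^'n \<Rightarrow> 'n \<Rightarrow> 'n \<Rightarrow> 'n \<Rightarrow> real) \<Rightarrow> (real^'n \<Rightarrow> 'n \<Rightarrow> 'n \<Rightarrow> real) \<Rightarrow>
   (real^'n \<Rightarrow> 'n \<Rightarrow> 'n \<Rightarrow> real) \<Rightarrow> real^('n + 'n) \<Rightarrow> real^('n + 'n)^('n + 'n)" where
  "modified_riemannian_extension \<Gamma> \<Phi> T z =
     (\<chi> a b. sym_prod (iota_11 T z) (iota_11 T z) a b
        + riemannian_extension \<Gamma> z a b + pullback_02 \<Phi> z a b)"

text \<open>The invariant characterisations by complete lifts. A vector field is given by its
  components \<open>X x $ i\<close>.\<close>

definition iota_vf :: "(real^'n \<Rightarrow> real^'n) \<Rightarrow> real^('n + 'n) \<Rightarrow> real" where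
  "iota_vf X z = (\<Sum>i\<in>UNIV. fibre z $ i * X (base_pt z) $ i)"

definition lie_bracket :: "(real^'n \<Rightarrow> real^'n) \<Rightarrow> (real^'n \<Rightarrow> real^'n) \<Rightarrow> real^'n \<Rightarrow> real^'n" where
  "lie_bracket X Y x =
     (\<chi> k. \<Sum>i\<in>UNIV. X x $ i * pd i (\<lambda>u. Y u $ k) x - Y x $ i * pd i (\<lambda>u. X u $ k) x)"

definition cov_deriv_vf ::
  "(real^'n \<Rightarrow> 'n \<Rightarrow> 'n \<Rightarrow> 'n \<Rightarrow> real) \<Rightarrow> (real^'n \<Rightarrow> real^'n) \<Rightarrow> (real^'n \<Rightarrow> real^'n) \<Rightarrow>
   real^'n \<Rightarrow> real^'n" where
  "cov_deriv_vf \<Gamma> X Y x =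
     (\<chi> k. \<Sum>i\<in>UNIV. X x $ i * (pd i (\<lambda>u. Y u $ k) x + (\<Sum>j\<in>UNIV. \<Gamma> x i j k * Y x $ j)))"

definition complete_lift :: "(real^'n \<Rightarrow> real^'n) \<Rightarrow> real^('n + 'n) \<Rightarrow> 'n + 'n \<Rightarrow> real" where
  "complete_lift X z a =
     (case a of Inl i \<Rightarrow> X (base_pt z) $ i
      | Inr i \<Rightarrow> - (\<Sum>k\<in>UNIV. fibre z $ k * pd i (\<lambda>u. X u $ k) (base_pt z)))"

lemma sum_UNIV_Plus:
  fixes f :: "'n::finite + 'n \<Rightarrow> real"
  shows "(\<Sum>a\<in>UNIV. f a) = (\<Sum>i\<in>UNIV. f (Inl i)) + (\<Sum>i\<in>UNIV. f (Inr i))"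
proof -
  have "(\<Sum>a\<in>UNIV. f a) = (\<Sum>a\<in>UNIV <+> UNIV. f a)" by (simp add: UNIV_Plus_UNIV)
  also have "\<dots> = (\<Sum>i\<in>UNIV. f (Inl i)) + (\<Sum>i\<in>UNIV. f (Inr i))"
    by (subst sum.Plus) auto
  finally show ?thesis .
qed

lemma complete_lift_iota_vf:
  fixes X Z :: "real^'n \<Rightarrow> real^'n"
  assumes Z: "\<And>k. (\<lambda>u. Z u $ k) differentiable (at (base_pt z))"
  shows "(\<Sum>a\<in>UNIV. complete_lift X z a * pd a (iota_vf Z) z) = iota_vf (lie_bracket X Z) z"
proof -
  have lin: "bounded_linear (base_pt :: real^('n + 'n) \<Rightarrow> real^'n)"
    unfolding base_pt_def
    by (intro linear_conv_bounded_linear[THEN iffD1] linearI) (auto simp: vec_eq_iff)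
  have dz: "((\<lambda>u. Z u $ k) has_derivative frechet_derivative (\<lambda>u. Z u $ k) (at (base_pt z)))
       (at (base_pt z))" for k
    using Z frechet_derivative_works by blast
  have dc: "((\<lambda>w. Z (base_pt w) $ k) has_derivative
       (\<lambda>h. frechet_derivative (\<lambda>u. Z u $ k) (at (base_pt z)) (base_pt h))) (at z)" for k
    using has_derivative_compose[OF bounded_linear.has_derivative[OF lin has_derivative_ident] dz] .
  have df: "((\<lambda>w. fibre w $ k) has_derivative (\<lambda>h. fibre h $ k)) (at z)"
    for k and z :: "real^('n + 'n)"
    by (simp add: fibre_def bounded_linear_imp_has_derivative bounded_linear_vec_nth)
  have "((\<lambda>w. \<Sum>k\<in>UNIV. fibre w $ k * Z (base_pt w) $ k) has_derivative
     (\<lambda>h. \<Sum>k\<in>UNIV. fibre z $ k * frechet_derivative (\<lambda>u. Z u $ k) (at (base_pt z)) (base_pt h)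
        + fibre h $ k * Z (base_pt z) $ k)) (at z)"
    by (intro has_derivative_sum has_derivative_mult df dc)
  then have fd: "frechet_derivative (iota_vf Z) (at z) =
     (\<lambda>h. \<Sum>k\<in>UNIV. fibre z $ k * frechet_derivative (\<lambda>u. Z u $ k) (at (base_pt z)) (base_pt h)
        + fibre h $ k * Z (base_pt z) $ k)"
    unfolding iota_vf_def by (rule frechet_derivative_at[symmetric])
  have ax: "base_pt (axis (Inl i) 1 :: real^('n + 'n)) = axis i 1"
     "base_pt (axis (Inr i) 1 :: real^('n + 'n)) = 0"
     "fibre (axis (Inl i) 1 :: real^('n + 'n)) = 0"
     "fibre (axis (Inr i) 1 :: real^('n + 'n)) = axis i 1" for i :: 'n
    by (auto simp: base_pt_def fibre_def vec_eq_iff axis_def)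
  have z0: "frechet_derivative (\<lambda>u. Z u $ k) (at (base_pt z)) 0 = 0" for k
    using dz[of k] has_derivative_bounded_linear linear_0 bounded_linear.linear by metis
  have pl: "pd (Inl i) (iota_vf Z) z = (\<Sum>k\<in>UNIV. fibre z $ k * pd i (\<lambda>u. Z u $ k) (base_pt z))"
    and pr: "pd (Inr i) (iota_vf Z) z = Z (base_pt z) $ i" for i :: 'n
    unfolding pd_def[of "Inl i"] pd_def[of "Inr i"] fd ax z0 unfolding pd_def
    by (auto simp: axis_def if_distrib[where f="\<lambda>t. t * _"] cong: if_cong)
  let ?p = "base_pt z"
  have "(\<Sum>a\<in>UNIV. complete_lift X z a * pd a (iota_vf Z) z) =
     (\<Sum>i\<in>UNIV. \<Sum>k\<in>UNIV. X ?p $ i * (fibre z $ k * pd i (\<lambda>u. Z u $ k) ?p)) -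
     (\<Sum>i\<in>UNIV. \<Sum>k\<in>UNIV. fibre z $ k * pd i (\<lambda>u. X u $ k) ?p * Z ?p $ i)"
    by (simp add: sum_UNIV_Plus complete_lift_def pl pr sum_distrib_left sum_distrib_right sum_negf)
  also have "\<dots> = iota_vf (lie_bracket X Z) z"
    unfolding iota_vf_def lie_bracket_def
    by (subst sum.swap, subst (2) sum.swap)
       (simp add: sum_distrib_left sum_subtractf[symmetric] algebra_simps)
  finally show ?thesis .
qed

lemma iota_11_complete_lift:
  "(\<Sum>a\<in>UNIV. iota_11 T z a * complete_lift X z a) = iota_vf (\<lambda>x. endo (T x) (X x)) z"
  unfolding sum_UNIV_Plus iota_11_def complete_lift_def iota_vf_def endo_def
  by (simp add: sum_distrib_left sum_distrib_right, subst sum.swap) (simp add: mult_ac)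

lemma riemannian_extension_complete_lift:
  fixes X Y :: "real^'n \<Rightarrow> real^'n"
  assumes sym: "\<And>i j k. \<Gamma> (base_pt z) i j k = \<Gamma> (base_pt z) j i k"
  shows "(\<Sum>a\<in>UNIV. \<Sum>b\<in>UNIV.
            riemannian_extension \<Gamma> z a b * complete_lift X z a * complete_lift Y z b) =
         - iota_vf (\<lambda>x. cov_deriv_vf \<Gamma> X Y x + cov_deriv_vf \<Gamma> Y X x) z"
proof -
  let ?p = "base_pt z" and ?w = "fibre z"
  let ?G = "\<Sum>i\<in>UNIV. \<Sum>j\<in>UNIV. \<Sum>k\<in>UNIV. ?w $ k * \<Gamma> ?p i j k * X ?p $ i * Y ?p $ j"
  have G1: "(\<Sum>k\<in>UNIV. ?w $ k * (\<Sum>i\<in>UNIV. X ?p $ i * (\<Sum>j\<in>UNIV. \<Gamma> ?p i j k * Y ?p $ j))) = ?G"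
  proof -
    have "(\<Sum>k\<in>UNIV. ?w $ k * (\<Sum>i\<in>UNIV. X ?p $ i * (\<Sum>j\<in>UNIV. \<Gamma> ?p i j k * Y ?p $ j))) =
      (\<Sum>k\<in>UNIV. \<Sum>i\<in>UNIV. \<Sum>j\<in>UNIV. ?w $ k * \<Gamma> ?p i j k * X ?p $ i * Y ?p $ j)"
      by (simp add: sum_distrib_left mult_ac)
    also have "\<dots> = (\<Sum>i\<in>UNIV. \<Sum>k\<in>UNIV. \<Sum>j\<in>UNIV. ?w $ k * \<Gamma> ?p i j k * X ?p $ i * Y ?p $ j)"
      by (rule sum.swap)
    also have "\<dots> = ?G" by (intro sum.cong refl sum.swap)
    finally show ?thesis .
  qed
  have G2: "(\<Sum>k\<in>UNIV. ?w $ k * (\<Sum>i\<in>UNIV. Y ?p $ i * (\<Sum>j\<in>UNIV. \<Gamma> ?p i j k * X ?p $ j))) = ?G"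
  proof -
    have "(\<Sum>i\<in>UNIV. Y ?p $ i * (\<Sum>j\<in>UNIV. \<Gamma> ?p i j k * X ?p $ j)) =
      (\<Sum>i\<in>UNIV. X ?p $ i * (\<Sum>j\<in>UNIV. \<Gamma> ?p i j k * Y ?p $ j))" for k
      unfolding sum_distrib_left by (subst sum.swap) (simp add: sym mult_ac)
    then show ?thesis using G1 by simp
  qed
  have H: "(\<Sum>i\<in>UNIV. U ?p $ i * (\<Sum>k\<in>UNIV. ?w $ k * pd i (\<lambda>u. V u $ k) ?p)) =
     (\<Sum>k\<in>UNIV. ?w $ k * (\<Sum>i\<in>UNIV. U ?p $ i * pd i (\<lambda>u. V u $ k) ?p))"
    for U V :: "real^'n \<Rightarrow> real^'n"
    unfolding sum_distrib_left by (subst sum.swap) (simp add: mult_ac)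
  have C: "iota_vf (\<lambda>x. cov_deriv_vf \<Gamma> U V x) z =
     (\<Sum>k\<in>UNIV. ?w $ k * (\<Sum>i\<in>UNIV. U ?p $ i * pd i (\<lambda>u. V u $ k) ?p)) +
     (\<Sum>k\<in>UNIV. ?w $ k * (\<Sum>i\<in>UNIV. U ?p $ i * (\<Sum>j\<in>UNIV. \<Gamma> ?p i j k * V ?p $ j)))"
    for U V :: "real^'n \<Rightarrow> real^'n"
    unfolding iota_vf_def cov_deriv_vf_def by (simp add: distrib_left sum.distrib)
  have A: "iota_vf (\<lambda>x. U x + V x) z = iota_vf U z + iota_vf V z" for U V :: "real^'n \<Rightarrow> real^'n"
    unfolding iota_vf_def by (simp add: distrib_left sum.distrib)
  have d: "(\<Sum>j\<in>UNIV. (if i = j then 1 else 0) * s * f j) = s * f i"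
    for i :: 'n and s :: real and f :: "'n \<Rightarrow> real"
    by (simp add: if_distrib[where f="\<lambda>t. t * _"] cong: if_cong)
  let ?XR = "\<lambda>i. - (\<Sum>k\<in>UNIV. ?w $ k * pd i (\<lambda>u. X u $ k) ?p)"
    and ?YR = "\<lambda>i. - (\<Sum>k\<in>UNIV. ?w $ k * pd i (\<lambda>u. Y u $ k) ?p)"
  have "(\<Sum>a\<in>UNIV. \<Sum>b\<in>UNIV.
            riemannian_extension \<Gamma> z a b * complete_lift X z a * complete_lift Y z b) =
     (\<Sum>i\<in>UNIV. \<Sum>j\<in>UNIV. - 2 * (\<Sum>k\<in>UNIV. ?w $ k * \<Gamma> ?p i j k) * X ?p $ i * Y ?p $ j)
     + (\<Sum>i\<in>UNIV. X ?p $ i * ?YR i) + (\<Sum>i\<in>UNIV. ?XR i * Y ?p $ i)"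
    unfolding sum_UNIV_Plus
    by (simp add: riemannian_extension_def complete_lift_def d sum.distrib
        sum_negf sum_subtractf)
  also have "(\<Sum>i\<in>UNIV. \<Sum>j\<in>UNIV. - 2 * (\<Sum>k\<in>UNIV. ?w $ k * \<Gamma> ?p i j k) * X ?p $ i * Y ?p $ j)
     = - 2 * ?G"
    by (simp add: sum_distrib_left sum_distrib_right mult_ac)
  also have "(\<Sum>i\<in>UNIV. X ?p $ i * ?YR i) =
     - (\<Sum>k\<in>UNIV. ?w $ k * (\<Sum>i\<in>UNIV. X ?p $ i * pd i (\<lambda>u. Y u $ k) ?p))"
    by (simp add: sum_negf H)
  also have "(\<Sum>i\<in>UNIV. ?XR i * Y ?p $ i) =
     - (\<Sum>k\<in>UNIV. ?w $ k * (\<Sum>i\<in>UNIV. Y ?p $ i * pd i (\<lambda>u. X u $ k) ?p))"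
    by (simp add: sum_negf H[symmetric] mult.commute)
  finally show ?thesis
    by (simp add: A C G1 G2)
qed


section \<open>The Bach tensor\<close>

text \<open>Tensor calculus of a pseudo-Riemannian metric in one coordinate system. The conventions are
  \<open>R(X,Y) = [\<nabla>\<^sub>X, \<nabla>\<^sub>Y] - \<nabla>\<^bsub>[X,Y]\<^esub>\<close>, \<open>R\<^sub>i\<^sub>j\<^sub>k\<^sub>l = g(R(\<partial>\<^sub>i,\<partial>\<^sub>j)\<partial>\<^sub>k, \<partial>\<^sub>l)\<close> and
  \<open>\<rho>(Y,Z) = tr (X \<mapsto> R(X,Y)Z)\<close>. Reversing the sign of \<open>R\<close> but not that of \<open>\<rho>\<close> would only change
  the sign of the Bach tensor.\<close>

definition levi_civita :: "(real^'m \<Rightarrow> real^'m^'m) \<Rightarrow> real^'m \<Rightarrow> 'm \<Rightarrow> 'm \<Rightarrow> 'm \<Rightarrow> real" where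
  "levi_civita g x i j k = (1/2) * (\<Sum>l\<in>UNIV. matrix_inv (g x) $ k $ l *
     (pd i (\<lambda>u. g u $ j $ l) x + pd j (\<lambda>u. g u $ i $ l) x - pd l (\<lambda>u. g u $ i $ j) x))"

text \<open>\<open>curv_op g x i j k l\<close> is the \<open>\<partial>\<^sub>l\<close>-component of \<open>R(\<partial>\<^sub>i,\<partial>\<^sub>j)\<partial>\<^sub>k\<close>.\<close>

definition curv_op :: "(real^'m \<Rightarrow> real^'m^'m) \<Rightarrow> real^'m \<Rightarrow> 'm \<Rightarrow> 'm \<Rightarrow> 'm \<Rightarrow> 'm \<Rightarrow> real" where
  "curv_op g x i j k l =
     pd i (\<lambda>u. levi_civita g u j k l) x - pd j (\<lambda>u. levi_civita g u i k l) x
     + (\<Sum>m\<in>UNIV. levi_civita g x j k m * levi_civita g x i m l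
                  - levi_civita g x i k m * levi_civita g x j m l)"

definition curv :: "(real^'m \<Rightarrow> real^'m^'m) \<Rightarrow> real^'m \<Rightarrow> 'm \<Rightarrow> 'm \<Rightarrow> 'm \<Rightarrow> 'm \<Rightarrow> real" where
  "curv g x i j k l = (\<Sum>m\<in>UNIV. curv_op g x i j k m * g x $ m $ l)"

definition ricci :: "(real^'m \<Rightarrow> real^'m^'m) \<Rightarrow> real^'m \<Rightarrow> 'm \<Rightarrow> 'm \<Rightarrow> real" where
  "ricci g x j k = (\<Sum>i\<in>UNIV. curv_op g x i j k i)"

definition scalar_curv :: "(real^'m \<Rightarrow> real^'m^'m) \<Rightarrow> real^'m \<Rightarrow> real" where
  "scalar_curv g x = (\<Sum>i\<in>UNIV. \<Sum>j\<in>UNIV. matrix_inv (g x) $ i $ j * ricci g x i j)"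

definition weyl :: "(real^'m \<Rightarrow> real^'m^'m) \<Rightarrow> real^'m \<Rightarrow> 'm \<Rightarrow> 'm \<Rightarrow> 'm \<Rightarrow> 'm \<Rightarrow> real" where
  "weyl g x i j k l = curv g x i j k l
     - 1 / (real CARD('m) - 2) *
         (ricci g x i l * g x $ j $ k + ricci g x j k * g x $ i $ l
          - ricci g x i k * g x $ j $ l - ricci g x j l * g x $ i $ k)
     + scalar_curv g x / ((real CARD('m) - 1) * (real CARD('m) - 2)) *
         (g x $ i $ l * g x $ j $ k - g x $ i $ k * g x $ j $ l)"

text \<open>\<open>nabla_weyl g x b i j k l\<close> is \<open>\<nabla>\<^sub>b W\<^sub>i\<^sub>j\<^sub>k\<^sub>l\<close>, and \<open>nabla2_weyl g x a b i j k l\<close> is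
  \<open>\<nabla>\<^sub>a \<nabla>\<^sub>b W\<^sub>i\<^sub>j\<^sub>k\<^sub>l\<close>.\<close>

definition nabla_weyl ::
  "(real^'m \<Rightarrow> real^'m^'m) \<Rightarrow> real^'m \<Rightarrow> 'm \<Rightarrow> 'm \<Rightarrow> 'm \<Rightarrow> 'm \<Rightarrow> 'm \<Rightarrow> real" where
  "nabla_weyl g x b i j k l = pd b (\<lambda>u. weyl g u i j k l) x
     - (\<Sum>s\<in>UNIV. levi_civita g x b i s * weyl g x s j k l
                  + levi_civita g x b j s * weyl g x i s k l
                  + levi_civita g x b k s * weyl g x i j s l
                  + levi_civita g x b l s * weyl g x i j k s)"

definition nabla2_weyl ::
  "(real^'m \<Rightarrow> real^'m^'m) \<Rightarrow> real^'m \<Rightarrow> 'm \<Rightarrow> 'm \<Rightarrow> 'm \<Rightarrow> 'm \<Rightarrow> 'm \<Rightarrow> 'm \<Rightarrow> real" where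
  "nabla2_weyl g x a b i j k l = pd a (\<lambda>u. nabla_weyl g u b i j k l) x
     - (\<Sum>s\<in>UNIV. levi_civita g x a b s * nabla_weyl g x s i j k l
                  + levi_civita g x a i s * nabla_weyl g x b s j k l
                  + levi_civita g x a j s * nabla_weyl g x b i s k l
                  + levi_civita g x a k s * nabla_weyl g x b i j s l
                  + levi_civita g x a l s * nabla_weyl g x b i j k s)"

definition bach :: "(real^'m \<Rightarrow> real^'m^'m) \<Rightarrow> real^'m \<Rightarrow> 'm \<Rightarrow> 'm \<Rightarrow> real" where
  "bach g x i j =
     (\<Sum>k\<in>UNIV. \<Sum>l\<in>UNIV. \<Sum>a\<in>UNIV. \<Sum>b\<in>UNIV.
        matrix_inv (g x) $ k $ a * matrix_inv (g x) $ l $ b *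
        (nabla2_weyl g x a b k i j l + (1/2) * ricci g x a b * weyl g x k i j l))"

text \<open>A metric on the cotangent bundle is given by its components \<open>G c\<close> in the induced chart of each
  \<open>c\<close>.\<close>

definition bach_vanishes_on_cotangent_bundle ::
  "('a, 'n::finite) chart set \<Rightarrow>
   (('a, 'n::finite) chart \<Rightarrow> real^('n + 'n) \<Rightarrow> real^('n + 'n)^('n + 'n)) \<Rightarrow> bool" where
  "bach_vanishes_on_cotangent_bundle A G \<longleftrightarrow>
     (\<forall>c\<in>A. \<forall>q\<in>fst (induced_chart A c). \<forall>a b.
        bach (G c) (snd (induced_chart A c) q) a b = 0)"

end

theory Submission
  imports Defs
begin

text \<open>In induced coordinates the metric is \<open>2 dx\<^sup>i \<circ> dx\<^sub>i\<^sub>' + h\<^sub>i\<^sub>j dx\<^sup>i \<circ> dx\<^sup>j\<close> with \<open>h\<^sub>i\<^sub>j\<close>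
quadratic in the fibre coordinates \<open>\<xi>\<close>. Write \<open>F\<^sup>j\<close> for the vertical coordinate field \<open>\<partial>\<^sub>j\<^sub>'\<close> and
\<open>E\<^sub>i = \<partial>\<^sub>i - 1/2 \<Sum>j. h\<^sub>i\<^sub>j F\<^sup>j\<close>. This is a frame of null vectors with \<open>E\<^sub>i\<close> dual to \<open>F\<^sup>i\<close>, it is
parallel along the fibres, \<open>\<nabla>E\<close> has a component \<open>A\<close> along \<open>E\<close> and, over a surface, a single skew
component \<open>b\<close> along \<open>F\<close>, and \<open>\<nabla>F\<close> is dual to \<open>A\<close>. Here \<open>A\<close> is the affine connection corrected by a
tensor made of \<open>T\<close> and of \<open>\<tau>\<close>, the covector \<open>\<xi>\<close> composed with \<open>T\<close>. Since \<open>T\<close> is parallel,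
differentiating expressions in \<open>T\<close>, \<open>\<xi>\<close>, \<open>\<tau>\<close> produces Christoffel symbols only in the combination
that the covariant derivative removes; everything is then polynomial along the fibres and the Bach
tensor can be computed in closed form.

With \<open>t = tr T\<close> and \<open>d = det T\<close> the result is the following. The Bach tensor vanishes on pairs of
vertical vectors; its mixed part is \<open>t (t\<^sup>2 - 4 d) (2 T - t id) / 6\<close>; its horizontal part is a
quadratic form in \<open>\<xi>\<close>, \<open>\<tau>\<close> with coefficients in \<open>t\<close>, \<open>d\<close>, plus terms linear in \<open>\<Phi>\<close> and in the
curvature of the affine connection (lemmas \<open>bach_ff\<close>, \<open>bach_ef\<close>, \<open>bach_fe\<close>, \<open>bach_ee\<close>).

If the Bach tensor vanishes and \<open>T\<close> is not a multiple of the identity at a point, then the mixed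
part gives \<open>t (t\<^sup>2 - 4 d) = 0\<close>, and the horizontal part, contracted with the vector that \<open>\<xi>\<close>
annihilates, gives \<open>d (t\<^sup>2 - 10 d) = 0\<close>; together \<open>t = d = 0\<close>, so \<open>T\<close> is nilpotent there
(\<open>scalar_or_nilpotent\<close>). As \<open>T\<close> is parallel, \<open>t\<close> and \<open>d\<close> are constant on the connected surface, so
one alternative holds everywhere and the factor of the identity is constant. Conversely all terms
vanish pointwise when \<open>T\<close> is a multiple of the identity (\<open>bach_zero_scalar\<close>). For nilpotent \<open>T\<close>
the one remaining term is \<open>T R T\<close>, which vanishes because the curvature of a connection commutes
with its parallel endomorphisms and \<open>T\<^sup>2 = 0\<close> (\<open>bach_zero_nilpotent\<close>).

The passage from coordinates to the frame holds for every frame with constant Gram matrix and is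
made first (\<open>frame_comp_cov\<close>, \<open>curv_frame\<close>, \<open>contract2_bach\<close>).\<close>

section \<open>Calculus of smooth functions on open sets\<close>

text \<open>At a point where the functions are not differentiable both sides are the same arbitrary
  value, because the two functions have the same (empty) set of candidate derivatives.\<close>

lemma pd_cong_open:
  assumes "open S" "x \<in> S" "\<And>y. y \<in> S \<Longrightarrow> f y = g y"
  shows "pd i f x = pd i g x"
proof (cases "f differentiable (at x)")
  case True
  then show ?thesis
    unfolding pd_def using frechet_derivative_transform_within_open[OF True assms(1,2)] assms(3)
    by simp
next
  case False
  have "\<not> g differentiable (at x)"
    using False assms unfolding differentiable_def
    by (metis has_derivative_transform_within_open)
  moreover have "(f has_derivative D) (at x) = (g has_derivative D) (at x)" for D
    using has_derivative_transform_within_open[OF _ assms(1,2)] assms(3) by metis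
  ultimately show ?thesis
    by (simp add: pd_def frechet_derivative_def)
qed

lemma C_k_on_cong:
  assumes "open S" "\<And>y. y \<in> S \<Longrightarrow> f y = g y"
  shows "C_k_on k S f \<longleftrightarrow> C_k_on k S g"
  using assms(2)
proof (induction k arbitrary: f g)
  case 0
  then show ?case by (simp cong: continuous_on_cong)
next
  case (Suc k)
  have "f differentiable_on S \<longleftrightarrow> g differentiable_on S"
    unfolding differentiable_on_def
    using differentiable_transform_within[OF _ zero_less_one] Suc.prems by (smt (verit))
  moreover have "C_k_on k S (pd i f) \<longleftrightarrow> C_k_on k S (pd i g)" for i
    by (rule Suc.IH) (rule pd_cong_open[OF assms(1)], auto simp: Suc.prems)
  ultimately show ?case by simp
qed

lemma smooth_on_cong:
  assumes "open S" "\<And>y. y \<in> S \<Longrightarrow> f y = g y"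
  shows "smooth_on S f \<longleftrightarrow> smooth_on S g"
  using C_k_on_cong[OF assms] by (simp add: smooth_on_def)

lemma smooth_on_differentiable:
  assumes "smooth_on S f" "open S" "x \<in> S"
  shows "f differentiable (at x)"
proof -
  have "C_k_on (Suc 0) S f" using assms(1) unfolding smooth_on_def by blast
  then show ?thesis
    using assms(2,3) by (auto simp: differentiable_on_eq_differentiable_at)
qed

lemma smooth_on_has_derivative:
  assumes "smooth_on S f" "open S" "x \<in> S"
  shows "(f has_derivative frechet_derivative f (at x)) (at x)"
  using smooth_on_differentiable[OF assms] by (simp add: frechet_derivative_works)

lemma smooth_on_pd [simp, intro]: "smooth_on S f \<Longrightarrow> smooth_on S (pd i f)"
  unfolding smooth_on_def by (metis C_k_on.simps(2))

lemma smooth_on_continuous: "smooth_on S f \<Longrightarrow> continuous_on S f"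
  unfolding smooth_on_def by (metis C_k_on.simps(1))

lemma pd_eqI: "(f has_derivative D) (at x) \<Longrightarrow> pd i f x = D (axis i 1)"
  by (simp add: pd_def frechet_derivative_at[symmetric])

lemma pd_const [simp]: "pd i (\<lambda>x. c) x = 0"
  by (rule pd_eqI[THEN trans]) (auto intro: has_derivative_const)

lemma pd_component: "pd i (\<lambda>x. x $ k) x = (if k = i then 1 else 0)"
  by (rule pd_eqI[THEN trans], rule bounded_linear_imp_has_derivative, rule bounded_linear_vec_nth)
     (simp add: axis_def)

lemma pd_add:
  assumes "f differentiable (at x)" "g differentiable (at x)"
  shows "pd i (\<lambda>x. f x + g x) x = pd i f x + pd i g x"
  using pd_eqI[OF has_derivative_add[OF assms[unfolded frechet_derivative_works]]]
  by (simp add: pd_def)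

lemma pd_mult:
  assumes "f differentiable (at x)" "g differentiable (at x)"
  shows "pd i (\<lambda>x. f x * g x) x = pd i f x * g x + f x * pd i g x"
  using pd_eqI[OF has_derivative_mult[OF assms[unfolded frechet_derivative_works]]]
  by (simp add: pd_def)

lemma C_k_on_const: "C_k_on k S (\<lambda>x::real^'n. c)"
proof (induction k arbitrary: c)
  case (Suc k)
  have "pd i (\<lambda>x::real^'n. c) = (\<lambda>x. 0)" for i by (rule ext) simp
  then show ?case using Suc by simp
qed simp

lemma smooth_on_const [simp, intro]: "smooth_on S (\<lambda>x. c)"
  by (simp add: smooth_on_def C_k_on_const)

lemma C_k_on_mono: "C_k_on (Suc k) S f \<Longrightarrow> C_k_on k S f"
proof (induction k arbitrary: f)
  case 0
  then show ?case by (auto simp: differentiable_imp_continuous_on)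
qed simp

lemma C_k_on_add:
  assumes "open S" "C_k_on k S f" "C_k_on k S g"
  shows "C_k_on k S (\<lambda>x. f x + g x)"
  using assms(2,3)
proof (induction k arbitrary: f g)
  case 0
  then show ?case by (auto intro: continuous_on_add)
next
  case (Suc k)
  have d: "f differentiable (at x)" "g differentiable (at x)" if "x \<in> S" for x
    using Suc.prems assms(1) that by (auto simp: differentiable_on_eq_differentiable_at)
  have "C_k_on k S (pd i (\<lambda>x. f x + g x))" for i
    by (subst C_k_on_cong[OF assms(1), where g="\<lambda>x. pd i f x + pd i g x"])
       (use Suc d in \<open>auto intro!: pd_add\<close>)
  then show ?case using Suc.prems by (auto simp: differentiable_on_add)
qed

lemma C_k_on_mult:
  assumes "open S" "C_k_on k S f" "C_k_on k S g"
  shows "C_k_on k S (\<lambda>x. f x * g x)"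
  using assms(2,3)
proof (induction k arbitrary: f g)
  case 0
  then show ?case by (auto intro: continuous_on_mult)
next
  case (Suc k)
  have d: "f differentiable (at x)" "g differentiable (at x)" if "x \<in> S" for x
    using Suc.prems assms(1) that by (auto simp: differentiable_on_eq_differentiable_at)
  have "C_k_on k S f" "C_k_on k S g" using Suc.prems C_k_on_mono by blast+
  then have "C_k_on k S (pd i (\<lambda>x. f x * g x))" for i
    by (subst C_k_on_cong[OF assms(1), where g="\<lambda>x. pd i f x * g x + f x * pd i g x"])
       (use Suc d in \<open>auto intro!: pd_mult C_k_on_add assms(1)\<close>)
  then show ?case using Suc.prems by (auto simp: differentiable_on_mult)
qed

lemma smooth_on_add [simp]:
  "\<lbrakk>open S; smooth_on S f; smooth_on S g\<rbrakk> \<Longrightarrow> smooth_on S (\<lambda>x. f x + g x)"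
  by (simp add: smooth_on_def C_k_on_add)

lemma smooth_on_mult [simp]:
  "\<lbrakk>open S; smooth_on S f; smooth_on S g\<rbrakk> \<Longrightarrow> smooth_on S (\<lambda>x. f x * g x)"
  by (simp add: smooth_on_def C_k_on_mult)

lemma smooth_on_uminus [simp]: "\<lbrakk>open S; smooth_on S f\<rbrakk> \<Longrightarrow> smooth_on S (\<lambda>x. - f x)"
  using smooth_on_mult[of S "\<lambda>x. -1" f] by simp

lemma smooth_on_diff [simp]:
  "\<lbrakk>open S; smooth_on S f; smooth_on S g\<rbrakk> \<Longrightarrow> smooth_on S (\<lambda>x. f x - g x)"
  using smooth_on_add[of S f "\<lambda>x. - g x"] by simp

lemma smooth_on_divide_const [simp]: "\<lbrakk>open S; smooth_on S f\<rbrakk> \<Longrightarrow> smooth_on S (\<lambda>x. f x / c)"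
  using smooth_on_mult[of S f "\<lambda>x. inverse c"] by (simp add: field_simps)

lemma smooth_on_power [simp]: "\<lbrakk>open S; smooth_on S f\<rbrakk> \<Longrightarrow> smooth_on S (\<lambda>x. f x ^ n)"
  by (induction n) auto

lemma smooth_on_sum [simp]:
  "\<lbrakk>open S; \<And>i. i \<in> I \<Longrightarrow> smooth_on S (f i)\<rbrakk> \<Longrightarrow> smooth_on S (\<lambda>x. \<Sum>i\<in>I. f i x)"
  by (induction I rule: infinite_finite_induct) auto

lemma smooth_on_component [simp]: "smooth_on S (\<lambda>x. x $ k)"
proof -
  have "C_k_on n S (\<lambda>x. x $ k)" for n
  proof (cases n)
    case 0
    then show ?thesis by (auto intro: continuous_intros)
  next
    case (Suc m)
    have "pd i (\<lambda>x. x $ k) = (\<lambda>x. if k = i then 1 else 0)" for i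
      by (rule ext) (rule pd_component)
    moreover have "(\<lambda>x. x $ k) differentiable_on S"
      by (intro linear_imp_differentiable_on bounded_linear.linear bounded_linear_vec_nth)
    ultimately show ?thesis using Suc by (simp add: C_k_on_const)
  qed
  then show ?thesis by (simp add: smooth_on_def)
qed

subsection \<open>Symmetry of second partial derivatives\<close>

lemma pd_has_real_derivative:
  assumes "smooth_on S f" "open S" "z + t *\<^sub>R axis i 1 \<in> S"
  shows "((\<lambda>t. f (z + t *\<^sub>R axis i 1)) has_real_derivative pd i f (z + t *\<^sub>R axis i 1)) (at t)"
proof -
  let ?D = "frechet_derivative f (at (z + t *\<^sub>R axis i 1))"
  have D: "(f has_derivative ?D) (at (z + t *\<^sub>R axis i 1))"
    by (rule smooth_on_has_derivative[OF assms])
  have "((\<lambda>t. z + t *\<^sub>R axis i 1) has_derivative (\<lambda>s. s *\<^sub>R axis i 1)) (at t)"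
    by (auto intro!: derivative_eq_intros)
  from has_derivative_compose[OF this D]
  have "((\<lambda>t. f (z + t *\<^sub>R axis i 1)) has_derivative (\<lambda>s. ?D (s *\<^sub>R axis i 1))) (at t)" .
  moreover have "?D (s *\<^sub>R axis i 1) = pd i f (z + t *\<^sub>R axis i 1) * s" for s
    using has_derivative_linear[OF D] by (simp add: pd_def linear_cmul)
  ultimately show ?thesis by (simp add: has_field_derivative_def)
qed

text \<open>Two applications of the mean value theorem; the roles of the two directions can be exchanged on
  the left-hand side, which is why the mixed derivatives agree in the limit.\<close>

lemma second_difference_mean_value:
  fixes z :: "real^'n"
  assumes f: "smooth_on S f" "open S" and s: "0 < s"
    and box: "\<And>u v. 0 \<le> u \<Longrightarrow> u \<le> s \<Longrightarrow> 0 \<le> v \<Longrightarrow> v \<le> s \<Longrightarrow> z + u *\<^sub>R axis i 1 + v *\<^sub>R axis j 1 \<in> S"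
  obtains u v where "0 < u" "u < s" "0 < v" "v < s"
    "f (z + s *\<^sub>R axis i 1 + s *\<^sub>R axis j 1) - f (z + s *\<^sub>R axis i 1)
       - f (z + s *\<^sub>R axis j 1) + f z = s * s * pd j (pd i f) (z + u *\<^sub>R axis i 1 + v *\<^sub>R axis j 1)"
proof -
  let ?a = "axis i 1 :: real^'n" and ?b = "axis j 1 :: real^'n"
  have "((\<lambda>u. f (z + s *\<^sub>R ?b + u *\<^sub>R ?a) - f (z + u *\<^sub>R ?a)) has_real_derivative
      pd i f (z + s *\<^sub>R ?b + u *\<^sub>R ?a) - pd i f (z + u *\<^sub>R ?a)) (at u)" if "0 \<le> u" "u \<le> s" for u
    using box[OF that, of s] box[OF that, of 0] s
    by (intro DERIV_diff pd_has_real_derivative) (use f in \<open>auto simp: algebra_simps\<close>)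
  from MVT2[OF s this] obtain u where u: "0 < u" "u < s" and
    1: "f (z + s *\<^sub>R ?b + s *\<^sub>R ?a) - f (z + s *\<^sub>R ?a) - (f (z + s *\<^sub>R ?b + 0 *\<^sub>R ?a) - f (z + 0 *\<^sub>R ?a))
      = (s - 0) * (pd i f (z + s *\<^sub>R ?b + u *\<^sub>R ?a) - pd i f (z + u *\<^sub>R ?a))"
    by (metis (no_types, lifting))
  have "((\<lambda>v. pd i f (z + u *\<^sub>R ?a + v *\<^sub>R ?b)) has_real_derivative
      pd j (pd i f) (z + u *\<^sub>R ?a + v *\<^sub>R ?b)) (at v)" if "0 \<le> v" "v \<le> s" for v
    using box[of u v] u that f by (intro pd_has_real_derivative) auto
  from MVT2[OF s this] obtain v where v: "0 < v" "v < s" and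
    2: "pd i f (z + u *\<^sub>R ?a + s *\<^sub>R ?b) - pd i f (z + u *\<^sub>R ?a + 0 *\<^sub>R ?b)
      = (s - 0) * pd j (pd i f) (z + u *\<^sub>R ?a + v *\<^sub>R ?b)"
    by (metis (no_types, lifting))
  show thesis
    using 1 2 by (intro that[OF u v]) (simp add: algebra_simps)
qed

text \<open>If the two mixed derivatives differed at a point, they would differ by a fixed amount near
  it; but they take a common value, the second difference divided by its step squared, at suitable
  points arbitrarily close.\<close>

lemma pd_commute:
  assumes f: "smooth_on S f" "open S" "z \<in> S"
  shows "pd i (pd j f) z = pd j (pd i f) z"
proof (rule ccontr)
  let ?a = "axis i 1 :: real^_" and ?b = "axis j 1 :: real^_"
  assume ne: "\<not> ?thesis"
  define e where "e = \<bar>pd i (pd j f) z - pd j (pd i f) z\<bar> / 2"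
  have e: "e > 0" using ne by (simp add: e_def)
  obtain r where r: "r > 0" "ball z r \<subseteq> S" using f openE by blast
  have lim: "\<exists>d>0. \<forall>y\<in>S. dist y z < d \<longrightarrow> dist (F y) (F z) < e" if "smooth_on S F" for F
    using smooth_on_continuous[OF that] f(3) e unfolding continuous_on_iff by blast
  obtain d1 where d1: "d1 > 0"
    "\<And>y. y \<in> S \<Longrightarrow> dist y z < d1 \<Longrightarrow> dist (pd i (pd j f) y) (pd i (pd j f) z) < e"
    using lim[of "pd i (pd j f)"] f by auto
  obtain d2 where d2: "d2 > 0"
    "\<And>y. y \<in> S \<Longrightarrow> dist y z < d2 \<Longrightarrow> dist (pd j (pd i f) y) (pd j (pd i f) z) < e"
    using lim[of "pd j (pd i f)"] f by auto
  define s where "s = min r (min d1 d2) / 3"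
  have s: "s > 0" "2 * s < r" "2 * s < d1" "2 * s < d2"
    using r d1 d2 by (auto simp: s_def min_def)
  have near: "dist (z + u *\<^sub>R ?a + v *\<^sub>R ?b) z \<le> 2 * s" if "0 \<le> u" "u \<le> s" "0 \<le> v" "v \<le> s" for u v
  proof -
    have "norm (u *\<^sub>R ?a + v *\<^sub>R ?b) \<le> \<bar>u\<bar> + \<bar>v\<bar>"
      by (rule norm_triangle_le) simp
    then show ?thesis using that by (simp add: dist_norm add.assoc)
  qed
  have box: "z + u *\<^sub>R ?a + v *\<^sub>R ?b \<in> S" if "0 \<le> u" "u \<le> s" "0 \<le> v" "v \<le> s" for u v
    using near[OF that] s r by (auto simp: subset_iff dist_commute)
  then have box': "z + u *\<^sub>R ?b + v *\<^sub>R ?a \<in> S" if "0 \<le> u" "u \<le> s" "0 \<le> v" "v \<le> s" for u v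
    using that by (simp add: add.assoc add.commute[of "u *\<^sub>R ?b"])
  obtain u v where uv: "0 < u" "u < s" "0 < v" "v < s"
    and 1: "f (z + s *\<^sub>R ?a + s *\<^sub>R ?b) - f (z + s *\<^sub>R ?a) - f (z + s *\<^sub>R ?b) + f z
       = s * s * pd j (pd i f) (z + u *\<^sub>R ?a + v *\<^sub>R ?b)"
    by (rule second_difference_mean_value[OF f(1,2) s(1) box])
  obtain u' v' where uv': "0 < u'" "u' < s" "0 < v'" "v' < s"
    and 2: "f (z + s *\<^sub>R ?b + s *\<^sub>R ?a) - f (z + s *\<^sub>R ?b) - f (z + s *\<^sub>R ?a) + f z
       = s * s * pd i (pd j f) (z + u' *\<^sub>R ?b + v' *\<^sub>R ?a)"
    by (rule second_difference_mean_value[OF f(1,2) s(1) box'])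
  have eq: "pd i (pd j f) (z + v' *\<^sub>R ?a + u' *\<^sub>R ?b) = pd j (pd i f) (z + u *\<^sub>R ?a + v *\<^sub>R ?b)"
    using 1 2 s(1) by (simp add: algebra_simps)
  have "dist (pd i (pd j f) (z + v' *\<^sub>R ?a + u' *\<^sub>R ?b)) (pd i (pd j f) z) < e"
    using uv' near[of v' u'] box[of v' u'] s by (intro d1) auto
  moreover have "dist (pd j (pd i f) (z + u *\<^sub>R ?a + v *\<^sub>R ?b)) (pd j (pd i f) z) < e"
    using uv near[of u v] box[of u v] s by (intro d2) auto
  ultimately show False
    unfolding eq dist_real_def e_def by argo
qed

section \<open>Tensor calculus in a moving frame\<close>

text \<open>Expanding a tensor or an inverse metric over the frame puts a sum over the frame inside the
  coordinate sums; these reorderings bring it to the front.\<close>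

lemma sum_pull2: "(\<Sum>i\<in>A. \<Sum>j\<in>B. \<Sum>c\<in>Z. H i j c) = (\<Sum>c\<in>Z. \<Sum>i\<in>A. \<Sum>j\<in>B. (H i j c :: real))"
  by (rule trans[OF sum.cong[OF refl] sum.swap], rule sum.swap)

lemma sum_pull3: "(\<Sum>i\<in>A. \<Sum>j\<in>B. \<Sum>k\<in>C. \<Sum>c\<in>Z. H i j k c)
    = (\<Sum>c\<in>Z. \<Sum>i\<in>A. \<Sum>j\<in>B. \<Sum>k\<in>C. (H i j k c :: real))"
  by (rule trans[OF sum.cong[OF refl] sum.swap], rule sum_pull2)

lemma sum_pull4: "(\<Sum>i\<in>A. \<Sum>j\<in>B. \<Sum>k\<in>C. \<Sum>l\<in>D. \<Sum>c\<in>Z. H i j k l c)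
    = (\<Sum>c\<in>Z. \<Sum>i\<in>A. \<Sum>j\<in>B. \<Sum>k\<in>C. \<Sum>l\<in>D. (H i j k l c :: real))"
  by (rule trans[OF sum.cong[OF refl] sum.swap], rule sum_pull3)

lemma sum_pull5: "(\<Sum>i\<in>A. \<Sum>j\<in>B. \<Sum>k\<in>C. \<Sum>l\<in>D. \<Sum>a\<in>E. \<Sum>c\<in>Z. H i j k l a c)
    = (\<Sum>c\<in>Z. \<Sum>i\<in>A. \<Sum>j\<in>B. \<Sum>k\<in>C. \<Sum>l\<in>D. \<Sum>a\<in>E. (H i j k l a c :: real))"
  by (rule trans[OF sum.cong[OF refl] sum.swap], rule sum_pull4)

lemma sum_pull6: "(\<Sum>i\<in>A. \<Sum>j\<in>B. \<Sum>k\<in>C. \<Sum>l\<in>D. \<Sum>a\<in>E. \<Sum>b\<in>F. \<Sum>c\<in>Z. H i j k l a b c)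
    = (\<Sum>c\<in>Z. \<Sum>i\<in>A. \<Sum>j\<in>B. \<Sum>k\<in>C. \<Sum>l\<in>D. \<Sum>a\<in>E. \<Sum>b\<in>F. (H i j k l a b c :: real))"
  by (rule trans[OF sum.cong[OF refl] sum.swap], rule sum_pull5)

definition fd :: "(real^'m \<Rightarrow> real^'m) \<Rightarrow> (real^'m \<Rightarrow> real) \<Rightarrow> real^'m \<Rightarrow> real" where
  "fd V f x = (\<Sum>i\<in>UNIV. V x $ i * pd i f x)"

lemma fd_const [simp]: "fd V (\<lambda>u. c) x = 0"
  by (simp add: fd_def)

lemma fd_cong:
  assumes "open U" "x \<in> U" "\<And>y. y \<in> U \<Longrightarrow> f y = g y"
  shows "fd V f x = fd V g x"
  unfolding fd_def using pd_cong_open[OF assms] by simp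

context
  fixes U :: "(real^'m) set" and x :: "real^'m"
  assumes U: "open U" "x \<in> U"
begin

lemma fd_add:
  "smooth_on U f \<Longrightarrow> smooth_on U g \<Longrightarrow> fd V (\<lambda>u. f u + g u) x = fd V f x + fd V g x"
  using U by (simp add: fd_def pd_add smooth_on_differentiable distrib_left sum.distrib)

lemma fd_mult:
  "smooth_on U f \<Longrightarrow> smooth_on U g \<Longrightarrow> fd V (\<lambda>u. f u * g u) x = fd V f x * g x + f x * fd V g x"
  using U by (simp add: fd_def pd_mult smooth_on_differentiable distrib_left sum.distrib
      sum_distrib_left sum_distrib_right mult_ac)

lemma fd_uminus: "smooth_on U f \<Longrightarrow> fd V (\<lambda>u. - f u) x = - fd V f x"
  using fd_mult[of "\<lambda>u. -1" f V] by simp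

lemma fd_diff:
  "smooth_on U f \<Longrightarrow> smooth_on U g \<Longrightarrow> fd V (\<lambda>u. f u - g u) x = fd V f x - fd V g x"
  using fd_add[of f "\<lambda>u. - g u" V] fd_uminus[of g V] U by simp

lemma fd_divide: "smooth_on U f \<Longrightarrow> fd V (\<lambda>u. f u / c) x = fd V f x / c"
  using fd_mult[of f "\<lambda>u. inverse c" V] by (simp add: divide_inverse)

lemma fd_sum:
  "(\<And>i. i \<in> I \<Longrightarrow> smooth_on U (f i)) \<Longrightarrow> fd V (\<lambda>u. \<Sum>i\<in>I. f i u) x = (\<Sum>i\<in>I. fd V (f i) x)"
  using U by (induction I rule: infinite_finite_induct) (simp_all add: fd_add)

lemma fd_power2: "smooth_on U f \<Longrightarrow> fd V (\<lambda>u. (f u)^2) x = 2 * f x * fd V f x"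
  using fd_mult[of f f V] by (simp add: power2_eq_square)

lemmas fd_rules = fd_add fd_mult fd_uminus fd_diff fd_divide fd_sum fd_power2

end

lemma smooth_on_fd [simp]:
  "\<lbrakk>open U; \<And>i. smooth_on U (\<lambda>u. V u $ i); smooth_on U f\<rbrakk> \<Longrightarrow> smooth_on U (fd V f)"
  unfolding fd_def[abs_def] by (intro smooth_on_sum smooth_on_mult) auto

subsection \<open>Tensors with an arbitrary number of lower indices\<close>

text \<open>A covariant tensor of rank \<open>n\<close> is a function of index lists of length \<open>n\<close>. This makes the
  frame components of a covariant derivative accessible to induction on the rank.\<close>

primrec frame_comp :: "('m \<Rightarrow> real^'m) \<Rightarrow> ('m list \<Rightarrow> real) \<Rightarrow> 'm list \<Rightarrow> real" where
  "frame_comp e T [] = T []"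
| "frame_comp e T (a # as) = (\<Sum>i\<in>UNIV. e a $ i * frame_comp e (\<lambda>is. T (i # is)) as)"

text \<open>The zeroth order part of a covariant derivative: one sum for every index, with \<open>G i s\<close> the
  coefficient that turns the index \<open>i\<close> into \<open>s\<close>.\<close>

primrec conn :: "('m::finite \<Rightarrow> 'm \<Rightarrow> real) \<Rightarrow> ('m list \<Rightarrow> real) \<Rightarrow> 'm list \<Rightarrow> real" where
  "conn G T [] = 0"
| "conn G T (i # is) = (\<Sum>s\<in>UNIV. G i s * T (s # is)) + conn G (\<lambda>is. T (i # is)) is"

lemma frame_comp_sum:
  "frame_comp e (\<lambda>is. \<Sum>s\<in>A. c s * T s is) as = (\<Sum>s\<in>A. c s * frame_comp e (T s) as)"
proof (induction as arbitrary: T)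
  case (Cons a as)
  show ?case
    by (simp add: Cons.IH sum_distrib_left, subst sum.swap) (simp add: mult_ac)
qed simp

lemma frame_comp_add:
  "frame_comp e (\<lambda>is. T is + S is) as = frame_comp e T as + frame_comp e S as"
  by (induction as arbitrary: T S) (simp_all add: distrib_left sum.distrib)

lemma frame_comp_diff:
  "frame_comp e (\<lambda>is. T is - S is) as = frame_comp e T as - frame_comp e S as"
  by (induction as arbitrary: T S) (simp_all add: right_diff_distrib sum_subtractf)

lemma frame_comp_scale:
  "frame_comp e (\<lambda>is. c * T is) as = c * frame_comp e T as"
  by (induction as arbitrary: T) (simp_all add: sum_distrib_left mult_ac)

lemma conn_sum:
  "conn G (\<lambda>is. \<Sum>s\<in>A. c s * T s is) as = (\<Sum>s\<in>A. c s * conn G (T s) as)"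
proof (induction as arbitrary: T)
  case (Cons a as)
  have "(\<Sum>s\<in>UNIV. G a s * (\<Sum>r\<in>A. c r * T r (s # as))) =
      (\<Sum>r\<in>A. c r * (\<Sum>s\<in>UNIV. G a s * T r (s # as)))"
    by (simp add: sum_distrib_left, subst sum.swap) (simp add: mult_ac)
  then show ?case by (simp add: Cons.IH distrib_left sum.distrib)
qed simp

lemma smooth_on_frame_comp:
  assumes "open U" "\<And>a i. smooth_on U (\<lambda>u. e a u $ i)" "\<And>is. smooth_on U (\<lambda>u. T u is)"
  shows "smooth_on U (\<lambda>u. frame_comp (\<lambda>a. e a u) (T u) as)"
  using assms(3) by (induction as arbitrary: T) (auto simp: assms)

lemma smooth_on_conn:
  assumes "open U" "\<And>i s. smooth_on U (\<lambda>u. G u i s)" "\<And>is. smooth_on U (\<lambda>u. T u is)"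
  shows "smooth_on U (\<lambda>u. conn (G u) (T u) as)"
  using assms(3) by (induction as arbitrary: T) (auto simp: assms)

text \<open>The first index of the result is the direction of differentiation. Rank-zero tensors have no
  counterpart, whence the value \<open>0\<close> at the empty list; the equations for \<open>cov\<close> and \<open>cov_frame\<close>
  then hold for all lists.\<close>

primrec cov :: "(real^'m \<Rightarrow> real^'m^'m) \<Rightarrow> (real^'m \<Rightarrow> 'm list \<Rightarrow> real) \<Rightarrow>
    real^'m \<Rightarrow> 'm list \<Rightarrow> real" where
  "cov g T x [] = 0"
| "cov g T x (b # is) = pd b (\<lambda>u. T u is) x - conn (levi_civita g x b) (T x) is"

text \<open>\<open>om x a b c\<close> is the \<open>e\<^sub>c\<close>-component of \<open>\<nabla>\<^bsub>e\<^sub>a\<^esub> e\<^sub>b\<close>.\<close>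

primrec cov_frame :: "('m::finite \<Rightarrow> real^'m \<Rightarrow> real^'m) \<Rightarrow> (real^'m \<Rightarrow> 'm \<Rightarrow> 'm \<Rightarrow> 'm \<Rightarrow> real) \<Rightarrow>
    (real^'m \<Rightarrow> 'm list \<Rightarrow> real) \<Rightarrow> real^'m \<Rightarrow> 'm list \<Rightarrow> real" where
  "cov_frame e om T x [] = 0"
| "cov_frame e om T x (a # as) = fd (e a) (\<lambda>u. T u as) x - conn (om x a) (T x) as"

locale moving_frame =
  fixes U :: "(real^'m) set" and g :: "real^'m \<Rightarrow> real^'m^'m"
    and e :: "'m \<Rightarrow> real^'m \<Rightarrow> real^'m" and om :: "real^'m \<Rightarrow> 'm \<Rightarrow> 'm \<Rightarrow> 'm \<Rightarrow> real"
  assumes open_U: "open U"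
    and smooth_e: "\<And>a i. smooth_on U (\<lambda>u. e a u $ i)"
    and smooth_om: "\<And>a b c. smooth_on U (\<lambda>u. om u a b c)"
    and smooth_lc: "\<And>i j k. smooth_on U (\<lambda>u. levi_civita g u i j k)"
    and lc_sym: "\<And>x i j k. x \<in> U \<Longrightarrow> levi_civita g x i j k = levi_civita g x j i k"
    and structure_eq: "\<And>x a b k. x \<in> U \<Longrightarrow>
      fd (e a) (\<lambda>u. e b u $ k) x
        + (\<Sum>i\<in>UNIV. \<Sum>j\<in>UNIV. e a x $ i * e b x $ j * levi_civita g x i j k)
      = (\<Sum>c\<in>UNIV. om x a b c * e c x $ k)"
begin

lemmas fdr = fd_rules[OF open_U]

text \<open>Induction on the rank: splitting off the first index produces the derivative of one more
  frame vector, and the structure equation trades it, together with the Christoffel term of that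
  index, for the frame connection coefficients.\<close>

lemma frame_comp_cov_aux:
  assumes x: "x \<in> U" and T: "\<And>is. smooth_on U (\<lambda>u. T u is)"
  shows "(\<Sum>b\<in>UNIV. e a x $ b * frame_comp (\<lambda>a. e a x) (\<lambda>is. cov g T x (b # is)) as)
    = fd (e a) (\<lambda>u. frame_comp (\<lambda>a. e a u) (T u) as) x
      - conn (om x a) (frame_comp (\<lambda>a. e a x) (T x)) as"
  using T
proof (induction as arbitrary: T)
  case Nil
  then show ?case by (simp add: fd_def)
next
  case (Cons c as)
  note sT = Cons.prems
  let ?e = "\<lambda>a. e a x"
  let ?F = "\<lambda>i u. frame_comp (\<lambda>a. e a u) (\<lambda>is. T u (i # is)) as"
  have sF: "smooth_on U (?F i)" for i
    by (rule smooth_on_frame_comp[OF open_U smooth_e]) (rule sT)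
  have L: "cov g T x (b # i # is) = cov g (\<lambda>u is. T u (i # is)) x (b # is)
      - (\<Sum>s\<in>UNIV. levi_civita g x b i s * T x (s # is))" for b i "is"
    by simp
  have "(\<Sum>b\<in>UNIV. e a x $ b * frame_comp ?e (\<lambda>is. cov g T x (b # is)) (c # as)) =
     (\<Sum>b\<in>UNIV. \<Sum>i\<in>UNIV. e a x $ b * (e c x $ i *
        (frame_comp ?e (\<lambda>is. cov g (\<lambda>u is. T u (i # is)) x (b # is)) as
         - (\<Sum>s\<in>UNIV. levi_civita g x b i s * ?F s x))))"
    unfolding frame_comp.simps L frame_comp_diff frame_comp_sum sum_distrib_left ..
  also have "\<dots> = (\<Sum>i\<in>UNIV. e c x $ i *
        (\<Sum>b\<in>UNIV. e a x $ b * frame_comp ?e (\<lambda>is. cov g (\<lambda>u is. T u (i # is)) x (b # is)) as))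
      - (\<Sum>b\<in>UNIV. \<Sum>i\<in>UNIV. \<Sum>s\<in>UNIV. e a x $ b * e c x $ i * levi_civita g x b i s * ?F s x)"
  proof -
    have "(\<Sum>b\<in>UNIV. \<Sum>i\<in>UNIV. e a x $ b * (e c x $ i * H b i)) =
      (\<Sum>i\<in>UNIV. e c x $ i * (\<Sum>b\<in>UNIV. e a x $ b * H b i))" for H
      by (simp add: sum_distrib_left, subst sum.swap) (simp add: mult_ac)
    from this[of "\<lambda>b i. frame_comp ?e (\<lambda>is. cov g (\<lambda>u is. T u (i # is)) x (b # is)) as"]
    show ?thesis
      by (simp add: right_diff_distrib sum_subtractf sum_distrib_left mult.assoc del: cov.simps)
  qed
  also have "(\<Sum>b\<in>UNIV. \<Sum>i\<in>UNIV. \<Sum>s\<in>UNIV. e a x $ b * e c x $ i * levi_civita g x b i s * ?F s x)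
      = (\<Sum>s\<in>UNIV. (\<Sum>b\<in>UNIV. \<Sum>i\<in>UNIV. e a x $ b * e c x $ i * levi_civita g x b i s) * ?F s x)"
    unfolding sum_distrib_right by (rule sum_pull2)
  also have "\<dots> = (\<Sum>s\<in>UNIV. (\<Sum>f\<in>UNIV. om x a c f * e f x $ s) * ?F s x)
      - (\<Sum>s\<in>UNIV. fd (e a) (\<lambda>u. e c u $ s) x * ?F s x)"
    unfolding sum_subtractf[symmetric] left_diff_distrib[symmetric]
    using structure_eq[OF x, of a c, symmetric] by simp
  also have "(\<Sum>s\<in>UNIV. (\<Sum>f\<in>UNIV. om x a c f * e f x $ s) * ?F s x)
      = (\<Sum>f\<in>UNIV. om x a c f * frame_comp ?e (T x) (f # as))"
    by (simp add: sum_distrib_left sum_distrib_right, subst sum.swap) (simp add: mult_ac)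
  also have "(\<Sum>i\<in>UNIV. e c x $ i *
        (\<Sum>b\<in>UNIV. e a x $ b * frame_comp ?e (\<lambda>is. cov g (\<lambda>u is. T u (i # is)) x (b # is)) as))
     = (\<Sum>i\<in>UNIV. e c x $ i * (fd (e a) (?F i) x
          - conn (om x a) (frame_comp ?e (\<lambda>is. T x (i # is))) as))"
    by (subst Cons.IH) (auto intro: sT)
  also have "\<dots> = (\<Sum>i\<in>UNIV. e c x $ i * fd (e a) (?F i) x)
      - conn (om x a) (\<lambda>as. frame_comp ?e (T x) (c # as)) as"
    by (simp add: right_diff_distrib sum_subtractf conn_sum)
  finally have "(\<Sum>b\<in>UNIV. e a x $ b * frame_comp ?e (\<lambda>is. cov g T x (b # is)) (c # as)) =
    (\<Sum>i\<in>UNIV. e c x $ i * fd (e a) (?F i) x) + (\<Sum>s\<in>UNIV. fd (e a) (\<lambda>u. e c u $ s) x * ?F s x)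
    - conn (om x a) (frame_comp ?e (T x)) (c # as)"
    by simp
  also have "(\<Sum>i\<in>UNIV. e c x $ i * fd (e a) (?F i) x)
      + (\<Sum>s\<in>UNIV. fd (e a) (\<lambda>u. e c u $ s) x * ?F s x)
    = fd (e a) (\<lambda>u. frame_comp (\<lambda>a. e a u) (T u) (c # as)) x"
    using sF smooth_e x open_U
    by (simp add: fdr sum.distrib[symmetric]) (intro sum.cong refl, simp)
  finally show ?case .
qed

lemma frame_comp_cov:
  assumes "x \<in> U" "\<And>is. smooth_on U (\<lambda>u. T u is)"
  shows "frame_comp (\<lambda>a. e a x) (cov g T x)
    = cov_frame e om (\<lambda>u. frame_comp (\<lambda>a. e a u) (T u)) x"
proof
  fix as show "frame_comp (\<lambda>a. e a x) (cov g T x) as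
    = cov_frame e om (\<lambda>u. frame_comp (\<lambda>a. e a u) (T u)) x as"
    using frame_comp_cov_aux[OF assms] by (cases as) auto
qed

lemma smooth_on_cov:
  assumes "\<And>is. smooth_on U (\<lambda>u. T u is)"
  shows "smooth_on U (\<lambda>u. cov g T u is)"
proof (cases "is")
  case (Cons b bs)
  have "smooth_on U (pd b (\<lambda>u. T u bs))" using assms by blast
  then show ?thesis
    using Cons assms open_U by (auto intro!: smooth_on_diff smooth_on_conn smooth_lc)
qed simp

lemma cov_frame_cong:
  assumes "x \<in> U" "\<And>u. u \<in> U \<Longrightarrow> T u = S u"
  shows "cov_frame e om T x = cov_frame e om S x"
proof
  fix as
  show "cov_frame e om T x as = cov_frame e om S x as"
    using assms fd_cong[OF open_U assms(1), of "\<lambda>u. T u bs" "\<lambda>u. S u bs" for bs]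
    by (cases as) auto
qed

text \<open>Frame components of a covariant derivative again form a smooth tensor, so second derivatives
  need no new argument.\<close>

lemma frame_comp_cov2:
  assumes "x \<in> U" "\<And>is. smooth_on U (\<lambda>u. T u is)"
  shows "frame_comp (\<lambda>a. e a x) (cov g (cov g T) x)
    = cov_frame e om (cov_frame e om (\<lambda>u. frame_comp (\<lambda>a. e a u) (T u))) x"
  using assms by (simp add: frame_comp_cov smooth_on_cov cong: cov_frame_cong)

subsection \<open>Curvature\<close>

text \<open>The classical formula for curvature in a moving frame; the last product accounts for the
  brackets of the frame fields, whose components are the antisymmetrised connection coefficients
  because the connection is torsion free.\<close>

definition curv_frame :: "real^'m \<Rightarrow> 'm \<Rightarrow> 'm \<Rightarrow> 'm \<Rightarrow> 'm \<Rightarrow> real" where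
  "curv_frame x a b c d =
     fd (e a) (\<lambda>u. om u b c d) x - fd (e b) (\<lambda>u. om u a c d) x
     + (\<Sum>f\<in>UNIV. om x b c f * om x a f d - om x a c f * om x b f d
          - (om x a b f - om x b a f) * om x f c d)"

lemma curv_frame:
  assumes x: "x \<in> U"
  shows "(\<Sum>i\<in>UNIV. \<Sum>j\<in>UNIV. \<Sum>k\<in>UNIV. e a x $ i * e b x $ j * e c x $ k * curv_op g x i j k l)
    = (\<Sum>d\<in>UNIV. curv_frame x a b c d * e d x $ l)"
proof -
  let ?L = "levi_civita g x"
  \<comment> \<open>the bilinear expression in the connection coefficients\<close>
  define B where "B X Y k = (\<Sum>i\<in>UNIV. \<Sum>j\<in>UNIV. X i * Y j * ?L i j k)" for X Y :: "'m \<Rightarrow> real" and k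
  let ?E = "\<lambda>a i. e a x $ i"
  define D where "D a b k = fd (e a) (\<lambda>u. e b u $ k) x" for a b k
  have B_diff1: "B (\<lambda>i. X i - X' i) Y k = B X Y k - B X' Y k"
    and B_diff2: "B X (\<lambda>i. Y i - Y' i) k = B X Y k - B X Y' k" for X X' Y Y' k
    by (simp_all add: B_def left_diff_distrib right_diff_distrib sum_subtractf)
  have B_sum1: "B (\<lambda>i. \<Sum>f\<in>UNIV. t f * Z f i) Y k = (\<Sum>f\<in>UNIV. t f * B (Z f) Y k)"
    for t :: "'m \<Rightarrow> real" and Z Y k
  proof -
    have "B (\<lambda>i. \<Sum>f\<in>UNIV. t f * Z f i) Y k
       = (\<Sum>i\<in>UNIV. \<Sum>f\<in>UNIV. \<Sum>j\<in>UNIV. t f * Z f i * Y j * ?L i j k)"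
      unfolding B_def by (rule sum.cong[OF refl], subst sum.swap) (simp add: sum_distrib_right)
    also have "\<dots> = (\<Sum>f\<in>UNIV. \<Sum>i\<in>UNIV. \<Sum>j\<in>UNIV. t f * Z f i * Y j * ?L i j k)"
      by (rule sum.swap)
    finally show ?thesis by (simp add: B_def sum_distrib_left mult_ac)
  qed
  have B_sym: "B X Y k = B Y X k" for X Y k
    unfolding B_def by (subst sum.swap) (simp add: lc_sym[OF x, of _ _ k] mult_ac)
  have B_sum2: "B Y (\<lambda>i. \<Sum>f\<in>UNIV. t f * Z f i) k = (\<Sum>f\<in>UNIV. t f * B Y (Z f) k)"
    for t :: "'m \<Rightarrow> real" and Z Y k
    unfolding B_sym[of Y] by (rule B_sum1)
  have D: "D a b k = (\<Sum>f\<in>UNIV. om x a b f * ?E f k) - B (?E a) (?E b) k" for a b k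
    using structure_eq[OF x, of a b k] by (simp add: D_def B_def)
  define t where "t f = om x a b f - om x b a f" for f
  have tors: "D a b k - D b a k = (\<Sum>f\<in>UNIV. t f * ?E f k)" for k
    unfolding D B_sym[of "?E b"] by (simp add: t_def left_diff_distrib sum_subtractf)
  define DD where "DD a b = fd (e a) (\<lambda>u. fd (e b) (\<lambda>u. e c u $ l) u) x" for a b
  note sm = open_U smooth_e smooth_om smooth_lc
  \<comment> \<open>the commutator of the two frame derivatives, once as a commutator of vector fields\<close>
  have DD1: "DD a b = (\<Sum>j\<in>UNIV. D a b j * pd j (\<lambda>u. e c u $ l) x)
      + (\<Sum>i\<in>UNIV. \<Sum>j\<in>UNIV. ?E a i * ?E b j * pd i (pd j (\<lambda>u. e c u $ l)) x)" for a b
  proof -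
    have "DD a b = (\<Sum>j\<in>UNIV. D a b j * pd j (\<lambda>u. e c u $ l) x
        + ?E b j * fd (e a) (pd j (\<lambda>u. e c u $ l)) x)"
      unfolding DD_def fd_def[of "e b"] using x sm by (simp add: fdr D_def)
    then show ?thesis
      by (simp add: sum.distrib fd_def sum_distrib_left mult_ac) (rule sum.swap)
  qed
  have "DD a b - DD b a = (\<Sum>j\<in>UNIV. (D a b j - D b a j) * pd j (\<lambda>u. e c u $ l) x)"
  proof -
    have "(\<Sum>i\<in>UNIV. \<Sum>j\<in>UNIV. ?E a i * ?E b j * pd i (pd j (\<lambda>u. e c u $ l)) x)
        = (\<Sum>i\<in>UNIV. \<Sum>j\<in>UNIV. ?E b i * ?E a j * pd i (pd j (\<lambda>u. e c u $ l)) x)"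
      using pd_commute[OF smooth_e open_U x, of _ _ c l] by (subst sum.swap) (simp add: mult_ac)
    then show ?thesis unfolding DD1 by (simp add: left_diff_distrib sum_subtractf)
  qed
  also have "\<dots> = (\<Sum>f\<in>UNIV. t f * D f c l)"
    unfolding tors unfolding D_def fd_def
    by (simp add: sum_distrib_left sum_distrib_right, subst sum.swap) (simp add: mult_ac)
  finally have comm: "DD a b - DD b a = (\<Sum>f\<in>UNIV. t f * D f c l)" .
  \<comment> \<open>and once by differentiating the structure equation\<close>
  define R where "R a b = (\<Sum>i\<in>UNIV. \<Sum>j\<in>UNIV. ?E b i * ?E c j * fd (e a) (\<lambda>u. levi_civita g u i j l) x)" for a b
  have DD2: "DD a b = (\<Sum>f\<in>UNIV. fd (e a) (\<lambda>u. om u b c f) x * ?E f l)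
      + (\<Sum>f\<in>UNIV. om x b c f * D a f l)
      - B (D a b) (?E c) l - B (?E b) (D a c) l - R a b" for a b
  proof -
    have "DD a b = fd (e a) (\<lambda>u. (\<Sum>f\<in>UNIV. om u b c f * e f u $ l)
        - (\<Sum>i\<in>UNIV. \<Sum>j\<in>UNIV. e b u $ i * e c u $ j * levi_civita g u i j l)) x"
      unfolding DD_def by (rule fd_cong[OF open_U x]) (simp add: structure_eq[symmetric])
    also have "\<dots> = (\<Sum>f\<in>UNIV. fd (e a) (\<lambda>u. om u b c f) x * ?E f l + om x b c f * D a f l)
       - (\<Sum>i\<in>UNIV. \<Sum>j\<in>UNIV. (D a b i * ?E c j + ?E b i * D a c j) * ?L i j l
           + ?E b i * ?E c j * fd (e a) (\<lambda>u. levi_civita g u i j l) x)"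
      using x sm by (simp add: fdr D_def)
    finally show ?thesis
      by (simp add: B_def R_def sum.distrib distrib_right)
  qed
  have "DD a b - DD b a =
      (\<Sum>f\<in>UNIV. (fd (e a) (\<lambda>u. om u b c f) x - fd (e b) (\<lambda>u. om u a c f) x) * ?E f l)
      + (\<Sum>f\<in>UNIV. om x b c f * D a f l) - (\<Sum>f\<in>UNIV. om x a c f * D b f l)
      - B (\<lambda>i. D a b i - D b a i) (?E c) l - B (?E b) (D a c) l + B (?E a) (D b c) l - R a b + R b a"
    unfolding DD2 B_diff1 by (simp add: left_diff_distrib sum_subtractf)
  also have "\<dots> = (\<Sum>f\<in>UNIV. (fd (e a) (\<lambda>u. om u b c f) x - fd (e b) (\<lambda>u. om u a c f) x) * ?E f l)
      + (\<Sum>f\<in>UNIV. om x b c f * (\<Sum>h\<in>UNIV. om x a f h * ?E h l))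
      - (\<Sum>f\<in>UNIV. om x a c f * (\<Sum>h\<in>UNIV. om x b f h * ?E h l))
      - (\<Sum>f\<in>UNIV. t f * B (?E f) (?E c) l)
      + B (?E b) (B (?E a) (?E c)) l - B (?E a) (B (?E b) (?E c)) l - R a b + R b a"
    unfolding tors B_sum1
    by (simp add: D[abs_def] B_diff2 B_sum2 right_diff_distrib sum_subtractf)
  finally have 1: "(\<Sum>f\<in>UNIV. t f * D f c l) = \<dots>" unfolding comm .
  have dist: "(\<Sum>f\<in>UNIV. u f * (\<Sum>h\<in>UNIV. v f h * ?E h l)) = (\<Sum>d\<in>UNIV. (\<Sum>f\<in>UNIV. u f * v f d) * ?E d l)"
    for u v by (simp add: sum_distrib_left sum_distrib_right, subst sum.swap) (simp add: mult_ac)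
  have "(\<Sum>d\<in>UNIV. curv_frame x a b c d * ?E d l) =
      (\<Sum>f\<in>UNIV. (fd (e a) (\<lambda>u. om u b c f) x - fd (e b) (\<lambda>u. om u a c f) x) * ?E f l)
      + (\<Sum>f\<in>UNIV. om x b c f * (\<Sum>h\<in>UNIV. om x a f h * ?E h l))
      - (\<Sum>f\<in>UNIV. om x a c f * (\<Sum>h\<in>UNIV. om x b f h * ?E h l))
      - (\<Sum>f\<in>UNIV. t f * (\<Sum>h\<in>UNIV. om x f c h * ?E h l))"
    unfolding dist by (simp add: curv_frame_def t_def sum.distrib sum_subtractf distrib_right
        left_diff_distrib)
  also have "\<dots> = R a b - R b a + B (?E a) (B (?E b) (?E c)) l - B (?E b) (B (?E a) (?E c)) l"
    using 1 by (simp add: D right_diff_distrib sum_subtractf)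
  also have "\<dots> = (\<Sum>i\<in>UNIV. \<Sum>j\<in>UNIV. \<Sum>k\<in>UNIV. ?E a i * ?E b j * ?E c k * curv_op g x i j k l)"
  proof -
    have Rs: "R a b = (\<Sum>i\<in>UNIV. \<Sum>j\<in>UNIV. \<Sum>k\<in>UNIV. ?E a i * ?E b j * ?E c k * pd i (\<lambda>u. levi_civita g u j k l) x)"
      for a b
    proof -
      have "R a b = (\<Sum>j\<in>UNIV. \<Sum>i\<in>UNIV. \<Sum>k\<in>UNIV. ?E a i * ?E b j * ?E c k * pd i (\<lambda>u. levi_civita g u j k l) x)"
        unfolding R_def fd_def sum_distrib_left
        by (rule sum.cong[OF refl], subst sum.swap) (simp add: mult_ac)
      also have "\<dots> = (\<Sum>i\<in>UNIV. \<Sum>j\<in>UNIV. \<Sum>k\<in>UNIV. ?E a i * ?E b j * ?E c k * pd i (\<lambda>u. levi_civita g u j k l) x)"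
        by (rule sum.swap)
      finally show ?thesis .
    qed
    have Rs': "R b a = (\<Sum>i\<in>UNIV. \<Sum>j\<in>UNIV. \<Sum>k\<in>UNIV. ?E a i * ?E b j * ?E c k * pd j (\<lambda>u. levi_civita g u i k l) x)"
      unfolding Rs by (subst sum.swap) (simp add: mult_ac)
    have Bs: "B (?E a) (B (?E b) (?E c)) l = (\<Sum>i\<in>UNIV. \<Sum>j\<in>UNIV. \<Sum>k\<in>UNIV. ?E a i * ?E b j * ?E c k *
        (\<Sum>m\<in>UNIV. ?L j k m * ?L i m l))" for a b
    proof -
      have "(\<Sum>m\<in>UNIV. ?E a i * (\<Sum>j\<in>UNIV. \<Sum>k\<in>UNIV. ?E b j * ?E c k * ?L j k m) * ?L i m l) =
        (\<Sum>j\<in>UNIV. \<Sum>k\<in>UNIV. ?E a i * ?E b j * ?E c k * (\<Sum>m\<in>UNIV. ?L j k m * ?L i m l))" for i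
      proof -
        have "(\<Sum>m\<in>UNIV. ?E a i * (\<Sum>j\<in>UNIV. \<Sum>k\<in>UNIV. ?E b j * ?E c k * ?L j k m) * ?L i m l) =
          (\<Sum>m\<in>UNIV. \<Sum>j\<in>UNIV. \<Sum>k\<in>UNIV. ?E a i * ?E b j * ?E c k * (?L j k m * ?L i m l))"
          by (simp add: sum_distrib_left sum_distrib_right mult_ac)
        also have "\<dots> = (\<Sum>j\<in>UNIV. \<Sum>m\<in>UNIV. \<Sum>k\<in>UNIV. ?E a i * ?E b j * ?E c k * (?L j k m * ?L i m l))"
          by (rule sum.swap)
        also have "\<dots> = (\<Sum>j\<in>UNIV. \<Sum>k\<in>UNIV. \<Sum>m\<in>UNIV. ?E a i * ?E b j * ?E c k * (?L j k m * ?L i m l))"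
          by (intro sum.cong refl sum.swap)
        finally show ?thesis by (simp add: sum_distrib_left)
      qed
      then show ?thesis unfolding B_def by simp
    qed
    have Bs': "B (?E b) (B (?E a) (?E c)) l = (\<Sum>i\<in>UNIV. \<Sum>j\<in>UNIV. \<Sum>k\<in>UNIV. ?E a i * ?E b j * ?E c k *
        (\<Sum>m\<in>UNIV. ?L i k m * ?L j m l))"
      unfolding Bs by (subst sum.swap) (simp add: mult_ac)
    show ?thesis
      unfolding Rs[of a b] Rs' Bs[of a b] Bs' curv_op_def
      by (simp add: sum.distrib sum_subtractf distrib_left right_diff_distrib)
  qed
  finally show ?thesis by simp
qed

end

lemma sum8_reorder:
  fixes H :: "'m::finite \<Rightarrow> 'm \<Rightarrow> 'm \<Rightarrow> 'm \<Rightarrow> 'm \<Rightarrow> 'm \<Rightarrow> 'm \<Rightarrow> 'm \<Rightarrow> real"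
  shows "(\<Sum>i\<in>UNIV. \<Sum>j\<in>UNIV. \<Sum>k\<in>UNIV. \<Sum>l\<in>UNIV. \<Sum>a\<in>UNIV. \<Sum>b\<in>UNIV. \<Sum>c\<in>UNIV. \<Sum>d\<in>UNIV.
      H i j k l a b c d)
    = (\<Sum>c\<in>UNIV. \<Sum>d\<in>UNIV. \<Sum>a\<in>UNIV. \<Sum>b\<in>UNIV. \<Sum>k\<in>UNIV. \<Sum>i\<in>UNIV. \<Sum>j\<in>UNIV. \<Sum>l\<in>UNIV.
      H i j k l a b c d)"
proof -
  have 1: "(\<Sum>i\<in>UNIV. \<Sum>j\<in>UNIV. \<Sum>k\<in>UNIV. \<Sum>l\<in>UNIV. \<Sum>a\<in>UNIV. \<Sum>b\<in>UNIV. K i j k l a b)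
     = (\<Sum>a\<in>UNIV. \<Sum>b\<in>UNIV. \<Sum>k\<in>UNIV. \<Sum>i\<in>UNIV. \<Sum>j\<in>UNIV. \<Sum>l\<in>UNIV. K i j k l a b)"
    for K :: "'m \<Rightarrow> 'm \<Rightarrow> 'm \<Rightarrow> 'm \<Rightarrow> 'm \<Rightarrow> 'm \<Rightarrow> real"
    by (rule trans[OF sum_pull4], rule sum.cong[OF refl], rule trans[OF sum_pull4],
        rule sum.cong[OF refl], rule sum_pull2)
  show ?thesis
    by (rule trans[OF sum_pull6], rule sum.cong[OF refl], rule trans[OF sum_pull6],
        rule sum.cong[OF refl], rule 1)
qed

lemma sum2_mult_sum2:
  fixes X Y :: "'m::finite \<Rightarrow> 'm \<Rightarrow> real"
  shows "(\<Sum>i\<in>UNIV. \<Sum>l\<in>UNIV. X i l) * (\<Sum>j\<in>UNIV. \<Sum>k\<in>UNIV. Y j k)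
    = (\<Sum>i\<in>UNIV. \<Sum>l\<in>UNIV. \<Sum>j\<in>UNIV. \<Sum>k\<in>UNIV. X i l * Y j k)"
  by (simp only: sum_distrib_right) (simp only: sum_distrib_left)

lemma mult_sum_mult_sum:
  fixes u v :: real
  shows "u * (\<Sum>c\<in>A. X c) * (\<Sum>d\<in>B. Y d) * v = (\<Sum>c\<in>A. \<Sum>d\<in>B. u * X c * Y d * v)"
proof -
  have "u * (\<Sum>c\<in>A. X c) * (\<Sum>d\<in>B. Y d) * v = u * v * (\<Sum>c\<in>A. \<Sum>d\<in>B. X c * Y d)"
    by (simp add: sum_product[symmetric])
  then show ?thesis by (simp add: sum_distrib_left mult_ac)
qed

subsection \<open>Frames with constant Gram matrix\<close>

text \<open>A frame whose Gram matrix is the permutation matrix of an involution \<open>st\<close>: the vector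
  \<open>e\<^bsub>st a\<^esub>\<close>
  is metrically dual to \<open>e\<^sub>a\<close>, so that metric contractions become sums over pairs \<open>(a, st a)\<close>.\<close>

locale dual_frame = moving_frame U g e om
  for U :: "(real^'m) set" and g :: "real^'m \<Rightarrow> real^'m^'m"
    and e :: "'m \<Rightarrow> real^'m \<Rightarrow> real^'m" and om :: "real^'m \<Rightarrow> 'm \<Rightarrow> 'm \<Rightarrow> 'm \<Rightarrow> real" +
  fixes st :: "'m \<Rightarrow> 'm"
  assumes st_st [simp]: "\<And>a. st (st a) = a"
    and smooth_g: "\<And>i j. smooth_on U (\<lambda>u. g u $ i $ j)"
    and gram: "\<And>x a b. x \<in> U \<Longrightarrow>
      (\<Sum>i\<in>UNIV. \<Sum>j\<in>UNIV. e a x $ i * e b x $ j * g x $ i $ j) = (if b = st a then 1 else 0)"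
    and inv_g: "\<And>x i j. x \<in> U \<Longrightarrow> matrix_inv (g x) $ i $ j = (\<Sum>a\<in>UNIV. e a x $ i * e (st a) x $ j)"
    and g_inv_g: "\<And>x. x \<in> U \<Longrightarrow> g x ** matrix_inv (g x) = mat 1"
    and metric_compat: "\<And>x a b c. x \<in> U \<Longrightarrow> om x a (st b) (st c) = - om x a c b"
begin

text \<open>Four-index functions as list tensors; values on lists of any other length are junk.\<close>

definition list4 :: "('m \<Rightarrow> 'm \<Rightarrow> 'm \<Rightarrow> 'm \<Rightarrow> real) \<Rightarrow> 'm list \<Rightarrow> real" where
  "list4 F is = F (is ! 0) (is ! 1) (is ! 2) (is ! 3)"

definition ricci_frame :: "real^'m \<Rightarrow> 'm \<Rightarrow> 'm \<Rightarrow> real" where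
  "ricci_frame x b c = (\<Sum>a\<in>UNIV. curv_frame x a b c a)"

definition scalar_frame :: "real^'m \<Rightarrow> real" where
  "scalar_frame x = (\<Sum>a\<in>UNIV. ricci_frame x a (st a))"

definition gram_coeff :: "'m \<Rightarrow> 'm \<Rightarrow> real" where
  "gram_coeff a b = (if b = st a then 1 else 0)"

definition weyl_frame :: "real^'m \<Rightarrow> 'm \<Rightarrow> 'm \<Rightarrow> 'm \<Rightarrow> 'm \<Rightarrow> real" where
  "weyl_frame x a b c d = curv_frame x a b c (st d)
     - 1 / (real CARD('m) - 2) *
         (ricci_frame x a d * gram_coeff b c + ricci_frame x b c * gram_coeff a d
          - ricci_frame x a c * gram_coeff b d - ricci_frame x b d * gram_coeff a c)
     + scalar_frame x / ((real CARD('m) - 1) * (real CARD('m) - 2)) *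
         (gram_coeff a d * gram_coeff b c - gram_coeff a c * gram_coeff b d)"

text \<open>The divergence in the last slot, with the metric contraction written as a sum over dual
  pairs.\<close>

definition div_weyl_frame :: "real^'m \<Rightarrow> 'm list \<Rightarrow> real" where
  "div_weyl_frame x as = (\<Sum>l\<in>UNIV.
     cov_frame e om (\<lambda>u. list4 (weyl_frame u)) x [st l, as ! 0, as ! 1, as ! 2, l])"

text \<open>Two nested divergences instead of a double contraction of a second covariant derivative: the
  divergence of the Weyl tensor has far fewer nonzero components than its full derivative.\<close>

definition bach_frame :: "real^'m \<Rightarrow> 'm \<Rightarrow> 'm \<Rightarrow> real" where
  "bach_frame x p q = (\<Sum>k\<in>UNIV. cov_frame e om div_weyl_frame x [st k, k, p, q])
     + 1/2 * (\<Sum>k\<in>UNIV. \<Sum>l\<in>UNIV. ricci_frame x (st k) (st l) * weyl_frame x k p q l)"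

text \<open>The frame components of the Weyl tensor are those of its summands, so they are treated with
  a functional whose linearity and values on products are easy to state.\<close>

definition contract4 :: "real^'m \<Rightarrow> ('m \<Rightarrow> 'm \<Rightarrow> 'm \<Rightarrow> 'm \<Rightarrow> real) \<Rightarrow> 'm \<Rightarrow> 'm \<Rightarrow> 'm \<Rightarrow> 'm \<Rightarrow> real" where
  "contract4 x F a b c d = (\<Sum>i\<in>UNIV. \<Sum>j\<in>UNIV. \<Sum>k\<in>UNIV. \<Sum>l\<in>UNIV.
     e a x $ i * e b x $ j * e c x $ k * e d x $ l * F i j k l)"

definition contract2 :: "real^'m \<Rightarrow> ('m \<Rightarrow> 'm \<Rightarrow> real) \<Rightarrow> 'm \<Rightarrow> 'm \<Rightarrow> real" where
  "contract2 x F a b = (\<Sum>i\<in>UNIV. \<Sum>j\<in>UNIV. e a x $ i * e b x $ j * F i j)"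

lemma frame_comp_list4: "frame_comp (\<lambda>a. e a x) (list4 F) [a, b, c, d] = contract4 x F a b c d"
  by (simp add: list4_def contract4_def sum_distrib_left mult.assoc)

lemma contract2_g: "x \<in> U \<Longrightarrow> contract2 x (\<lambda>i j. g x $ i $ j) a b = gram_coeff a b"
  by (simp add: contract2_def gram gram_coeff_def)

lemma sum4_reorder:
  fixes H :: "'m \<Rightarrow> 'm \<Rightarrow> 'm \<Rightarrow> 'm \<Rightarrow> real"
  shows "(\<Sum>i\<in>UNIV. \<Sum>j\<in>UNIV. \<Sum>k\<in>UNIV. \<Sum>l\<in>UNIV. H i j k l)
      = (\<Sum>i\<in>UNIV. \<Sum>l\<in>UNIV. \<Sum>j\<in>UNIV. \<Sum>k\<in>UNIV. H i j k l)"
    and "(\<Sum>i\<in>UNIV. \<Sum>j\<in>UNIV. \<Sum>k\<in>UNIV. \<Sum>l\<in>UNIV. H i j k l)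
      = (\<Sum>i\<in>UNIV. \<Sum>k\<in>UNIV. \<Sum>j\<in>UNIV. \<Sum>l\<in>UNIV. H i j k l)"
  by (rule sum.cong[OF refl], rule sum_pull2) (rule sum.cong[OF refl], rule sum.swap)

lemma contract4_mult:
  shows "contract4 x (\<lambda>i j k l. F i l * G j k) a b c d = contract2 x F a d * contract2 x G b c"
    and "contract4 x (\<lambda>i j k l. F j k * G i l) a b c d = contract2 x F b c * contract2 x G a d"
    and "contract4 x (\<lambda>i j k l. F i k * G j l) a b c d = contract2 x F a c * contract2 x G b d"
    and "contract4 x (\<lambda>i j k l. F j l * G i k) a b c d = contract2 x F b d * contract2 x G a c"
proof -
  show 1: "contract4 x (\<lambda>i j k l. F i l * G j k) a b c d = contract2 x F a d * contract2 x G b c" for F G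
    unfolding contract4_def contract2_def
    by (subst sum4_reorder(1)) (simp only: sum2_mult_sum2, simp add: mult_ac)
  show 2: "contract4 x (\<lambda>i j k l. F i k * G j l) a b c d = contract2 x F a c * contract2 x G b d" for F G
    unfolding contract4_def contract2_def
    by (subst sum4_reorder(2)) (simp only: sum2_mult_sum2, simp add: mult_ac)
  show "contract4 x (\<lambda>i j k l. F j k * G i l) a b c d = contract2 x F b c * contract2 x G a d"
    using 1[of G F] by (simp add: mult.commute)
  show "contract4 x (\<lambda>i j k l. F j l * G i k) a b c d = contract2 x F b d * contract2 x G a c"
    using 2[of G F] by (simp add: mult.commute)
qed

lemma contract4_linear:
  shows "contract4 x (\<lambda>i j k l. F i j k l + G i j k l) a b c d = contract4 x F a b c d + contract4 x G a b c d"
    and "contract4 x (\<lambda>i j k l. F i j k l - G i j k l) a b c d = contract4 x F a b c d - contract4 x G a b c d"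
    and "contract4 x (\<lambda>i j k l. r * F i j k l) a b c d = r * contract4 x F a b c d"
  by (simp_all add: contract4_def distrib_left right_diff_distrib sum.distrib sum_subtractf
      sum_distrib_left mult_ac)

text \<open>Lowering the last index with the metric turns the upper frame index \<open>d\<close> into its dual.\<close>

lemma contract4_curv:
  assumes x: "x \<in> U"
  shows "contract4 x (curv g x) a b c d = curv_frame x a b c (st d)"
proof -
  have "contract4 x (curv g x) a b c d = (\<Sum>i\<in>UNIV. \<Sum>j\<in>UNIV. \<Sum>k\<in>UNIV. \<Sum>l\<in>UNIV. \<Sum>m\<in>UNIV.
      e a x $ i * e b x $ j * e c x $ k * curv_op g x i j k m * (e d x $ l * g x $ m $ l))"
    by (simp add: contract4_def curv_def sum_distrib_left mult_ac)
  also have "\<dots> = (\<Sum>l\<in>UNIV. \<Sum>m\<in>UNIV. (\<Sum>i\<in>UNIV. \<Sum>j\<in>UNIV. \<Sum>k\<in>UNIV.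
      e a x $ i * e b x $ j * e c x $ k * curv_op g x i j k m) * (e d x $ l * g x $ m $ l))"
    unfolding sum_distrib_right
    by (rule trans[OF sum_pull3], rule sum.cong[OF refl], rule sum_pull3)
  also have "\<dots> = (\<Sum>l\<in>UNIV. \<Sum>m\<in>UNIV. \<Sum>f\<in>UNIV.
      curv_frame x a b c f * (e f x $ m * e d x $ l * g x $ m $ l))"
    by (simp only: curv_frame[OF x] sum_distrib_right, simp add: mult_ac)
  also have "\<dots> = (\<Sum>f\<in>UNIV. curv_frame x a b c f * contract2 x (\<lambda>i j. g x $ i $ j) f d)"
    unfolding contract2_def sum_distrib_left
    by (rule trans[OF sum_pull2], rule sum.cong[OF refl], rule sum.swap)
  also have "\<dots> = (\<Sum>f\<in>UNIV. if f = st d then curv_frame x a b c f else 0)"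
    using x by (intro sum.cong refl) (auto simp: contract2_g gram_coeff_def)
  finally show ?thesis by simp
qed

lemma g_inv_g_entry:
  assumes "x \<in> U"
  shows "(\<Sum>l\<in>UNIV. g x $ m $ l * matrix_inv (g x) $ l $ i) = (if m = i then 1 else 0)"
  using arg_cong[OF g_inv_g[OF assms], of "\<lambda>M. M $ m $ i"]
  by (simp add: matrix_matrix_mult_def mat_def)

text \<open>A trace does not depend on the frame: expanding the inverse metric over dual pairs turns the
  coordinate trace into the frame trace.\<close>

lemma contract2_ricci:
  assumes x: "x \<in> U"
  shows "contract2 x (ricci g x) b c = ricci_frame x b c"
proof -
  have "ricci g x j k = (\<Sum>a\<in>UNIV. \<Sum>i\<in>UNIV. \<Sum>l\<in>UNIV. e a x $ i * e (st a) x $ l * curv g x i j k l)" for j k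
  proof -
    have "ricci g x j k = (\<Sum>i\<in>UNIV. \<Sum>m\<in>UNIV. curv_op g x i j k m *
        (\<Sum>l\<in>UNIV. g x $ m $ l * matrix_inv (g x) $ l $ i))"
      by (simp add: g_inv_g_entry[OF x] ricci_def if_distrib[where f="\<lambda>t. _ * t"] cong: if_cong)
    also have "\<dots> = (\<Sum>i\<in>UNIV. \<Sum>l\<in>UNIV. curv g x i j k l * matrix_inv (g x) $ l $ i)"
      unfolding curv_def sum_distrib_left sum_distrib_right
      by (rule sum.cong[OF refl], subst sum.swap) (simp add: mult.assoc)
    also have "\<dots> = (\<Sum>i\<in>UNIV. \<Sum>l\<in>UNIV. \<Sum>a\<in>UNIV. e (st a) x $ l * e a x $ i * curv g x i j k l)"
    proof -
      have "bij st" by (rule o_bij[of st]) auto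
      then have "matrix_inv (g x) $ l $ i = (\<Sum>a\<in>UNIV. e (st a) x $ l * e a x $ i)" for l i
        using inv_g[OF x, of l i] sum.reindex_bij_betw[of st UNIV UNIV "\<lambda>a. e a x $ l * e (st a) x $ i"]
        by (simp add: bij_def bij_betw_def)
      then show ?thesis by (simp add: sum_distrib_left mult_ac)
    qed
    also have "\<dots> = (\<Sum>a\<in>UNIV. \<Sum>i\<in>UNIV. \<Sum>l\<in>UNIV. e (st a) x $ l * e a x $ i * curv g x i j k l)"
      by (rule sum_pull2)
    finally show ?thesis by (simp add: mult_ac)
  qed
  then have "contract2 x (ricci g x) b c = (\<Sum>j\<in>UNIV. \<Sum>k\<in>UNIV. \<Sum>a\<in>UNIV. \<Sum>i\<in>UNIV. \<Sum>l\<in>UNIV.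
      e a x $ i * e b x $ j * e c x $ k * e (st a) x $ l * curv g x i j k l)"
    by (simp add: contract2_def sum_distrib_left mult_ac)
  also have "\<dots> = (\<Sum>a\<in>UNIV. \<Sum>j\<in>UNIV. \<Sum>k\<in>UNIV. \<Sum>i\<in>UNIV. \<Sum>l\<in>UNIV.
      e a x $ i * e b x $ j * e c x $ k * e (st a) x $ l * curv g x i j k l)"
    by (rule sum_pull2)
  also have "\<dots> = (\<Sum>a\<in>UNIV. contract4 x (curv g x) a b c (st a))"
    unfolding contract4_def by (rule sum.cong[OF refl], rule sum_pull2)
  finally show ?thesis by (simp add: contract4_curv[OF x] ricci_frame_def)
qed

lemma scalar_curv_frame:
  assumes x: "x \<in> U"
  shows "scalar_curv g x = scalar_frame x"
proof -
  have "scalar_curv g x = (\<Sum>i\<in>UNIV. \<Sum>j\<in>UNIV. \<Sum>a\<in>UNIV. e a x $ i * e (st a) x $ j * ricci g x i j)"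
    by (simp add: scalar_curv_def inv_g[OF x] sum_distrib_right)
  also have "\<dots> = (\<Sum>a\<in>UNIV. \<Sum>i\<in>UNIV. \<Sum>j\<in>UNIV. e a x $ i * e (st a) x $ j * ricci g x i j)"
    by (rule sum_pull2)
  finally show ?thesis
    by (simp add: scalar_frame_def contract2_ricci[OF x, symmetric] contract2_def)
qed

lemma contract4_weyl:
  assumes x: "x \<in> U"
  shows "contract4 x (weyl g x) a b c d = weyl_frame x a b c d"
proof -
  have "contract4 x (weyl g x) a b c d = contract4 x (\<lambda>i j k l. curv g x i j k l
     - 1 / (real CARD('m) - 2) *
         (ricci g x i l * g x $ j $ k + ricci g x j k * g x $ i $ l
          - ricci g x i k * g x $ j $ l - ricci g x j l * g x $ i $ k)
     + scalar_curv g x / ((real CARD('m) - 1) * (real CARD('m) - 2)) *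
         (g x $ i $ l * g x $ j $ k - g x $ i $ k * g x $ j $ l)) a b c d"
    by (simp add: contract4_def weyl_def)
  also have "\<dots> = weyl_frame x a b c d"
    unfolding contract4_linear contract4_mult contract2_ricci[OF x] contract2_g[OF x] contract4_curv[OF x] scalar_curv_frame[OF x]
      weyl_frame_def ..
  finally show ?thesis .
qed

subsection \<open>The Bach tensor in the frame\<close>

lemma smooth_curv_frame [simp]: "smooth_on U (\<lambda>u. curv_frame u a b c d)"
  unfolding curv_frame_def
  by (intro smooth_on_add smooth_on_diff smooth_on_sum smooth_on_mult smooth_on_fd open_U smooth_e smooth_om)

lemma smooth_ricci_frame [simp]: "smooth_on U (\<lambda>u. ricci_frame u a b)"
  unfolding ricci_frame_def by (simp add: open_U)

lemma smooth_weyl_frame [simp]: "smooth_on U (\<lambda>u. weyl_frame u a b c d)"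
  unfolding weyl_frame_def scalar_frame_def by (simp add: open_U)

lemma smooth_list4_weyl_frame: "smooth_on U (\<lambda>u. list4 (weyl_frame u) is)"
  by (simp add: list4_def)

lemma smooth_cov_frame:
  assumes "\<And>is. smooth_on U (\<lambda>u. T u is)"
  shows "smooth_on U (\<lambda>u. cov_frame e om T u is)"
  using assms open_U smooth_e smooth_om
  by (cases "is") (auto intro!: smooth_on_diff smooth_on_conn smooth_on_fd)

lemma frame_comp_weyl:
  assumes "x \<in> U"
  shows "frame_comp (\<lambda>a. e a x) (list4 (weyl g x)) [a, b, c, d] = list4 (weyl_frame x) [a, b, c, d]"
  unfolding frame_comp_list4 contract4_weyl[OF assms] by (simp add: list4_def)

lemma conn_cong_length:
  assumes "\<And>js. length js = length is \<Longrightarrow> T js = S js"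
  shows "conn G T is = conn G S is"
  using assms
proof (induction "is" arbitrary: T S)
  case (Cons i "is")
  have "conn G (\<lambda>js. T (i # js)) is = conn G (\<lambda>js. S (i # js)) is"
    by (rule Cons.IH) (simp add: Cons.prems)
  then show ?case by (simp add: Cons.prems)
qed simp

text \<open>Only the values on lists of the right length enter a covariant derivative, so tensors need
  to agree in their own rank only.\<close>

lemma cov_frame_cong_length:
  assumes x: "x \<in> U" and "\<And>u js. u \<in> U \<Longrightarrow> Suc (length js) = length is \<Longrightarrow> T u js = S u js"
  shows "cov_frame e om T x is = cov_frame e om S x is"
proof (cases "is")
  case (Cons a as)
  then show ?thesis
    using assms fd_cong[OF open_U x, of "\<lambda>u. T u as" "\<lambda>u. S u as"]
      conn_cong_length[of as "T x" "S x"] by simp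
qed simp

lemma nabla2_weyl_cov:
  "nabla2_weyl g x a b i j k l = cov g (cov g (\<lambda>u. list4 (weyl g u))) x [a, b, i, j, k, l]"
proof -
  have 1: "nabla_weyl g u b i j k l = cov g (\<lambda>u. list4 (weyl g u)) u [b, i, j, k, l]" for u b i j k l
    by (simp add: nabla_weyl_def list4_def sum.distrib add.assoc)
  show ?thesis
    unfolding nabla2_weyl_def 1[abs_def] cov.simps(2)[of _ _ _ a] conn.simps
    by (simp add: sum.distrib add.assoc del: cov.simps)
qed

text \<open>Both inverse metrics are expanded over dual pairs; reordering the eight sums leaves the
  frame components of a tensor of rank six.\<close>

lemma contract2_bach_double_divergence:
  assumes x: "x \<in> U"
  shows "contract2 x (bach g x) p q = (\<Sum>c\<in>UNIV. \<Sum>d\<in>UNIV.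
      cov_frame e om (cov_frame e om (\<lambda>u. list4 (weyl_frame u))) x [st c, st d, c, p, q, d]
      + 1/2 * (ricci_frame x (st c) (st d) * weyl_frame x c p q d))"
proof -
  let ?e = "\<lambda>a. e a x"
  define Z where "Z is = nabla2_weyl g x (is!0) (is!1) (is!2) (is!3) (is!4) (is!5)
     + (1/2) * (ricci g x (is!0) (is!1) * weyl g x (is!2) (is!3) (is!4) (is!5))" for "is" :: "'m list"
  have "contract2 x (bach g x) p q = (\<Sum>i\<in>UNIV. \<Sum>j\<in>UNIV. \<Sum>k\<in>UNIV. \<Sum>l\<in>UNIV. \<Sum>a\<in>UNIV. \<Sum>b\<in>UNIV.
      e p x $ i * e q x $ j * matrix_inv (g x) $ k $ a * matrix_inv (g x) $ l $ b * Z [a, b, k, i, j, l])"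
    by (simp add: contract2_def bach_def Z_def sum_distrib_left mult.assoc)
  also have "\<dots> = (\<Sum>i\<in>UNIV. \<Sum>j\<in>UNIV. \<Sum>k\<in>UNIV. \<Sum>l\<in>UNIV. \<Sum>a\<in>UNIV. \<Sum>b\<in>UNIV. \<Sum>c\<in>UNIV. \<Sum>d\<in>UNIV.
      e p x $ i * e q x $ j * (e c x $ k * e (st c) x $ a) * (e d x $ l * e (st d) x $ b)
        * Z [a, b, k, i, j, l])"
    unfolding inv_g[OF x] mult_sum_mult_sum ..
  also have "\<dots> = (\<Sum>c\<in>UNIV. \<Sum>d\<in>UNIV. frame_comp ?e Z [st c, st d, c, p, q, d])"
    by (subst sum8_reorder) (simp add: sum_distrib_left mult_ac)
  also have "\<dots> = (\<Sum>c\<in>UNIV. \<Sum>d\<in>UNIV.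
      cov_frame e om (cov_frame e om (\<lambda>u. list4 (weyl_frame u))) x [st c, st d, c, p, q, d]
      + 1/2 * (ricci_frame x (st c) (st d) * weyl_frame x c p q d))"
  proof (intro sum.cong refl)
    fix c d
    have smW: "smooth_on U (\<lambda>u. list4 (weyl g u) is)" for "is"
    proof -
      have "smooth_on U (\<lambda>u. curv_op g u i j k l)" for i j k l
        unfolding curv_op_def
        by (intro smooth_on_add smooth_on_diff smooth_on_sum smooth_on_mult smooth_on_pd open_U smooth_lc)
      moreover have "smooth_on U (\<lambda>u. matrix_inv (g u) $ i $ j)" for i j
        by (subst smooth_on_cong[OF open_U inv_g]) (auto simp: open_U smooth_e)
      ultimately show ?thesis
        unfolding list4_def weyl_def curv_def ricci_def scalar_curv_def
        by (simp add: open_U smooth_g)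
    qed
    have "frame_comp ?e (cov g (cov g (\<lambda>u. list4 (weyl g u))) x) [st c, st d, c, p, q, d]
      = cov_frame e om (cov_frame e om (\<lambda>u. list4 (weyl_frame u))) x [st c, st d, c, p, q, d]"
      unfolding frame_comp_cov2[OF x smW]
    proof (intro cov_frame_cong_length x)
      fix u and js js' :: "'m list"
      assume "u \<in> U" "Suc (length js) = length [st c, st d, c, p, q, d]" "Suc (length js') = length js"
      then have "length js' = 4" by simp
      then obtain a1 a2 a3 a4 where "js' = [a1, a2, a3, a4]"
        by (auto simp: length_Suc_conv numeral_eq_Suc)
      then show "frame_comp (\<lambda>a. e a v) (list4 (weyl g v)) js' = list4 (weyl_frame v) js'" if "v \<in> U" for v
        using frame_comp_weyl[OF that] by simp
    qed
    moreover have "frame_comp ?e (\<lambda>is. nabla2_weyl g x (is!0) (is!1) (is!2) (is!3) (is!4) (is!5)) [st c, st d, c, p, q, d]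
      = frame_comp ?e (cov g (cov g (\<lambda>u. list4 (weyl g u))) x) [st c, st d, c, p, q, d]"
      unfolding nabla2_weyl_cov by (simp del: cov.simps)
    moreover have "frame_comp ?e (\<lambda>is. ricci g x (is!0) (is!1) * weyl g x (is!2) (is!3) (is!4) (is!5)) [st c, st d, c, p, q, d]
      = contract2 x (ricci g x) (st c) (st d) * contract4 x (weyl g x) c p q d"
      unfolding contract2_def contract4_def sum_distrib_right by (simp add: sum_distrib_left mult_ac)
    ultimately show "frame_comp ?e Z [st c, st d, c, p, q, d] =
      cov_frame e om (cov_frame e om (\<lambda>u. list4 (weyl_frame u))) x [st c, st d, c, p, q, d]
      + 1/2 * (ricci_frame x (st c) (st d) * weyl_frame x c p q d)"
      unfolding Z_def[abs_def] frame_comp_add frame_comp_scale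
      by (simp only: contract2_ricci[OF x] contract4_weyl[OF x])
  qed
  finally show ?thesis .
qed

text \<open>Contraction of the last slot commutes with the second derivative, because the connection
  coefficients are skew with respect to the constant Gram matrix.\<close>

lemma divergence_of_divergence:
  assumes x: "x \<in> U"
  shows "(\<Sum>d\<in>UNIV. cov_frame e om (cov_frame e om (\<lambda>u. list4 (weyl_frame u))) x [a, st d, c, p, q, d])
    = cov_frame e om div_weyl_frame x [a, c, p, q]"
proof -
  define V where "V = cov_frame e om (\<lambda>u. list4 (weyl_frame u))"
  have sV: "smooth_on U (\<lambda>u. V u is)" for "is"
    unfolding V_def by (intro smooth_cov_frame smooth_list4_weyl_frame)
  have bij: "bij_betw st UNIV UNIV" by (rule o_bij[of st]) auto
  have "(\<Sum>d\<in>UNIV. \<Sum>s\<in>UNIV. om x a (st d) s * V x [s, c, p, q, d])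
      = (\<Sum>d\<in>UNIV. \<Sum>s\<in>UNIV. om x a (st d) (st s) * V x [st s, c, p, q, d])"
    by (rule sum.cong[OF refl], rule sum.reindex_bij_betw[OF bij, symmetric])
  also have "\<dots> = - (\<Sum>d\<in>UNIV. \<Sum>s\<in>UNIV. om x a d s * V x [st d, c, p, q, s])"
    unfolding metric_compat[OF x] by (subst sum.swap) (simp add: sum_negf)
  finally have cancel: "(\<Sum>d\<in>UNIV. \<Sum>s\<in>UNIV. om x a (st d) s * V x [s, c, p, q, d])
      + (\<Sum>d\<in>UNIV. \<Sum>s\<in>UNIV. om x a d s * V x [st d, c, p, q, s]) = 0" by simp
  have swap: "(\<Sum>d\<in>UNIV. \<Sum>s\<in>UNIV. om x a r s * V x (H d s))
      = (\<Sum>s\<in>UNIV. om x a r s * (\<Sum>d\<in>UNIV. V x (H d s)))" for r H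
    by (subst sum.swap) (simp add: sum_distrib_left)
  have "(\<Sum>d\<in>UNIV. cov_frame e om V x [a, st d, c, p, q, d]) =
      (\<Sum>d\<in>UNIV. fd (e a) (\<lambda>u. V u [st d, c, p, q, d]) x)
      - ((\<Sum>s\<in>UNIV. om x a c s * (\<Sum>d\<in>UNIV. V x [st d, s, p, q, d]))
       + (\<Sum>s\<in>UNIV. om x a p s * (\<Sum>d\<in>UNIV. V x [st d, c, s, q, d]))
       + (\<Sum>s\<in>UNIV. om x a q s * (\<Sum>d\<in>UNIV. V x [st d, c, p, s, d])))"
    using cancel by (simp add: sum_subtractf sum.distrib swap)
  also have "(\<Sum>d\<in>UNIV. fd (e a) (\<lambda>u. V u [st d, c, p, q, d]) x)
      = fd (e a) (\<lambda>u. \<Sum>d\<in>UNIV. V u [st d, c, p, q, d]) x"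
    using sV by (simp add: fd_sum[OF open_U x])
  finally show ?thesis
    by (simp add: div_weyl_frame_def[abs_def] V_def[symmetric])
qed

theorem contract2_bach:
  assumes x: "x \<in> U"
  shows "contract2 x (bach g x) p q = bach_frame x p q"
  unfolding contract2_bach_double_divergence[OF x] bach_frame_def sum.distrib
    divergence_of_divergence[OF x] by (simp add: sum_distrib_left)

end

section \<open>Metrics of Walker form and their adapted null frame\<close>

text \<open>Coordinates with index \<open>Inr i\<close> run along a null foliation; every such metric has constant
  determinant, so its inverse is again polynomial in \<open>h\<close>.\<close>

definition walker :: "(real^('n::finite + 'n) \<Rightarrow> 'n \<Rightarrow> 'n \<Rightarrow> real) \<Rightarrow> real^('n + 'n) \<Rightarrow> real^('n + 'n)^('n + 'n)" where
  "walker h z = (\<chi> a b. case (a, b) of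
      (Inl i, Inl j) \<Rightarrow> h z i j
    | (Inl i, Inr j) \<Rightarrow> (if i = j then 1 else 0)
    | (Inr i, Inl j) \<Rightarrow> (if i = j then 1 else 0)
    | (Inr i, Inr j) \<Rightarrow> 0)"

definition walker_inverse :: "(real^('n::finite + 'n) \<Rightarrow> 'n \<Rightarrow> 'n \<Rightarrow> real) \<Rightarrow> real^('n + 'n) \<Rightarrow> real^('n + 'n)^('n + 'n)" where
  "walker_inverse h z = (\<chi> a b. case (a, b) of
      (Inl i, Inl j) \<Rightarrow> 0
    | (Inl i, Inr j) \<Rightarrow> (if i = j then 1 else 0)
    | (Inr i, Inl j) \<Rightarrow> (if i = j then 1 else 0)
    | (Inr i, Inr j) \<Rightarrow> - h z i j)"

text \<open>The coordinate fields along the fibres, completed by \<open>\<partial>\<^sub>i - \<Sum>j. h\<^sub>i\<^sub>j/2 \<partial>\<^sub>j\<^sub>'\<close>: a frame of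
  null vectors.\<close>

definition walker_frame ::
  "(real^('n::finite + 'n) \<Rightarrow> 'n \<Rightarrow> 'n \<Rightarrow> real) \<Rightarrow> 'n + 'n \<Rightarrow> real^('n + 'n) \<Rightarrow> real^('n + 'n)" where
  "walker_frame h a z = (\<chi> b. case (a, b) of
      (Inl i, Inl j) \<Rightarrow> (if i = j then 1 else 0)
    | (Inl i, Inr j) \<Rightarrow> - h z i j / 2
    | (Inr i, Inl j) \<Rightarrow> 0
    | (Inr i, Inr j) \<Rightarrow> (if i = j then 1 else 0))"

definition hor :: "(real^('n::finite + 'n) \<Rightarrow> 'n \<Rightarrow> 'n \<Rightarrow> real) \<Rightarrow> 'n \<Rightarrow> (real^('n::finite + 'n) \<Rightarrow> real) \<Rightarrow> real^('n + 'n) \<Rightarrow> real" where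
  "hor h i = fd (walker_frame h (Inl i))"

abbreviation ver :: "'n \<Rightarrow> (real^('n::finite + 'n) \<Rightarrow> real) \<Rightarrow> real^('n + 'n) \<Rightarrow> real" where
  "ver j \<equiv> pd (Inr j)"

primrec flip :: "'n + 'n \<Rightarrow> 'n + 'n" where
  "flip (Inl i) = Inr i" | "flip (Inr i) = Inl i"

text \<open>The connection coefficients of the frame: \<open>walker_A h z l i k\<close> and \<open>walker_B h z l i k\<close> are
  the components along \<open>e\<^bsub>Inl k\<^esub>\<close> and \<open>e\<^bsub>Inr k\<^esub>\<close> of the derivative of \<open>e\<^bsub>Inl i\<^esub>\<close> in direction
  \<open>e\<^bsub>Inl l\<^esub>\<close>. All derivatives in vertical directions vanish, which is the reason for using this
  frame.\<close>

definition walker_A :: "(real^('n::finite + 'n) \<Rightarrow> 'n \<Rightarrow> 'n \<Rightarrow> real) \<Rightarrow> real^('n + 'n) \<Rightarrow> 'n \<Rightarrow> 'n \<Rightarrow> 'n \<Rightarrow> real" where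
  "walker_A h z l i k = - ver k (\<lambda>u. h u l i) z / 2"

definition walker_B :: "(real^('n::finite + 'n) \<Rightarrow> 'n \<Rightarrow> 'n \<Rightarrow> real) \<Rightarrow> real^('n + 'n) \<Rightarrow> 'n \<Rightarrow> 'n \<Rightarrow> 'n \<Rightarrow> real" where
  "walker_B h z l i k = (hor h i (\<lambda>u. h u l k) z - hor h k (\<lambda>u. h u l i) z) / 2"

definition walker_om ::
  "(real^('n::finite + 'n) \<Rightarrow> 'n \<Rightarrow> 'n \<Rightarrow> real) \<Rightarrow> real^('n + 'n) \<Rightarrow> 'n + 'n \<Rightarrow> 'n + 'n \<Rightarrow> 'n + 'n \<Rightarrow> real" where
  "walker_om h z a b c = (case (a, b, c) of
      (Inl l, Inl i, Inl k) \<Rightarrow> walker_A h z l i k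
    | (Inl l, Inl i, Inr k) \<Rightarrow> walker_B h z l i k
    | (Inl l, Inr j, Inr k) \<Rightarrow> - walker_A h z l k j
    | _ \<Rightarrow> 0)"

lemma delta_simps:
  "(if P then 1 else 0) * x = (if P then x else 0)"
  "x * (if P then 1 else 0) = (if P then x else 0)"
  "(if P then x else 0) * y = (if P then x * y else 0)"
  "y * (if P then x else 0) = (if P then y * x else 0)"
  "- (if P then x else 0) = (if P then - x else 0)"
  "(if P then x else 0) / y = (if P then x / y else 0)"
  "(\<Sum>i\<in>I. if P then f i else 0) = (if P then \<Sum>i\<in>I. f i else 0)"
  for x y :: real and f :: "'i \<Rightarrow> real"
  by auto

lemma fd_walker_frame:
  "fd (walker_frame h (Inr j)) f z = ver j f z"
  "fd (walker_frame h (Inl i)) f z = pd (Inl i) f z - (\<Sum>j\<in>UNIV. h z i j * ver j f z) / 2"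
  by (simp_all add: fd_def sum_UNIV_Plus delta_simps sum.distrib sum_subtractf walker_frame_def sum_negf sum_divide_distrib)

lemma walker_entries:
  "walker h z $ Inl i $ Inl j = h z i j"
  "walker h z $ Inl i $ Inr j = (if i = j then 1 else 0)"
  "walker h z $ Inr i $ Inl j = (if i = j then 1 else 0)"
  "walker h z $ Inr i $ Inr j = 0"
  "walker_inverse h z $ Inl i $ Inl j = 0"
  "walker_inverse h z $ Inl i $ Inr j = (if i = j then 1 else 0)"
  "walker_inverse h z $ Inr i $ Inl j = (if i = j then 1 else 0)"
  "walker_inverse h z $ Inr i $ Inr j = - h z i j"
  by (simp_all add: walker_def walker_inverse_def)

lemma walker_frame_entries:
  "walker_frame h (Inl i) z $ Inl j = (if i = j then 1 else 0)"
  "walker_frame h (Inl i) z $ Inr j = - h z i j / 2"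
  "walker_frame h (Inr i) z $ Inl j = 0"
  "walker_frame h (Inr i) z $ Inr j = (if i = j then 1 else 0)"
  by (simp_all add: walker_frame_def)

lemma walker_om_simps [simp]:
  "walker_om h z (Inl l) (Inl i) (Inl k) = walker_A h z l i k"
  "walker_om h z (Inl l) (Inl i) (Inr k) = walker_B h z l i k"
  "walker_om h z (Inl l) (Inr j) (Inr k) = - walker_A h z l k j"
  "walker_om h z (Inl l) (Inr j) (Inl k) = 0"
  "walker_om h z (Inr l) b c = 0"
  by (simp_all add: walker_om_def)

lemma walker_mult_inverse:
  "walker h z ** walker_inverse h z = mat 1" "walker_inverse h z ** walker h z = mat 1"
proof -
  have "(\<Sum>k\<in>UNIV. walker h z $ a $ k * walker_inverse h z $ k $ b) = (if a = b then 1 else 0)"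
    "(\<Sum>k\<in>UNIV. walker_inverse h z $ a $ k * walker h z $ k $ b) = (if a = b then 1 else 0)" for a b
    by (cases a; cases b, simp_all add: sum_UNIV_Plus delta_simps sum.distrib sum_subtractf walker_entries sum_negf)
      (cases a; cases b, simp_all add: sum_UNIV_Plus delta_simps sum.distrib sum_subtractf walker_entries sum_negf)
  then show "walker h z ** walker_inverse h z = mat 1" "walker_inverse h z ** walker h z = mat 1"
    by (simp_all add: vec_eq_iff matrix_matrix_mult_def mat_def)
qed

lemma matrix_inv_walker: "matrix_inv (walker h z) = walker_inverse h z"
proof -
  show ?thesis
    using walker_mult_inverse
    by (metis (mono_tags, lifting) matrix_inv_def matrix_mul_assoc matrix_mul_lid matrix_mul_rid someI_ex)
qed

lemma levi_civita_walker:
  "levi_civita (walker h) z (Inl i) (Inl j) (Inl k) = - ver k (\<lambda>u. h u i j) z / 2"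
  "levi_civita (walker h) z (Inl i) (Inl j) (Inr k) =
     (pd (Inl i) (\<lambda>u. h u j k) z + pd (Inl j) (\<lambda>u. h u i k) z - pd (Inl k) (\<lambda>u. h u i j) z) / 2
     + (\<Sum>l\<in>UNIV. h z k l * ver l (\<lambda>u. h u i j) z) / 2"
  "levi_civita (walker h) z (Inl i) (Inr j) (Inl k) = 0"
  "levi_civita (walker h) z (Inl i) (Inr j) (Inr k) = ver j (\<lambda>u. h u i k) z / 2"
  "levi_civita (walker h) z (Inr j) (Inl i) (Inl k) = 0"
  "levi_civita (walker h) z (Inr j) (Inl i) (Inr k) = ver j (\<lambda>u. h u i k) z / 2"
  "levi_civita (walker h) z (Inr i) (Inr j) (Inl k) = 0"
  "levi_civita (walker h) z (Inr i) (Inr j) (Inr k) = 0"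
  by (simp_all add: levi_civita_def matrix_inv_walker sum_UNIV_Plus delta_simps sum.distrib sum_subtractf walker_entries
      sum_negf algebra_simps diff_divide_distrib add_divide_distrib)

locale walker_metric =
  fixes U :: "(real^('n::finite + 'n)) set" and h :: "real^('n + 'n) \<Rightarrow> 'n \<Rightarrow> 'n \<Rightarrow> real"
  assumes open_U: "open U"
    and smooth_h [simp]: "\<And>i j. smooth_on U (\<lambda>z. h z i j)"
    and h_sym: "\<And>z i j. z \<in> U \<Longrightarrow> h z i j = h z j i"
begin

lemma pd_h_sym: "z \<in> U \<Longrightarrow> pd a (\<lambda>u. h u i j) z = pd a (\<lambda>u. h u j i) z"
  by (rule pd_cong_open[OF open_U]) (auto intro: h_sym)

lemma smooth_walker_frame: "smooth_on U (\<lambda>u. walker_frame h a u $ b)"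
  by (cases a; cases b) (simp_all add: walker_frame_entries open_U)

lemma smooth_hor [simp]: "smooth_on U f \<Longrightarrow> smooth_on U (hor h i f)"
  unfolding hor_def by (simp add: open_U smooth_walker_frame)

lemma smooth_walker_A [simp]: "smooth_on U (\<lambda>u. walker_A h u l i k)"
  unfolding walker_A_def by (simp add: open_U)

lemma smooth_walker_B [simp]: "smooth_on U (\<lambda>u. walker_B h u l i k)"
  unfolding walker_B_def by (simp add: open_U)

lemma walker_structure_eq:
  assumes z: "z \<in> U"
  shows "fd (walker_frame h a) (\<lambda>u. walker_frame h b u $ k) z
        + (\<Sum>i\<in>UNIV. \<Sum>j\<in>UNIV. walker_frame h a z $ i * walker_frame h b z $ j * levi_civita (walker h) z i j k)
      = (\<Sum>c\<in>UNIV. walker_om h z a b c * walker_frame h c z $ k)"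
proof -
  have S: "pd b (\<lambda>u. - (h u i j / 2)) z = - pd b (\<lambda>u. h u i j) z / 2" for b i j
    using fd_divide[OF open_U z, of "\<lambda>u. - h u i j" "\<lambda>u. axis b 1" 2]
      fd_uminus[OF open_U z, of "\<lambda>u. h u i j" "\<lambda>u. axis b 1"] open_U
    by (simp add: fd_def axis_def if_distrib[where f="\<lambda>t. t * _"] cong: if_cong)
  show ?thesis
  proof (cases a)
    case (Inl l)
    show ?thesis
    proof (cases b)
      case (Inl i)
      show ?thesis
      proof (cases k)
        case (Inl m)
        then show ?thesis using \<open>a = Inl l\<close> \<open>b = Inl i\<close>
          by (simp add: sum_UNIV_Plus delta_simps sum.distrib sum_subtractf walker_frame_entries levi_civita_walker walker_A_def)
      next
        case (Inr m)
        have *: "pd x (\<lambda>u. h u l i) z = pd x (\<lambda>u. h u i l) z" "h z m j = h z j m" for x j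
          using z pd_h_sym h_sym by blast+
        show ?thesis
          using Inr \<open>a = Inl l\<close> \<open>b = Inl i\<close>
          by (simp add: sum_UNIV_Plus delta_simps sum.distrib sum_subtractf walker_frame_entries levi_civita_walker walker_A_def
              walker_B_def hor_def fd_walker_frame S * sum_negf sum_divide_distrib[symmetric])
             (simp add: sum_distrib_left[symmetric] sum_divide_distrib[symmetric] mult.commute field_simps)
      qed
    next
      case (Inr i)
      then show ?thesis using \<open>a = Inl l\<close>
        by (cases k) (simp_all add: sum_UNIV_Plus delta_simps sum.distrib sum_subtractf walker_frame_entries levi_civita_walker walker_A_def sum_negf)
    qed
  next
    case (Inr l)
    show ?thesis
      by (cases b; cases k)
         (simp_all add: Inr sum_UNIV_Plus delta_simps sum.distrib sum_subtractf walker_frame_entries levi_civita_walker fd_walker_frame S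
           pd_h_sym[OF z])
  qed
qed

sublocale dual_frame U "walker h" "walker_frame h" "walker_om h" flip
proof
  show "open U" by (rule open_U)
  show "smooth_on U (\<lambda>u. walker_frame h a u $ i)" for a i by (rule smooth_walker_frame)
  show "smooth_on U (\<lambda>u. walker_om h u a b c)" for a b c
    by (cases a; cases b; cases c) (simp_all add: open_U)
  show "smooth_on U (\<lambda>u. levi_civita (walker h) u i j k)" for i j k
    by (cases i; cases j; cases k) (simp_all add: levi_civita_walker open_U)
  show "levi_civita (walker h) z i j k = levi_civita (walker h) z j i k" if z: "z \<in> U" for z i j k
  proof (cases "\<exists>i' j'. i = Inl i' \<and> j = Inl j'")
    case True
    then obtain i' j' where ij: "i = Inl i'" "j = Inl j'" by blast
    show ?thesis
      by (cases k) (simp_all add: ij levi_civita_walker pd_h_sym[OF z, of _ i' j'])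
  next
    case False
    then show ?thesis
      by (cases i; cases j; cases k) (simp_all add: levi_civita_walker)
  qed
  show "fd (walker_frame h a) (\<lambda>u. walker_frame h b u $ k) x
        + (\<Sum>i\<in>UNIV. \<Sum>j\<in>UNIV. walker_frame h a x $ i * walker_frame h b x $ j * levi_civita (walker h) x i j k)
      = (\<Sum>c\<in>UNIV. walker_om h x a b c * walker_frame h c x $ k)" if "x \<in> U" for x a b k
    by (rule walker_structure_eq[OF that])
  show "flip (flip a) = a" for a :: "'n + 'n" by (cases a) auto
  show "smooth_on U (\<lambda>u. walker h u $ i $ j)" for i j
    by (cases i; cases j) (simp_all add: walker_entries open_U)
  show "(\<Sum>i\<in>UNIV. \<Sum>j\<in>UNIV. walker_frame h a x $ i * walker_frame h b x $ j * walker h x $ i $ j)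
      = (if b = flip a then 1 else 0)" if "x \<in> U" for x a b
    using that by (cases a; cases b)
      (auto simp: sum_UNIV_Plus delta_simps sum.distrib sum_subtractf walker_frame_entries walker_entries h_sym)
  show "matrix_inv (walker h x) $ i $ j = (\<Sum>a\<in>UNIV. walker_frame h a x $ i * walker_frame h (flip a) x $ j)"
    if "x \<in> U" for x i j
    unfolding matrix_inv_walker using that h_sym[OF that]
    by (cases i; cases j) (auto simp: sum_UNIV_Plus delta_simps sum.distrib sum_subtractf walker_frame_entries walker_entries)
  show "walker h x ** matrix_inv (walker h x) = mat 1" for x
    unfolding matrix_inv_walker by (rule walker_mult_inverse)
  show "walker_om h x a (flip b) (flip c) = - walker_om h x a c b" if "x \<in> U" for x a b c
    by (cases a; cases b; cases c) (auto simp: walker_B_def field_simps)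
qed

end

section \<open>The modified Riemannian extension over a surface\<close>

lemma linear_base_pt: "bounded_linear (base_pt :: real^('n::finite + 'n) \<Rightarrow> real^'n)"
  unfolding base_pt_def
  by (intro linear_conv_bounded_linear[THEN iffD1] linearI) (auto simp: vec_eq_iff)

lemma open_base_pt:
  fixes S :: "(real^'n::finite) set"
  assumes "open S"
  shows "open {z :: real^('n + 'n). base_pt z \<in> S}"
proof -
  have "open (base_pt -` S :: (real^('n + 'n)) set)"
    by (rule open_vimage[OF assms linear_continuous_on[OF linear_base_pt]])
  then show ?thesis by (simp add: vimage_def)
qed

lemma pd_base_pt:
  fixes f :: "real^'n::finite \<Rightarrow> real"
  assumes "f differentiable (at (base_pt z))"
  shows "pd (Inl i) (\<lambda>u. f (base_pt u)) z = pd i f (base_pt z)"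
    and "pd (Inr i) (\<lambda>u. f (base_pt u)) z = 0"
proof -
  have f: "(f has_derivative frechet_derivative f (at (base_pt z))) (at (base_pt z))"
    using assms by (simp add: frechet_derivative_works)
  have "((\<lambda>u. f (base_pt u)) has_derivative (\<lambda>v. frechet_derivative f (at (base_pt z)) (base_pt v))) (at z)"
    using has_derivative_compose[OF bounded_linear.has_derivative[OF linear_base_pt has_derivative_ident] f] .
  note d = pd_eqI[OF this]
  have ax: "base_pt (axis (Inl i) 1 :: real^('n + 'n)) = axis i 1"
    "base_pt (axis (Inr i) 1 :: real^('n + 'n)) = 0"
    by (auto simp: base_pt_def vec_eq_iff axis_def)
  show "pd (Inl i) (\<lambda>u. f (base_pt u)) z = pd i f (base_pt z)"
    unfolding d ax by (simp add: pd_def)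
  show "pd (Inr i) (\<lambda>u. f (base_pt u)) z = 0"
    unfolding d ax using linear_0[OF has_derivative_linear[OF f]] .
qed

lemma smooth_on_base_pt:
  fixes f :: "real^'n::finite \<Rightarrow> real"
  assumes "smooth_on S f" "open S"
  shows "smooth_on {z :: real^('n + 'n). base_pt z \<in> S} (\<lambda>z. f (base_pt z))"
proof -
  let ?U = "{z :: real^('n + 'n). base_pt z \<in> S}"
  have op: "open ?U" by (rule open_base_pt[OF assms(2)])
  have "C_k_on k ?U (\<lambda>z. f (base_pt z))" for k
    using assms(1)
  proof (induction k arbitrary: f)
    case 0
    have "continuous_on ?U (base_pt :: real^('n + 'n) \<Rightarrow> real^'n)"
      using linear_continuous_on[OF linear_base_pt] .
    then show ?case
      using continuous_on_compose2[OF smooth_on_continuous[OF 0], of ?U base_pt] by auto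
  next
    case (Suc k)
    have d: "f differentiable (at (base_pt z))" if "z \<in> ?U" for z :: "real^('n + 'n)"
      using smooth_on_differentiable[OF Suc.prems assms(2)] that by auto
    have "(\<lambda>z. f (base_pt z)) differentiable (at z)" if "z \<in> ?U" for z :: "real^('n + 'n)"
      using differentiable_chain_at[OF bounded_linear_imp_differentiable[OF linear_base_pt] d[OF that]]
      by (simp add: o_def)
    moreover have "C_k_on k ?U (pd a (\<lambda>z. f (base_pt z)))" for a
    proof (cases a)
      case (Inl i)
      have "C_k_on k ?U (\<lambda>z. pd i f (base_pt z))"
        using Suc by blast
      then show ?thesis
        using C_k_on_cong[OF op, of "pd a (\<lambda>z. f (base_pt z))" "\<lambda>z. pd i f (base_pt z)"] Inl pd_base_pt(1)[OF d]
        by blast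
    next
      case (Inr i)
      show ?thesis
        using C_k_on_cong[OF op, of "pd a (\<lambda>z. f (base_pt z))" "\<lambda>z. 0"] Inr pd_base_pt(2)[OF d]
          C_k_on_const[of k ?U 0] by blast
    qed
    ultimately show ?case
      by (simp add: differentiable_on_eq_differentiable_at[OF op])
  qed
  then show ?thesis by (simp add: smooth_on_def)
qed

text \<open>The area form in coordinates.\<close>

definition eps :: "2 \<Rightarrow> 2 \<Rightarrow> real" where
  "eps i k = (if i = k then 0 else if i = 1 then 1 else -1)"

lemma two_neq [simp]: "(1::2) \<noteq> 2" "(2::2) \<noteq> 1"
  by simp_all

lemma eps_simps [simp]: "eps 1 1 = 0" "eps 1 2 = 1" "eps 2 1 = -1" "eps 2 2 = 0"
  by (simp_all add: eps_def)

locale modified_extension =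
  fixes S :: "(real^2) set"
    and \<Gamma> :: "real^2 \<Rightarrow> 2 \<Rightarrow> 2 \<Rightarrow> 2 \<Rightarrow> real" and T \<Phi> :: "real^2 \<Rightarrow> 2 \<Rightarrow> 2 \<Rightarrow> real"
  assumes open_S: "open S"
    and smooth_\<Gamma>: "\<And>i j k. smooth_on S (\<lambda>x. \<Gamma> x i j k)"
    and smooth_T: "\<And>i j. smooth_on S (\<lambda>x. T x i j)"
    and smooth_\<Phi>: "\<And>i j. smooth_on S (\<lambda>x. \<Phi> x i j)"
    and \<Gamma>_sym: "\<And>x i j k. x \<in> S \<Longrightarrow> \<Gamma> x i j k = \<Gamma> x j i k"
    and \<Phi>_sym: "\<And>x i j. x \<in> S \<Longrightarrow> \<Phi> x i j = \<Phi> x j i"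
    and parallel: "\<And>x k i j. x \<in> S \<Longrightarrow> cov_deriv_11 \<Gamma> T x k i j = 0"
begin

definition U :: "(real^(2 + 2)) set" where "U = {z. base_pt z \<in> S}"

text \<open>All objects are pulled back to functions on the total space. The components of the connection, of
  \<open>T\<close> and of \<open>\<Phi>\<close> become \<open>G\<close>, \<open>t\<close> and \<open>f\<close>; \<open>xi\<close> are the fibre coordinates and \<open>tau\<close> is the covector composed with \<open>T\<close>.\<close>

definition xi :: "2 \<Rightarrow> real^(2 + 2) \<Rightarrow> real" where "xi i z = z $ Inr i"
definition G :: "2 \<Rightarrow> 2 \<Rightarrow> 2 \<Rightarrow> real^(2 + 2) \<Rightarrow> real" where "G i j k z = \<Gamma> (base_pt z) i j k"
definition t :: "2 \<Rightarrow> 2 \<Rightarrow> real^(2 + 2) \<Rightarrow> real" where "t i j z = T (base_pt z) i j"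
definition f :: "2 \<Rightarrow> 2 \<Rightarrow> real^(2 + 2) \<Rightarrow> real" where "f i j z = \<Phi> (base_pt z) i j"
definition tau :: "2 \<Rightarrow> real^(2 + 2) \<Rightarrow> real" where "tau i z = xi 1 z * t i 1 z + xi 2 z * t i 2 z"

definition h :: "real^(2 + 2) \<Rightarrow> 2 \<Rightarrow> 2 \<Rightarrow> real" where
  "h z i j = tau i z * tau j z - 2 * (xi 1 z * G i j 1 z + xi 2 z * G i j 2 z) + f i j z"

lemma modified_riemannian_extension_walker: "modified_riemannian_extension \<Gamma> \<Phi> T = walker h"
proof (rule ext)
  fix z
  have "modified_riemannian_extension \<Gamma> \<Phi> T z $ a $ b = walker h z $ a $ b" for a b
    by (cases a; cases b)
      (simp_all add: modified_riemannian_extension_def walker_def sym_prod_def iota_11_def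
        riemannian_extension_def pullback_02_def h_def tau_def xi_def t_def G_def f_def fibre_def sum_2)
  then show "modified_riemannian_extension \<Gamma> \<Phi> T z = walker h z"
    by (simp add: vec_eq_iff)
qed

lemma open_U_ext: "open U"
  unfolding U_def by (rule open_base_pt[OF open_S])

lemma smooth_pullback: "smooth_on S p \<Longrightarrow> smooth_on U (\<lambda>z. p (base_pt z))"
  unfolding U_def by (rule smooth_on_base_pt[OF _ open_S])

lemma smooth_basic [simp]:
  "smooth_on U (xi i)" "smooth_on U (G i j k)" "smooth_on U (t i j)" "smooth_on U (f i j)"
  by (simp_all add: xi_def[abs_def] G_def[abs_def] t_def[abs_def] f_def[abs_def] smooth_pullback[OF smooth_\<Gamma>]
      smooth_pullback[OF smooth_T] smooth_pullback[OF smooth_\<Phi>])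

lemma smooth_tau [simp]: "smooth_on U (tau i)"
  unfolding tau_def[abs_def] by (simp add: open_U_ext)

lemma G_sym: "z \<in> U \<Longrightarrow> G i j k z = G j i k z" and f_sym: "z \<in> U \<Longrightarrow> f i j z = f j i z"
  by (auto simp: U_def G_def f_def \<Gamma>_sym \<Phi>_sym)

sublocale walker_metric U h
proof
  show "open U" by (rule open_U_ext)
  show "smooth_on U (\<lambda>z. h z i j)" for i j
    unfolding h_def by (simp add: open_U_ext)
  show "h z i j = h z j i" if "z \<in> U" for z i j
    using G_sym[OF that, of i j] f_sym[OF that, of i j] by (simp add: h_def)
qed

declare open_U_ext [simp]

lemma hor_pullback:
  assumes "smooth_on S p" "z \<in> U"
  shows "hor h l (\<lambda>u. p (base_pt u)) z = pd l p (base_pt z)"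
  using pd_base_pt[of p z] smooth_on_differentiable[OF assms(1) open_S] assms(2)
  by (simp add: hor_def fd_walker_frame U_def)

lemma ver_pullback:
  assumes "smooth_on S p" "z \<in> U"
  shows "ver r (\<lambda>u. p (base_pt u)) z = 0"
  using pd_base_pt[of p z] smooth_on_differentiable[OF assms(1) open_S] assms(2)
  by (simp add: U_def)

lemma hor_xi: "hor h l (xi i) z = - h z l i / 2"
  by (simp add: hor_def fd_walker_frame xi_def[abs_def] pd_component delta_simps)

lemma ver_xi: "ver r (xi i) z = (if i = r then 1 else 0)"
  by (simp add: xi_def[abs_def] pd_component)

context
  fixes z assumes z: "z \<in> U"
begin

lemma ver_basic: "ver r (G i j k) z = 0" "ver r (t i j) z = 0" "ver r (f i j) z = 0"
  using z by (simp_all add: G_def[abs_def] t_def[abs_def] f_def[abs_def] ver_pullback[OF smooth_\<Gamma>]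
      ver_pullback[OF smooth_T] ver_pullback[OF smooth_\<Phi>])

text \<open>Parallelism of \<open>T\<close> enters the computation of the Bach tensor here: it replaces derivatives
  of \<open>T\<close> by Christoffel symbols.\<close>

lemma hor_t: "hor h l (t i j) z =
    G l i 1 z * t 1 j z + G l i 2 z * t 2 j z - G l 1 j z * t i 1 z - G l 2 j z * t i 2 z"
  using parallel[of "base_pt z" l i j] z
  by (simp add: t_def[abs_def] G_def hor_pullback[OF smooth_T] cov_deriv_11_def sum_2 U_def algebra_simps)

lemma hor_rules:
  "smooth_on U p \<Longrightarrow> smooth_on U q \<Longrightarrow> hor h l (\<lambda>u. p u + q u) z = hor h l p z + hor h l q z"
  "smooth_on U p \<Longrightarrow> smooth_on U q \<Longrightarrow> hor h l (\<lambda>u. p u * q u) z = hor h l p z * q z + p z * hor h l q z"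
  "smooth_on U p \<Longrightarrow> hor h l (\<lambda>u. - p u) z = - hor h l p z"
  "smooth_on U p \<Longrightarrow> smooth_on U q \<Longrightarrow> hor h l (\<lambda>u. p u - q u) z = hor h l p z - hor h l q z"
  "smooth_on U p \<Longrightarrow> hor h l (\<lambda>u. p u / c) z = hor h l p z / c"
  "smooth_on U p \<Longrightarrow> hor h l (\<lambda>u. (p u)^2) z = 2 * p z * hor h l p z"
  "hor h l (\<lambda>u. c) z = 0"
  unfolding hor_def by (simp_all add: fd_rules[OF open_U_ext z])

lemma ver_rules:
  "smooth_on U p \<Longrightarrow> smooth_on U q \<Longrightarrow> ver l (\<lambda>u. p u + q u) z = ver l p z + ver l q z"
  "smooth_on U p \<Longrightarrow> smooth_on U q \<Longrightarrow> ver l (\<lambda>u. p u * q u) z = ver l p z * q z + p z * ver l q z"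
  "smooth_on U p \<Longrightarrow> ver l (\<lambda>u. - p u) z = - ver l p z"
  "smooth_on U p \<Longrightarrow> smooth_on U q \<Longrightarrow> ver l (\<lambda>u. p u - q u) z = ver l p z - ver l q z"
  "smooth_on U p \<Longrightarrow> ver l (\<lambda>u. p u / c) z = ver l p z / c"
  "smooth_on U p \<Longrightarrow> ver l (\<lambda>u. (p u)^2) z = 2 * p z * ver l p z"
  "ver l (\<lambda>u. c) z = 0"
  unfolding fd_walker_frame(1)[where h=h, symmetric] by (simp_all add: fd_rules[OF open_U_ext z])

lemma ver_tau: "ver r (tau i) z = t i r z"
  using exhaust_2[of r] by (auto simp: tau_def[abs_def] ver_rules ver_xi ver_basic)

text \<open>The first two summands are what a parallel object contributes, the rest is tensorial and
  comes from the vertical part of the horizontal frame vector.\<close>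

lemma hor_tau: "hor h l (tau i) z = G l i 1 z * tau 1 z + G l i 2 z * tau 2 z
    - (tau l z * (tau 1 z * t i 1 z + tau 2 z * t i 2 z) + f l 1 z * t i 1 z + f l 2 z * t i 2 z) / 2"
proof -
  have "hor h l (tau i) z = hor h l (xi 1) z * t i 1 z + xi 1 z * hor h l (t i 1) z
     + (hor h l (xi 2) z * t i 2 z + xi 2 z * hor h l (t i 2) z)"
    unfolding tau_def[abs_def] by (simp add: hor_rules)
  then show ?thesis
    unfolding hor_xi hor_t h_def by (simp add: tau_def field_simps)
qed

text \<open>The difference from the affine connection is tensorial and of degree one along the fibres;
  this is where the Christoffel symbols enter the frame connection.\<close>

lemma walker_A_ext: "walker_A h z l i k = G l i k z - (t l k z * tau i z + t i k z * tau l z) / 2"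
proof -
  have "ver k (\<lambda>u. h u l i) z = t l k z * tau i z + t i k z * tau l z - 2 * G l i k z"
    using exhaust_2[of k] by (auto simp: h_def[abs_def] ver_rules ver_tau ver_xi ver_basic algebra_simps)
  then show ?thesis by (simp add: walker_A_def field_simps)
qed

end

text \<open>The curvature \<open>R(\<partial>\<^sub>1,\<partial>\<^sub>2)\<partial>\<^sub>k\<close> of the affine connection.\<close>

definition Raff :: "2 \<Rightarrow> 2 \<Rightarrow> real^2 \<Rightarrow> real" where
  "Raff k r x = pd 1 (\<lambda>u. \<Gamma> u 2 k r) x - pd 2 (\<lambda>u. \<Gamma> u 1 k r) x
     + \<Gamma> x 2 k 1 * \<Gamma> x 1 1 r + \<Gamma> x 2 k 2 * \<Gamma> x 1 2 r - \<Gamma> x 1 k 1 * \<Gamma> x 2 1 r - \<Gamma> x 1 k 2 * \<Gamma> x 2 2 r"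

text \<open>\<open>b\<close> is cubic along the fibres; \<open>c_base\<close> and \<open>K_base\<close> are its coefficients of degree zero and
  one. Only \<open>K_base\<close> survives in the Bach tensor, and it carries all curvature of the affine
  connection that enters there.\<close>

definition K_base :: "2 \<Rightarrow> 2 \<Rightarrow> real^2 \<Rightarrow> real" where
  "K_base k r x = - Raff k r x
     + (\<Phi> x 2 1 * (T x 1 1 * T x k r + T x 1 r * T x k 1) + \<Phi> x 2 2 * (T x 1 2 * T x k r + T x 1 r * T x k 2)
      - \<Phi> x 1 1 * (T x 2 1 * T x k r + T x 2 r * T x k 1) - \<Phi> x 1 2 * (T x 2 2 * T x k r + T x 2 r * T x k 2)) / 4"

definition c_base :: "2 \<Rightarrow> real^2 \<Rightarrow> real" where
  "c_base k x = (pd 1 (\<lambda>u. \<Phi> u 2 k) x - pd 2 (\<lambda>u. \<Phi> u 1 k) x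
     + \<Phi> x 1 1 * \<Gamma> x 2 k 1 + \<Phi> x 1 2 * \<Gamma> x 2 k 2 - \<Phi> x 2 1 * \<Gamma> x 1 k 1 - \<Phi> x 2 2 * \<Gamma> x 1 k 2) / 2"

definition K :: "2 \<Rightarrow> 2 \<Rightarrow> real^(2 + 2) \<Rightarrow> real" where "K k r z = K_base k r (base_pt z)"
definition c :: "2 \<Rightarrow> real^(2 + 2) \<Rightarrow> real" where "c k z = c_base k (base_pt z)"

text \<open>Trace and determinant of \<open>T\<close>, and the area spanned by \<open>xi\<close> and \<open>tau\<close>, which vanishes exactly
  when they are proportional.\<close>

definition tr :: "real^(2 + 2) \<Rightarrow> real" where "tr z = t 1 1 z + t 2 2 z"
definition dt :: "real^(2 + 2) \<Rightarrow> real" where "dt z = t 1 1 z * t 2 2 z - t 1 2 z * t 2 1 z"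
definition th :: "real^(2 + 2) \<Rightarrow> real" where "th z = xi 1 z * tau 2 z - xi 2 z * tau 1 z"

text \<open>\<open>walker_B\<close> is skew in its last two indices, so over a surface it is \<open>eps\<close> times the covector
  \<open>b\<close>.\<close>

definition b :: "2 \<Rightarrow> real^(2 + 2) \<Rightarrow> real" where
  "b k z = c k z + K k 1 z * xi 1 z + K k 2 z * xi 2 z - dt z * th z * tau k z / 4"

lemma smooth_K_base: "smooth_on S (K_base k r)" and smooth_c_base: "smooth_on S (c_base k)"
  unfolding K_base_def[abs_def] c_base_def[abs_def] Raff_def
  by (simp_all add: open_S smooth_\<Gamma> smooth_T smooth_\<Phi>)

lemma smooth_derived [simp]:
  "smooth_on U (K k r)" "smooth_on U (c k)" "smooth_on U tr" "smooth_on U dt" "smooth_on U th" "smooth_on U (b k)"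
proof -
  show 1: "smooth_on U (K k r)" "smooth_on U (c k)" "smooth_on U tr" "smooth_on U dt" "smooth_on U th" for k r
    by (simp_all add: K_def[abs_def] c_def[abs_def] smooth_pullback smooth_K_base smooth_c_base
        tr_def[abs_def] dt_def[abs_def] th_def[abs_def])
  show "smooth_on U (b k)" unfolding b_def[abs_def] by (simp add: 1)
qed

context
  fixes z assumes z: "z \<in> U"
begin

lemma hor_tr: "hor h l tr z = 0" and hor_dt: "hor h l dt z = 0"
  unfolding tr_def[abs_def] dt_def[abs_def]
  by (simp_all add: hor_rules[OF z] hor_t[OF z]) (simp add: algebra_simps)

lemma ver_derived: "ver r tr z = 0" "ver r dt z = 0" "ver r (K k s) z = 0" "ver r (c k) z = 0"
  unfolding tr_def[abs_def] dt_def[abs_def] K_def[abs_def] c_def[abs_def]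
  by (simp_all add: ver_rules[OF z] ver_basic[OF z] ver_pullback smooth_K_base smooth_c_base z)

lemma hor_h: "hor h l (\<lambda>u. h u i j) z = hor h l (tau i) z * tau j z + tau i z * hor h l (tau j) z
    - 2 * (hor h l (xi 1) z * G i j 1 z + xi 1 z * pd l (\<lambda>x. \<Gamma> x i j 1) (base_pt z)
         + hor h l (xi 2) z * G i j 2 z + xi 2 z * pd l (\<lambda>x. \<Gamma> x i j 2) (base_pt z))
    + pd l (\<lambda>x. \<Phi> x i j) (base_pt z)"
proof -
  have "hor h l (G i j k) z = pd l (\<lambda>x. \<Gamma> x i j k) (base_pt z)"
    "hor h l (f i j) z = pd l (\<lambda>x. \<Phi> x i j) (base_pt z)" for k
    by (simp_all add: G_def[abs_def] f_def[abs_def] hor_pullback[OF smooth_\<Gamma>] hor_pullback[OF smooth_\<Phi>] z)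
  moreover have "hor h l (\<lambda>u. h u i j) z = hor h l (\<lambda>u. tau i u * tau j u
      - 2 * (xi 1 u * G i j 1 u + xi 2 u * G i j 2 u) + f i j u) z"
    by (rule arg_cong[where f="\<lambda>p. hor h l p z"]) (simp add: h_def fun_eq_iff)
  ultimately show ?thesis by (simp add: hor_rules[OF z])
qed

text \<open>The next two identities keep \<open>tau\<close> folded, which makes the comparison in \<open>walker_b\<close> a short
  linear computation; the second one is the theorem of Cayley and Hamilton applied to \<open>xi\<close>.\<close>

lemma K_xi: "K k 1 z * xi 1 z + K k 2 z * xi 2 z =
    - (Raff k 1 (base_pt z) * xi 1 z + Raff k 2 (base_pt z) * xi 2 z)
    + (f 2 1 z * (t 1 1 z * tau k z + t k 1 z * tau 1 z) + f 2 2 z * (t 1 2 z * tau k z + t k 2 z * tau 1 z)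
     - f 1 1 z * (t 2 1 z * tau k z + t k 1 z * tau 2 z) - f 1 2 z * (t 2 2 z * tau k z + t k 2 z * tau 2 z)) / 4"
  unfolding K_def K_base_def tau_def f_def t_def by (simp add: field_simps)

lemma dt_th: "dt z * th z = tau 1 z * (tau 1 z * t 2 1 z + tau 2 z * t 2 2 z)
    - tau 2 z * (tau 1 z * t 1 1 z + tau 2 z * t 1 2 z)"
  unfolding dt_def th_def tau_def by (simp add: field_simps)

text \<open>Quadratic terms in the fibre coordinates cancel: they contain derivatives of \<open>T\<close> or products
  of Christoffel symbols with \<open>T \<otimes> T\<close>, which combine to covariant derivatives of \<open>T\<close>.\<close>

lemma walker_b: "(hor h 1 (\<lambda>u. h u 2 k) z - hor h 2 (\<lambda>u. h u 1 k) z) / 2 = b k z"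
proof -
  have s: "G 2 1 j z = G 1 2 j z" "f 2 1 z = f 1 2 z" for j
    by (rule G_sym[OF z], rule f_sym[OF z])
  have B: "b k z = c k z + (K k 1 z * xi 1 z + K k 2 z * xi 2 z) - dt z * th z * tau k z / 4"
    by (simp add: b_def)
  show ?thesis
    unfolding B K_xi dt_th hor_h hor_tau[OF z] hor_xi
    unfolding c_def c_base_def Raff_def h_def G_def[symmetric] f_def[symmetric] t_def[symmetric] s
    by (simp add: field_simps)
qed

lemma walker_B_ext: "walker_B h z l i k = eps i k * b l z"
proof -
  have s: "hor h j (\<lambda>u. h u l m) z = hor h j (\<lambda>u. h u m l) z" for j m
    unfolding hor_def by (rule fd_cong[OF open_U_ext z]) (rule h_sym)
  show ?thesis
    using exhaust_2[of i] exhaust_2[of k]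
    by (auto simp: walker_B_def s field_simps simp flip: walker_b)
qed

end

subsection \<open>Curvature\<close>

text \<open>The connection coefficient in closed form, and abbreviations of the vertical derivatives
  (prefix \<open>v\<close>) and of the base derivatives \<open>dc\<close> and \<open>dK\<close> that occur below; \<open>sg\<close> is \<open>tau\<close> composed
  with \<open>T\<close>, and \<open>trS l 1\<close>, \<open>trS l 2\<close> are the coefficients of \<open>xi\<close> in the trace of \<open>G l - A l\<close>.\<close>

definition A :: "2 \<Rightarrow> 2 \<Rightarrow> 2 \<Rightarrow> real^(2 + 2) \<Rightarrow> real" where
  "A l i k z = G l i k z - (t l k z * tau i z + t i k z * tau l z) / 2"

definition vA :: "2 \<Rightarrow> 2 \<Rightarrow> 2 \<Rightarrow> 2 \<Rightarrow> real^(2 + 2) \<Rightarrow> real" where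
  "vA l i k j z = - (t l k z * t i j z + t i k z * t l j z) / 2"

definition vth :: "2 \<Rightarrow> real^(2 + 2) \<Rightarrow> real" where
  "vth r z = (if r = 1 then tau 2 z else - tau 1 z) + xi 1 z * t 2 r z - xi 2 z * t 1 r z"

definition vb :: "2 \<Rightarrow> 2 \<Rightarrow> real^(2 + 2) \<Rightarrow> real" where
  "vb k r z = K k r z - dt z * (vth r z * tau k z + th z * t k r z) / 4"

definition sg :: "2 \<Rightarrow> real^(2 + 2) \<Rightarrow> real" where
  "sg i z = tau 1 z * t i 1 z + tau 2 z * t i 2 z"

definition dc :: "2 \<Rightarrow> 2 \<Rightarrow> real^(2 + 2) \<Rightarrow> real" where "dc l k z = pd l (c_base k) (base_pt z)"
definition dK :: "2 \<Rightarrow> 2 \<Rightarrow> 2 \<Rightarrow> real^(2 + 2) \<Rightarrow> real" where "dK l k r z = pd l (K_base k r) (base_pt z)"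
definition trG :: "2 \<Rightarrow> real^(2 + 2) \<Rightarrow> real" where "trG l z = G l 1 1 z + G l 2 2 z"

definition trS :: "2 \<Rightarrow> 2 \<Rightarrow> real^(2 + 2) \<Rightarrow> real" where
  "trS l r z = (t l 1 z * t 1 r z + t l 2 z * t 2 r z + tr z * t l r z) / 2"

text \<open>The parts of \<open>q\<close> of degree zero and the base coefficients of degree one.\<close>

definition q0 :: "real^(2 + 2) \<Rightarrow> real" where
  "q0 z = dc 1 2 z - dc 2 1 z - trG 1 z * c 2 z + trG 2 z * c 1 z
     - (f 1 1 z * K 2 1 z + f 1 2 z * K 2 2 z - f 2 1 z * K 1 1 z - f 2 2 z * K 1 2 z) / 2"

definition q1 :: "2 \<Rightarrow> real^(2 + 2) \<Rightarrow> real" where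
  "q1 r z = dK 1 2 r z - dK 2 1 r z
     + K 2 1 z * G 1 1 r z + K 2 2 z * G 1 2 r z - K 1 1 z * G 2 1 r z - K 1 2 z * G 2 2 r z
     - trG 1 z * K 2 r z + trG 2 z * K 1 r z + trS 1 r z * c 2 z - trS 2 r z * c 1 z"

text \<open>The curvature component \<open>R(e\<^sub>1,e\<^sub>2,e\<^sub>1,e\<^sub>2)\<close>, ordered by degree along the fibres: the last summand has
  degree four.\<close>

definition q :: "real^(2 + 2) \<Rightarrow> real" where
  "q z = q0 z + q1 1 z * xi 1 z + q1 2 z * xi 2 z
     - (tau 1 z * (tau 1 z * K 2 1 z + tau 2 z * K 2 2 z) - tau 2 z * (tau 1 z * K 1 1 z + tau 2 z * K 1 2 z)) / 2
     + (sg 1 z + tr z * tau 1 z) / 2 * (K 2 1 z * xi 1 z + K 2 2 z * xi 2 z)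
     - (sg 2 z + tr z * tau 2 z) / 2 * (K 1 1 z * xi 1 z + K 1 2 z * xi 2 z)
     + dt z / 8 * (f 1 1 z * (vth 1 z * tau 2 z + th z * t 2 1 z) + f 1 2 z * (vth 2 z * tau 2 z + th z * t 2 2 z)
                 - f 2 1 z * (vth 1 z * tau 1 z + th z * t 1 1 z) - f 2 2 z * (vth 2 z * tau 1 z + th z * t 1 2 z))
     + (dt z * th z)^2 / 4"

lemma smooth_curvature_data [simp]:
  "smooth_on U (A l i k)" "smooth_on U (vth r)" "smooth_on U (vb k r)" "smooth_on U (sg i)"
  "smooth_on U (dc l k)" "smooth_on U (dK l k r)" "smooth_on U (trG l)" "smooth_on U (trS l r)"
  "smooth_on U q0" "smooth_on U (q1 r)" "smooth_on U q"
proof -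
  have v: "smooth_on U (vth r)" for r
    by (cases "r = 1") (simp_all add: vth_def[abs_def])
  show 1: "smooth_on U (A l i k)" "smooth_on U (vth r)" "smooth_on U (sg i)"
    "smooth_on U (dc l k)" "smooth_on U (dK l k r)" "smooth_on U (trG l)" "smooth_on U (trS l r)" for l i k r
    by (simp_all add: v A_def[abs_def] sg_def[abs_def] dc_def[abs_def] dK_def[abs_def]
        trG_def[abs_def] trS_def[abs_def] smooth_pullback smooth_on_pd smooth_c_base smooth_K_base)
  show "smooth_on U (vb k r)" unfolding vb_def[abs_def] by (simp add: 1)
  show 2: "smooth_on U q0" "smooth_on U (q1 r)" for r
    unfolding q0_def[abs_def] q1_def[abs_def] by (simp_all add: 1)
  show "smooth_on U q" unfolding q_def[abs_def] by (simp add: 1 2)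
qed

context
  fixes z assumes z: "z \<in> U"
begin

lemma ver_A: "ver j (A l i k) z = vA l i k j z"
  by (simp add: A_def[abs_def] vA_def ver_rules[OF z] ver_basic[OF z] ver_tau[OF z] field_simps)

lemma ver_th: "ver r th z = vth r z"
  using exhaust_2[of r]
  by (auto simp: th_def[abs_def] vth_def ver_rules[OF z] ver_xi ver_tau[OF z])

lemma ver_b: "ver r (b k) z = vb k r z"
  using exhaust_2[of r]
  by (auto simp: b_def[abs_def] vb_def ver_rules[OF z] ver_xi ver_tau[OF z] ver_th ver_derived[OF z] algebra_simps)

lemma hor_A: "hor h m (A l i k) z = pd m (\<lambda>x. \<Gamma> x l i k) (base_pt z)
    - (hor h m (t l k) z * tau i z + t l k z * hor h m (tau i) z
       + hor h m (t i k) z * tau l z + t i k z * hor h m (tau l) z) / 2"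
proof -
  have "hor h m (G l i k) z = pd m (\<lambda>x. \<Gamma> x l i k) (base_pt z)"
    by (simp add: G_def[abs_def] hor_pullback[OF smooth_\<Gamma>] z)
  then show ?thesis by (simp add: A_def[abs_def] hor_rules[OF z])
qed

lemma dt_vth: "dt z * vth r z = t 1 r z * sg 2 z + tau 1 z * (t 1 r z * t 2 1 z + t 2 r z * t 2 2 z)
    - t 2 r z * sg 1 z - tau 2 z * (t 1 r z * t 1 1 z + t 2 r z * t 1 2 z)"
  using exhaust_2[of r] by (auto simp: dt_def vth_def sg_def tau_def field_simps)

text \<open>The pair symmetry of the curvature tensor, found by computing both sides: the curvature of
  \<open>A\<close> is the vertical derivative of \<open>b\<close> up to sign.\<close>

lemma curv_horizontal:
  "hor h 1 (A 2 i k) z - hor h 2 (A 1 i k) z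
    + (A 2 i 1 z * A 1 1 k z + A 2 i 2 z * A 1 2 k z - A 1 i 1 z * A 2 1 k z - A 1 i 2 z * A 2 2 k z)
   = - vb i k z"
proof -
  have s: "G 2 1 j z = G 1 2 j z" "f 2 1 z = f 1 2 z" for j
    by (rule G_sym[OF z], rule f_sym[OF z])
  have V: "vb i k z = K i k z - (dt z * vth k z * tau i z + dt z * th z * t i k z) / 4"
    by (simp add: vb_def field_simps)
  show ?thesis
    unfolding V dt_vth dt_th[OF z] hor_A hor_t[OF z] hor_tau[OF z]
    unfolding sg_def A_def K_def K_base_def Raff_def G_def[symmetric] f_def[symmetric] t_def[symmetric] s
    by (simp add: field_simps)
qed

text \<open>Up to the tensorial part, \<open>th\<close> behaves as a parallel area density.\<close>

lemma hor_th: "hor h l th z = trG l z * th z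
    - (tr z * tau l z * th z + f l 1 z * vth 1 z + f l 2 z * vth 2 z) / 2"
proof -
  have "hor h l th z = hor h l (xi 1) z * tau 2 z + xi 1 z * hor h l (tau 2) z
     - (hor h l (xi 2) z * tau 1 z + xi 2 z * hor h l (tau 1) z)"
    unfolding th_def[abs_def] by (simp add: hor_rules[OF z])
  also have "\<dots> = trG l z * th z
    - (tau l z * (tau 1 z * tau 2 z + xi 1 z * (tau 1 z * t 2 1 z + tau 2 z * t 2 2 z)
         - tau 2 z * tau 1 z - xi 2 z * (tau 1 z * t 1 1 z + tau 2 z * t 1 2 z))
       + f l 1 z * vth 1 z + f l 2 z * vth 2 z) / 2"
    unfolding hor_xi hor_tau[OF z] h_def trG_def th_def vth_def by (simp add: field_simps)
  also have "tau 1 z * tau 2 z + xi 1 z * (tau 1 z * t 2 1 z + tau 2 z * t 2 2 z)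
         - tau 2 z * tau 1 z - xi 2 z * (tau 1 z * t 1 1 z + tau 2 z * t 1 2 z) = tr z * th z"
    unfolding tr_def th_def tau_def by (simp add: field_simps)
  finally show ?thesis by (simp add: mult_ac)
qed

lemma hor_K_c: "hor h l (K k r) z = dK l k r z" "hor h l (c k) z = dc l k z"
  unfolding K_def[abs_def] c_def[abs_def]
  by (simp_all add: hor_pullback[OF smooth_K_base z] hor_pullback[OF smooth_c_base z] dK_def dc_def)

lemma hor_b: "hor h l (b k) z = dc l k z + dK l k 1 z * xi 1 z + dK l k 2 z * xi 2 z
    - (K k 1 z * h z l 1 + K k 2 z * h z l 2) / 2
    - dt z * (hor h l th z * tau k z + th z * hor h l (tau k) z) / 4"
  unfolding b_def[abs_def]
  by (simp add: hor_rules[OF z] hor_K_c hor_dt[OF z] hor_xi) (simp add: field_simps)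

lemma sg_xi: "(sg l z + tr z * tau l z) / 2 = trS l 1 z * xi 1 z + trS l 2 z * xi 2 z"
  unfolding sg_def trS_def tau_def by (simp add: field_simps)

text \<open>The exterior covariant derivative of \<open>b\<close>. The term of degree four comes from the cubic part
  of \<open>b\<close> by two uses of the identity \<open>dt_th\<close>.\<close>

lemma curv_q: "hor h 1 (b 2) z - hor h 2 (b 1) z - (A 1 1 1 z + A 1 2 2 z) * b 2 z
    + (A 2 1 1 z + A 2 2 2 z) * b 1 z = q z"
proof -
  have s: "G 2 1 j z = G 1 2 j z" "f 2 1 z = f 1 2 z" for j
    by (rule G_sym[OF z], rule f_sym[OF z])
  have A: "A l 1 1 z + A l 2 2 z = trG l z - (sg l z + tr z * tau l z) / 2" for l
    unfolding A_def trG_def sg_def tr_def by (simp add: field_simps)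
  have P: "(dt z * th z)^2 = dt z * th z * (tau 1 z * sg 2 z - tau 2 z * sg 1 z)"
    unfolding sg_def dt_th[OF z, symmetric] by (simp add: power2_eq_square)
  have Q: "trS l 1 z * c k z * xi 1 z + trS l 2 z * c k z * xi 2 z = (sg l z + tr z * tau l z) / 2 * c k z" for l k
    unfolding sg_xi by (simp add: field_simps)
  have T: "hor h l (tau k) z = G l k 1 z * tau 1 z + G l k 2 z * tau 2 z
    - (tau l z * sg k z + f l 1 z * t k 1 z + f l 2 z * t k 2 z) / 2" for l k
    by (simp add: hor_tau[OF z] sg_def)
  have L: "q1 1 z * xi 1 z + q1 2 z * xi 2 z =
     (dK 1 2 1 z - dK 2 1 1 z) * xi 1 z + (dK 1 2 2 z - dK 2 1 2 z) * xi 2 z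
     + K 2 1 z * (G 1 1 1 z * xi 1 z + G 1 1 2 z * xi 2 z) + K 2 2 z * (G 1 2 1 z * xi 1 z + G 1 2 2 z * xi 2 z)
     - K 1 1 z * (G 2 1 1 z * xi 1 z + G 2 1 2 z * xi 2 z) - K 1 2 z * (G 2 2 1 z * xi 1 z + G 2 2 2 z * xi 2 z)
     - trG 1 z * (K 2 1 z * xi 1 z + K 2 2 z * xi 2 z) + trG 2 z * (K 1 1 z * xi 1 z + K 1 2 z * xi 2 z)
     + (sg 1 z + tr z * tau 1 z) / 2 * c 2 z - (sg 2 z + tr z * tau 2 z) / 2 * c 1 z"
    unfolding q1_def Q[symmetric] by (simp add: field_simps)
  show ?thesis
    unfolding q_def add.assoc[of "q0 z"] L P hor_b hor_th T A
    unfolding q0_def b_def h_def s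
    by (simp add: field_simps trG_def)
qed

end

lemma hor_cong: "z \<in> U \<Longrightarrow> (\<And>u. u \<in> U \<Longrightarrow> p u = p' u) \<Longrightarrow> hor h l p z = hor h l p' z"
  unfolding hor_def by (rule fd_cong[OF open_U_ext])

lemma ver_cong: "z \<in> U \<Longrightarrow> (\<And>u. u \<in> U \<Longrightarrow> p u = p' u) \<Longrightarrow> ver l p z = ver l p' z"
  by (rule pd_cong_open[OF open_U_ext])

context
  fixes z assumes z: "z \<in> U"
begin

lemma hor_om:
  "hor h m (\<lambda>u. walker_A h u l i k) z = hor h m (A l i k) z"
  "hor h m (\<lambda>u. walker_B h u l i k) z = eps i k * hor h m (b l) z"
  "hor h m (\<lambda>u. - walker_A h u l i k) z = - hor h m (A l i k) z"
proof -
  show 1: "hor h m (\<lambda>u. walker_A h u l i k) z = hor h m (A l i k) z"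
    by (rule hor_cong[OF z]) (simp add: walker_A_ext A_def)
  have "hor h m (\<lambda>u. walker_B h u l i k) z = hor h m (\<lambda>u. eps i k * b l u) z"
    by (rule hor_cong[OF z]) (rule walker_B_ext)
  then show "hor h m (\<lambda>u. walker_B h u l i k) z = eps i k * hor h m (b l) z"
    by (simp add: hor_rules[OF z])
  show "hor h m (\<lambda>u. - walker_A h u l i k) z = - hor h m (A l i k) z"
    by (simp add: hor_rules[OF z] 1)
qed

lemma ver_om:
  "ver m (\<lambda>u. walker_A h u l i k) z = vA l i k m z"
  "ver m (\<lambda>u. walker_B h u l i k) z = eps i k * vb l m z"
  "ver m (\<lambda>u. - walker_A h u l i k) z = - vA l i k m z"
proof -
  show 1: "ver m (\<lambda>u. walker_A h u l i k) z = vA l i k m z"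
    unfolding ver_A[OF z, symmetric] by (rule ver_cong[OF z]) (simp add: walker_A_ext A_def)
  have "ver m (\<lambda>u. walker_B h u l i k) z = ver m (\<lambda>u. eps i k * b l u) z"
    by (rule ver_cong[OF z]) (rule walker_B_ext)
  then show "ver m (\<lambda>u. walker_B h u l i k) z = eps i k * vb l m z"
    by (simp add: ver_rules[OF z] ver_b[OF z])
  show "ver m (\<lambda>u. - walker_A h u l i k) z = - vA l i k m z"
    by (simp add: ver_rules[OF z] 1)
qed

lemma curv_frame_skew: "curv_frame z x y v w = - curv_frame z y x v w"
  by (simp add: curv_frame_def sum.distrib sum_subtractf algebra_simps)

lemmas frame_derivative = fd_walker_frame(1) hor_def[symmetric]

text \<open>All curvature with a vertical argument is a vertical derivative of a connection coefficient,
  since vertical derivatives of the frame vanish.\<close>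

lemma curv_mixed:
  "curv_frame z (Inr j) (Inl l) (Inl i) (Inl k) = vA l i k j z"
  "curv_frame z (Inr j) (Inl l) (Inl i) (Inr k) = eps i k * vb l j z"
  "curv_frame z (Inr j) (Inl l) (Inr i) (Inr k) = - vA l k i j z"
  "curv_frame z (Inr j) (Inl l) (Inr i) (Inl k) = 0"
  "curv_frame z (Inr j) (Inr l) x y = 0"
  by (simp_all add: curv_frame_def sum_UNIV_Plus frame_derivative ver_om hor_rules[OF z] ver_rules[OF z])

lemma curv_mixed':
  "curv_frame z (Inl l) (Inr j) (Inl i) (Inl k) = - vA l i k j z"
  "curv_frame z (Inl l) (Inr j) (Inl i) (Inr k) = - (eps i k * vb l j z)"
  "curv_frame z (Inl l) (Inr j) (Inr i) (Inr k) = vA l k i j z"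
  "curv_frame z (Inl l) (Inr j) (Inr i) (Inl k) = 0"
  using curv_frame_skew[of "Inl l" "Inr j"] curv_mixed by simp_all

lemma curv_hor12:
  "curv_frame z (Inl 1) (Inl 2) (Inl i) (Inl k) = - vb i k z"
  "curv_frame z (Inl 1) (Inl 2) (Inr i) (Inr k) = vb k i z"
  "curv_frame z (Inl 1) (Inl 2) (Inl i) (Inr k) = eps i k * q z"
  "curv_frame z (Inl 1) (Inl 2) (Inr i) (Inl k) = 0"
proof -
  have s: "walker_A h z 2 1 j = walker_A h z 1 2 j" for j
    using G_sym[OF z, of 1 2] by (simp add: walker_A_ext[OF z])
  have AA: "walker_A h z l i k = A l i k z" for l i k
    using walker_A_ext[OF z] by (simp add: A_def)
  have s': "A 2 1 j z = A 1 2 j z" for j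
    using s AA by metis
  show "curv_frame z (Inl 1) (Inl 2) (Inl i) (Inl k) = - vb i k z"
    using curv_horizontal[OF z, of i k, simplified s']
    by (simp add: curv_frame_def sum_UNIV_Plus frame_derivative hor_om sum_2 s) (simp add: AA s')
  show "curv_frame z (Inl 1) (Inl 2) (Inr i) (Inr k) = vb k i z"
    using curv_horizontal[OF z, of k i, simplified s']
    by (simp add: curv_frame_def sum_UNIV_Plus frame_derivative hor_om sum_2 s) (simp add: AA s' algebra_simps)
  show "curv_frame z (Inl 1) (Inl 2) (Inl i) (Inr k) = eps i k * q z"
    using curv_q[OF z, simplified s'] exhaust_2[of i] exhaust_2[of k]
    by (auto simp: curv_frame_def sum_UNIV_Plus frame_derivative hor_om sum_2 s walker_B_ext[OF z])
       (simp_all add: AA s' algebra_simps)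
  show "curv_frame z (Inl 1) (Inl 2) (Inr i) (Inl k) = 0"
    by (simp add: curv_frame_def sum_UNIV_Plus frame_derivative hor_om hor_rules[OF z])
qed

lemma curv_hor:
  "curv_frame z (Inl m) (Inl n) (Inl i) (Inl k) = - (eps m n * vb i k z)"
  "curv_frame z (Inl m) (Inl n) (Inr i) (Inr k) = eps m n * vb k i z"
  "curv_frame z (Inl m) (Inl n) (Inl i) (Inr k) = eps m n * eps i k * q z"
  "curv_frame z (Inl m) (Inl n) (Inr i) (Inl k) = 0"
  using exhaust_2[of m] exhaust_2[of n] curv_frame_skew[of "Inl m" "Inl n"] curv_hor12
  by auto

end

subsection \<open>Ricci and Weyl tensor\<close>

definition kd :: "2 \<Rightarrow> 2 \<Rightarrow> real" where "kd i j = (if i = j then 1 else 0)"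

lemma kd_simps [simp]: "kd 1 1 = 1" "kd 2 2 = 1" "kd 1 2 = 0" "kd 2 1 = 0"
  by (simp_all add: kd_def)

text \<open>The mixed Ricci components depend on \<open>T\<close> only.\<close>

definition rho :: "2 \<Rightarrow> 2 \<Rightarrow> real^(2 + 2) \<Rightarrow> real" where
  "rho i j z = tr z * t i j z - kd i j * dt z / 2"

definition ricci_hh :: "2 \<Rightarrow> 2 \<Rightarrow> real^(2 + 2) \<Rightarrow> real" where
  "ricci_hh i j z = eps i 1 * vb j 1 z + eps i 2 * vb j 2 z + eps j 1 * vb i 1 z + eps j 2 * vb i 2 z"

text \<open>The Weyl tensor has four kinds of components: \<open>w\<close> and the scalar curvature depend on \<open>T\<close>
  alone, the remaining ones are the vertical divergence \<open>beta\<close> of \<open>b\<close> and the function \<open>q\<close>.\<close>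

definition beta :: "real^(2 + 2) \<Rightarrow> real" where
  "beta z = K 1 1 z + K 2 2 z - tr z * dt z * th z / 2"

definition w :: "2 \<Rightarrow> 2 \<Rightarrow> 2 \<Rightarrow> 2 \<Rightarrow> real^(2 + 2) \<Rightarrow> real" where
  "w l i j k z = - (t l k z * t i j z + t l j z * t i k z) / 2
     + (rho i j z * kd l k + rho l k z * kd i j) / 2 - (tr z * tr z - dt z) / 3 * (kd i j * kd l k)"

lemma eps_skew: "eps j i = - eps i j"
  using exhaust_2[of i] exhaust_2[of j] by auto

lemma T_square: "t i 1 z * t 1 j z + t i 2 z * t 2 j z = tr z * t i j z - kd i j * dt z"
  using exhaust_2[of i] exhaust_2[of j] by (auto simp: tr_def dt_def algebra_simps)

lemma beta_divergence: "vb 1 1 z + vb 2 2 z = beta z"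
  by (simp add: vb_def beta_def vth_def th_def tau_def tr_def field_simps)

context
  fixes z assumes z: "z \<in> U"
begin

lemmas curv_simps = curv_mixed[OF z] curv_mixed'[OF z] curv_hor[OF z]

lemma ricci_closed:
  "ricci_frame z (Inl i) (Inl j) = ricci_hh i j z"
  "ricci_frame z (Inl i) (Inr j) = rho i j z"
  "ricci_frame z (Inr j) (Inl i) = rho i j z"
  "ricci_frame z (Inr i) (Inr j) = 0"
proof -
  show "ricci_frame z (Inl i) (Inl j) = ricci_hh i j z"
    by (simp add: ricci_frame_def sum_UNIV_Plus curv_simps sum_2 ricci_hh_def eps_skew[of i] algebra_simps)
  have T: "t 1 j z * t i 1 z + t 2 j z * t i 2 z = tr z * t i j z - kd i j * dt z"
    using T_square[of i z j] by (simp add: mult.commute)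
  show "ricci_frame z (Inl i) (Inr j) = rho i j z"
    using T by (simp add: ricci_frame_def sum_UNIV_Plus curv_simps sum_2 rho_def vA_def tr_def field_simps)
  show "ricci_frame z (Inr j) (Inl i) = rho i j z"
    using T by (simp add: ricci_frame_def sum_UNIV_Plus curv_simps sum_2 rho_def vA_def tr_def field_simps)
  show "ricci_frame z (Inr i) (Inr j) = 0"
    by (simp add: ricci_frame_def sum_UNIV_Plus curv_simps sum_2)
qed

lemma scalar_closed: "scalar_frame z = 2 * (tr z * tr z - dt z)"
  by (simp add: scalar_frame_def sum_UNIV_Plus sum_2 ricci_closed rho_def tr_def algebra_simps)

end

lemma gram_simps [simp]:
  "gram_coeff (Inl i) (Inl j) = 0" "gram_coeff (Inr i) (Inr j) = 0"
  "gram_coeff (Inl i) (Inr j) = kd i j" "gram_coeff (Inr i) (Inl j) = kd i j"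
  by (auto simp: gram_coeff_def kd_def)

definition weyl_comp :: "2 + 2 \<Rightarrow> 2 + 2 \<Rightarrow> 2 + 2 \<Rightarrow> 2 + 2 \<Rightarrow> real^(2 + 2) \<Rightarrow> real" where
  "weyl_comp a1 a2 a3 a4 z = (case (a1, a2, a3, a4) of
      (Inr j, Inl l, Inl i, Inr k) \<Rightarrow> w l i j k z
    | (Inl l, Inr j, Inl i, Inr k) \<Rightarrow> - w l i j k z
    | (Inr j, Inl l, Inr k, Inl i) \<Rightarrow> - w l i j k z
    | (Inl l, Inr j, Inr k, Inl i) \<Rightarrow> w l i j k z
    | (Inr j, Inr m, Inl i, Inl k) \<Rightarrow> eps j m * eps i k * (tr z * tr z - dt z) / 6
    | (Inl i, Inl k, Inr j, Inr m) \<Rightarrow> eps j m * eps i k * (tr z * tr z - dt z) / 6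
    | (Inr j, Inl l, Inl i, Inl m) \<Rightarrow> kd j l * eps i m * beta z / 2
    | (Inl l, Inr j, Inl i, Inl m) \<Rightarrow> - (kd j l * eps i m * beta z / 2)
    | (Inl i, Inl m, Inr j, Inl l) \<Rightarrow> kd j l * eps i m * beta z / 2
    | (Inl i, Inl m, Inl l, Inr j) \<Rightarrow> - (kd j l * eps i m * beta z / 2)
    | (Inl i, Inl m, Inl l, Inl k) \<Rightarrow> eps i m * eps l k * q z
    | _ \<Rightarrow> 0)"

lemma weyl_comp_simps [simp]:
  "weyl_comp (Inr j) (Inl l) (Inl i) (Inr k) = w l i j k"
  "weyl_comp (Inl l) (Inr j) (Inl i) (Inr k) z = - w l i j k z"
  "weyl_comp (Inr j) (Inl l) (Inr k) (Inl i) z = - w l i j k z"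
  "weyl_comp (Inl l) (Inr j) (Inr k) (Inl i) = w l i j k"
  "weyl_comp (Inr j) (Inr m) (Inl i) (Inl k) z = eps j m * eps i k * (tr z * tr z - dt z) / 6"
  "weyl_comp (Inl i) (Inl k) (Inr j) (Inr m) z = eps j m * eps i k * (tr z * tr z - dt z) / 6"
  "weyl_comp (Inr j) (Inl l) (Inl i) (Inl m) z = kd j l * eps i m * beta z / 2"
  "weyl_comp (Inl l) (Inr j) (Inl i) (Inl m) z = - (kd j l * eps i m * beta z / 2)"
  "weyl_comp (Inl i) (Inl m) (Inr j) (Inl l) z = kd j l * eps i m * beta z / 2"
  "weyl_comp (Inl i) (Inl m) (Inl l) (Inr j) z = - (kd j l * eps i m * beta z / 2)"
  "weyl_comp (Inl i) (Inl m) (Inl l) (Inl k) z = eps i m * eps l k * q z"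
  by (simp_all add: weyl_comp_def fun_eq_iff)

lemma weyl_comp_zero [simp]:
  "weyl_comp (Inr j) (Inr m) (Inr x) y z = 0" "weyl_comp (Inr j) (Inr m) y (Inr x) z = 0"
  "weyl_comp (Inr x) y (Inr j) (Inr m) z = 0" "weyl_comp y (Inr x) (Inr j) (Inr m) z = 0"
proof -
  show "weyl_comp (Inr j) (Inr m) (Inr x) y z = 0" by (cases y) (simp_all add: weyl_comp_def)
  show "weyl_comp (Inr j) (Inr m) y (Inr x) z = 0" by (cases y) (simp_all add: weyl_comp_def)
  show "weyl_comp (Inr x) y (Inr j) (Inr m) z = 0" by (cases y) (simp_all add: weyl_comp_def)
  show "weyl_comp y (Inr x) (Inr j) (Inr m) z = 0" by (cases y) (simp_all add: weyl_comp_def)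
qed

text \<open>The vertical derivatives of \<open>b\<close> enter the curvature in full but only their trace \<open>beta\<close> is
  left after removing the Ricci part.\<close>

lemma weyl_closed:
  assumes z: "z \<in> U"
  shows "weyl_frame z a1 a2 a3 a4 = weyl_comp a1 a2 a3 a4 z"
proof -
  have car: "real CARD(2 + 2) = 4" by simp
  note e = weyl_frame_def car ricci_closed[OF z] scalar_closed[OF z] curv_simps[OF z]
  have r: "rho 1 1 z + rho 2 2 z = tr z * tr z - dt z"
    by (simp add: rho_def tr_def algebra_simps)
  have r': "rho 1 1 z = tr z * tr z - dt z - rho 2 2 z" using r by simp
  have bb: "vb 1 1 z = beta z - vb 2 2 z" using beta_divergence[of z] by simp
  have ix: "x = 1 \<or> x = 2" for x :: 2 by (rule exhaust_2)
  have w: "weyl_frame z (Inr j) (Inl l) (Inl i) (Inr k) = w l i j k z"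
    "weyl_frame z (Inl l) (Inr j) (Inl i) (Inr k) = - w l i j k z"
    "weyl_frame z (Inr j) (Inl l) (Inr k) (Inl i) = - w l i j k z"
    "weyl_frame z (Inl l) (Inr j) (Inr k) (Inl i) = w l i j k z" for l i j k
    by (simp_all add: e w_def vA_def kd_def field_simps)
  have s: "weyl_frame z (Inr j) (Inr m) (Inl i) (Inl k) = eps j m * eps i k * (tr z * tr z - dt z) / 6"
    "weyl_frame z (Inl i) (Inl k) (Inr j) (Inr m) = eps j m * eps i k * (tr z * tr z - dt z) / 6" for i j k m
    using ix[of i] ix[of j] ix[of k] ix[of m] by (auto simp: e r' field_simps)
  have b: "weyl_frame z (Inr j) (Inl l) (Inl i) (Inl m) = kd j l * eps i m * beta z / 2"
    "weyl_frame z (Inl l) (Inr j) (Inl i) (Inl m) = - (kd j l * eps i m * beta z / 2)"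
    "weyl_frame z (Inl i) (Inl m) (Inr j) (Inl l) = kd j l * eps i m * beta z / 2"
    "weyl_frame z (Inl i) (Inl m) (Inl l) (Inr j) = - (kd j l * eps i m * beta z / 2)" for i j l m
    using ix[of i] ix[of j] ix[of l] ix[of m] by (auto simp: e ricci_hh_def bb field_simps)
  have q: "weyl_frame z (Inl i) (Inl m) (Inl l) (Inl k) = eps i m * eps l k * q z" for i m l k
    by (simp add: e)
  have o: "weyl_frame z (Inr j) (Inr m) (Inr x) y = 0" "weyl_frame z (Inr j) (Inr m) y (Inr x) = 0"
    "weyl_frame z (Inr x) y (Inr j) (Inr m) = 0" "weyl_frame z y (Inr x) (Inr j) (Inr m) = 0" for j m x y
  proof -
    show "weyl_frame z (Inr j) (Inr m) (Inr x) y = 0" by (cases y) (simp_all add: e)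
    show "weyl_frame z (Inr j) (Inr m) y (Inr x) = 0" by (cases y) (simp_all add: e)
    show "weyl_frame z (Inr x) y (Inr j) (Inr m) = 0" by (cases y) (simp_all add: e)
    show "weyl_frame z y (Inr x) (Inr j) (Inr m) = 0" by (cases y) (simp_all add: e)
  qed
  show ?thesis
    by (cases a1; cases a2; cases a3; cases a4) (simp_all add: w s b q o)
qed

subsection \<open>The divergence of the Weyl tensor\<close>

text \<open>Horizontal derivative of \<open>beta\<close>, and the first and second vertical derivatives of \<open>th\<close> and
  \<open>q\<close>.\<close>

definition hbeta :: "2 \<Rightarrow> real^(2 + 2) \<Rightarrow> real" where
  "hbeta j z = dK j 1 1 z + dK j 2 2 z - tr z * dt z / 2 * (trG j z * th z
     - (tr z * tau j z * th z + f j 1 z * vth 1 z + f j 2 z * vth 2 z) / 2)"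

definition vvth :: "2 \<Rightarrow> 2 \<Rightarrow> real^(2 + 2) \<Rightarrow> real" where
  "vvth r m z = (if r = 1 then t 2 m z else - t 1 m z) + kd 1 m * t 2 r z - kd 2 m * t 1 r z"

definition vq :: "2 \<Rightarrow> real^(2 + 2) \<Rightarrow> real" where
  "vq m z = q1 m z
    - (t 1 m z * (tau 1 z * K 2 1 z + tau 2 z * K 2 2 z) + tau 1 z * (t 1 m z * K 2 1 z + t 2 m z * K 2 2 z)
       - t 2 m z * (tau 1 z * K 1 1 z + tau 2 z * K 1 2 z) - tau 2 z * (t 1 m z * K 1 1 z + t 2 m z * K 1 2 z)) / 2
    + trS 1 m z * (K 2 1 z * xi 1 z + K 2 2 z * xi 2 z) + (trS 1 1 z * xi 1 z + trS 1 2 z * xi 2 z) * K 2 m z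
    - trS 2 m z * (K 1 1 z * xi 1 z + K 1 2 z * xi 2 z) - (trS 2 1 z * xi 1 z + trS 2 2 z * xi 2 z) * K 1 m z
    + dt z / 8 * (f 1 1 z * (vvth 1 m z * tau 2 z + vth 1 z * t 2 m z + vth m z * t 2 1 z)
                + f 1 2 z * (vvth 2 m z * tau 2 z + vth 2 z * t 2 m z + vth m z * t 2 2 z)
                - f 2 1 z * (vvth 1 m z * tau 1 z + vth 1 z * t 1 m z + vth m z * t 1 1 z)
                - f 2 2 z * (vvth 2 m z * tau 1 z + vth 2 z * t 1 m z + vth m z * t 1 2 z))
    + dt z * dt z * th z * vth m z / 2"

definition vvq :: "2 \<Rightarrow> 2 \<Rightarrow> real^(2 + 2) \<Rightarrow> real" where
  "vvq m k z =
    - (t 1 m z * (t 1 k z * K 2 1 z + t 2 k z * K 2 2 z) + t 1 k z * (t 1 m z * K 2 1 z + t 2 m z * K 2 2 z)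
       - t 2 m z * (t 1 k z * K 1 1 z + t 2 k z * K 1 2 z) - t 2 k z * (t 1 m z * K 1 1 z + t 2 m z * K 1 2 z)) / 2
    + trS 1 m z * K 2 k z + trS 1 k z * K 2 m z - trS 2 m z * K 1 k z - trS 2 k z * K 1 m z
    + dt z / 8 * (f 1 1 z * (vvth 1 m z * t 2 k z + vvth 1 k z * t 2 m z + vvth m k z * t 2 1 z)
                + f 1 2 z * (vvth 2 m z * t 2 k z + vvth 2 k z * t 2 m z + vvth m k z * t 2 2 z)
                - f 2 1 z * (vvth 1 m z * t 1 k z + vvth 1 k z * t 1 m z + vvth m k z * t 1 1 z)
                - f 2 2 z * (vvth 2 m z * t 1 k z + vvth 2 k z * t 1 m z + vvth m k z * t 1 2 z))
    + dt z * dt z * (vth k z * vth m z + th z * vvth m k z) / 2"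

lemma smooth_weyl_data [simp]:
  "smooth_on U beta" "smooth_on U (w l i j k)" "smooth_on U (hbeta j)" "smooth_on U (vvth r m)" "smooth_on U (vq m)"
  "smooth_on U (rho i j)"
proof -
  have rho: "smooth_on U (rho i j)" for i j
    by (simp add: rho_def[abs_def])
  have "smooth_on U (\<lambda>z. if r = 1 then t 2 m z else - t 1 m z)"
    by (cases "r = 1") simp_all
  then show v: "smooth_on U (vvth r m)" for r m
    by (cases "r = 1") (simp_all add: vvth_def[abs_def])
  show "smooth_on U beta" "smooth_on U (w l i j k)" "smooth_on U (hbeta j)" "smooth_on U (vq m)"
    by (simp_all add: v rho beta_def[abs_def] w_def[abs_def] hbeta_def[abs_def] vq_def[abs_def])
  show "smooth_on U (rho i j)" by (rule rho)
qed

context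
  fixes z assumes z: "z \<in> U"
begin

lemma ver_base: "ver r (dc l k) z = 0" "ver r (dK l k s) z = 0" "ver r (trG l) z = 0" "ver r (trS l s) z = 0"
  "ver r (q1 s) z = 0" "ver r q0 z = 0" "ver r (vvth s m) z = 0" "ver r (w l i j k) z = 0"
proof -
  show 1: "ver r (dc l k) z = 0" "ver r (dK l k s) z = 0" "ver r (trG l) z = 0" "ver r (trS l s) z = 0" for l k s
    by (simp_all add: dc_def[abs_def] dK_def[abs_def] trG_def[abs_def] trS_def[abs_def] ver_rules[OF z]
        ver_basic[OF z] ver_derived[OF z] ver_pullback[OF smooth_on_pd z] smooth_c_base smooth_K_base)
  show "ver r (q1 s) z = 0" "ver r q0 z = 0"
    by (simp_all add: q1_def[abs_def] q0_def[abs_def] ver_rules[OF z] ver_basic[OF z] ver_derived[OF z] 1)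
  show "ver r (vvth s m) z = 0"
    by (cases "s = 1") (simp_all add: vvth_def[abs_def] ver_rules[OF z] ver_basic[OF z])
  show "ver r (w l i j k) z = 0"
    by (simp add: w_def[abs_def] rho_def[abs_def] ver_rules[OF z] ver_basic[OF z] ver_derived[OF z])
qed

lemma ver_vth: "ver m (vth r) z = vvth r m z"
  using exhaust_2[of m]
  by (cases "r = 1") (auto simp: vth_def[abs_def] vvth_def ver_rules[OF z] ver_xi ver_tau[OF z] ver_basic[OF z])

lemma ver_sg: "ver m (sg i) z = t 1 m z * t i 1 z + t 2 m z * t i 2 z"
  by (simp add: sg_def[abs_def] ver_rules[OF z] ver_tau[OF z] ver_basic[OF z])

lemmas ver_all = ver_rules[OF z] ver_xi ver_basic[OF z] ver_tau[OF z] ver_derived[OF z] ver_th[OF z]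
  ver_b[OF z] ver_base ver_vth ver_sg

lemma ver_beta: "ver r beta z = - tr z * dt z * vth r z / 2"
  by (simp add: beta_def[abs_def] ver_all)

lemma hor_beta: "hor h j beta z = hbeta j z"
  by (simp add: beta_def[abs_def] hor_rules[OF z] hor_K_c[OF z] hor_tr[OF z] hor_dt[OF z] hor_th[OF z] hbeta_def)

lemma ver_q: "ver m q z = vq m z"
proof -
  have S: "(sg l z + tr z * tau l z) / 2 = trS l 1 z * xi 1 z + trS l 2 z * xi 2 z" for l
    by (rule sg_xi[OF z])
  have S': "(t 1 m z * t l 1 z + t 2 m z * t l 2 z + tr z * t l m z) / 2 = trS l m z" for l
    by (simp add: trS_def mult.commute)
  have "m = 1 \<or> m = 2" by (rule exhaust_2)
  then show ?thesis
    unfolding q_def[abs_def] vq_def S[symmetric] S'[symmetric]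
    by (auto simp: ver_all field_simps power2_eq_square)
qed

lemma ver_vq: "ver k (vq m) z = vvq m k z"
proof -
  have "k = 1 \<or> k = 2" by (rule exhaust_2)
  then show ?thesis
    unfolding vq_def[abs_def] vvq_def
    by (auto simp: ver_all field_simps)
qed

text \<open>\<open>w\<close> is built from \<open>T\<close>, hence parallel for the affine connection.\<close>

lemma hor_w: "hor h m (w l i j k) z =
    (G m l 1 z * w 1 i j k z + G m l 2 z * w 2 i j k z) + (G m i 1 z * w l 1 j k z + G m i 2 z * w l 2 j k z)
    - (G m 1 j z * w l i 1 k z + G m 2 j z * w l i 2 k z) - (G m 1 k z * w l i j 1 z + G m 2 k z * w l i j 2 z)"
proof -
  have *: "hor h m (rho i j) z = tr z * hor h m (t i j) z" for i j
    by (simp add: rho_def[abs_def] hor_rules[OF z] hor_tr[OF z] hor_dt[OF z])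
  have ix: "x = 1 \<or> x = 2" for x :: 2 by (rule exhaust_2)
  show ?thesis
    using ix[of l] ix[of i] ix[of j] ix[of k]
    by (auto simp: w_def[abs_def] hor_rules[OF z] hor_tr[OF z] hor_dt[OF z] * hor_t[OF z])
       (simp_all add: rho_def field_simps)
qed

end

text \<open>The divergence of the Weyl tensor on a vertical and two horizontal vectors. Its coefficients
  arise from contracting \<open>w\<close> with the tensor \<open>G - A\<close> and adding the vertical derivative of \<open>beta\<close>,
  simplified by the theorem of Cayley and Hamilton.\<close>

definition div_mixed :: "2 \<Rightarrow> 2 \<Rightarrow> 2 \<Rightarrow> real^(2 + 2) \<Rightarrow> real" where
  "div_mixed a i j z = (tr z * tr z / 4 + dt z / 2) * t i a z * tau j z + (dt z - tr z * tr z / 4) * t j a z * tau i z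
     + dt z * dt z / 2 * kd i a * xi j z - tr z * dt z / 4 * kd i a * tau j z - 3 / 4 * tr z * dt z * t i a z * xi j z"

text \<open>The divergence on three horizontal vectors is \<open>eps\<close> times this covector.\<close>

definition div_hor :: "2 \<Rightarrow> real^(2 + 2) \<Rightarrow> real" where
  "div_hor j z = (tr z * tr z - dt z) / 2 * b j z + eps j 1 * vq 1 z + eps j 2 * vq 2 z
     - (hbeta j z - (trG j z - (sg j z + tr z * tau j z) / 2) * beta z) / 2"

definition div_comp :: "2 + 2 \<Rightarrow> 2 + 2 \<Rightarrow> 2 + 2 \<Rightarrow> real^(2 + 2) \<Rightarrow> real" where
  "div_comp a1 a2 a3 z = (case (a1, a2, a3) of
      (Inr a, Inl i, Inl j) \<Rightarrow> div_mixed a i j z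
    | (Inl i, Inr a, Inl j) \<Rightarrow> - div_mixed a i j z
    | (Inl i, Inl k, Inl j) \<Rightarrow> eps i k * div_hor j z
    | (Inl i, Inl k, Inr a) \<Rightarrow> - (eps i k * tr z * dt z * vth a z / 4)
    | _ \<Rightarrow> 0)"

lemma div_comp_simps [simp]:
  "div_comp (Inr a) (Inl i) (Inl j) = div_mixed a i j"
  "div_comp (Inl i) (Inr a) (Inl j) z = - div_mixed a i j z"
  "div_comp (Inl i) (Inl k) (Inl j) z = eps i k * div_hor j z"
  "div_comp (Inl i) (Inl k) (Inr a) z = - (eps i k * tr z * dt z * vth a z / 4)"
  "div_comp (Inr a) x (Inr a') z = 0" "div_comp x (Inr a) (Inr a') z = 0" "div_comp (Inr a) (Inr a') x z = 0"
proof -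
  show "div_comp (Inr a) (Inl i) (Inl j) = div_mixed a i j" "div_comp (Inl i) (Inr a) (Inl j) z = - div_mixed a i j z"
    "div_comp (Inl i) (Inl k) (Inl j) z = eps i k * div_hor j z"
    "div_comp (Inl i) (Inl k) (Inr a) z = - (eps i k * tr z * dt z * vth a z / 4)"
    by (simp_all add: div_comp_def fun_eq_iff)
  show "div_comp (Inr a) x (Inr a') z = 0" by (cases x) (simp_all add: div_comp_def)
  show "div_comp x (Inr a) (Inr a') z = 0" by (cases x) (simp_all add: div_comp_def)
  show "div_comp (Inr a) (Inr a') x z = 0" by (cases x) (simp_all add: div_comp_def)
qed

lemma smooth_div [simp]: "smooth_on U (div_mixed a i j)" "smooth_on U (div_hor j)"
  by (simp_all add: div_mixed_def[abs_def] div_hor_def[abs_def])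

abbreviation nab :: "(real^(2 + 2) \<Rightarrow> (2 + 2) list \<Rightarrow> real) \<Rightarrow> real^(2 + 2) \<Rightarrow> (2 + 2) list \<Rightarrow> real" where
  "nab \<equiv> cov_frame (walker_frame h) (walker_om h)"

lemma weyl_comp_fun:
  "weyl_comp (Inl l) (Inr j) (Inl i) (Inr k) = (\<lambda>z. - w l i j k z)"
  "weyl_comp (Inr j) (Inl l) (Inr k) (Inl i) = (\<lambda>z. - w l i j k z)"
  "weyl_comp (Inr j) (Inr m) (Inl i) (Inl k) = (\<lambda>z. eps j m * eps i k * (tr z * tr z - dt z) / 6)"
  "weyl_comp (Inl i) (Inl k) (Inr j) (Inr m) = (\<lambda>z. eps j m * eps i k * (tr z * tr z - dt z) / 6)"
  "weyl_comp (Inr j) (Inl l) (Inl i) (Inl m) = (\<lambda>z. kd j l * eps i m * beta z / 2)"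
  "weyl_comp (Inl l) (Inr j) (Inl i) (Inl m) = (\<lambda>z. - (kd j l * eps i m * beta z / 2))"
  "weyl_comp (Inl i) (Inl m) (Inr j) (Inl l) = (\<lambda>z. kd j l * eps i m * beta z / 2)"
  "weyl_comp (Inl i) (Inl m) (Inl l) (Inr j) = (\<lambda>z. - (kd j l * eps i m * beta z / 2))"
  "weyl_comp (Inl i) (Inl m) (Inl l) (Inl k) = (\<lambda>z. eps i m * eps l k * q z)"
  "weyl_comp (Inr j) (Inr m) (Inr x) y = (\<lambda>z. 0)" "weyl_comp (Inr j) (Inr m) y (Inr x) = (\<lambda>z. 0)"
  "weyl_comp (Inr x) y (Inr j) (Inr m) = (\<lambda>z. 0)" "weyl_comp y (Inr x) (Inr j) (Inr m) = (\<lambda>z. 0)"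
  by (simp_all add: fun_eq_iff)

context
  fixes z assumes z: "z \<in> U"
begin

lemma div_weyl_expand:
  "div_weyl_frame z as = (\<Sum>l\<in>UNIV. nab (\<lambda>u. list4 (\<lambda>a b c d. weyl_comp a b c d u)) z [flip l, as ! 0, as ! 1, as ! 2, l])"
proof -
  have "nab (\<lambda>u. list4 (weyl_frame u)) z = nab (\<lambda>u. list4 (\<lambda>a b c d. weyl_comp a b c d u)) z"
    by (rule cov_frame_cong[OF z]) (simp add: list4_def fun_eq_iff weyl_closed)
  then show ?thesis by (simp add: div_weyl_frame_def)
qed

lemmas frame_expand = sum_UNIV_Plus sum_2 list4_def fd_walker_frame(1) hor_def[symmetric] weyl_comp_fun
  walker_A_ext[OF z, folded A_def] walker_B_ext[OF z]

lemmas deriv_all = hor_rules[OF z] ver_all[OF z] hor_w[OF z] hor_beta[OF z] ver_beta[OF z] ver_q[OF z] hor_tr[OF z] hor_dt[OF z]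

text \<open>The Christoffel symbols cancel because \<open>w\<close> is parallel; what remains is the action of
  \<open>G - A\<close> and the vertical derivative of \<open>beta\<close>.\<close>

lemma div_weyl_vhh: "div_weyl_frame z [Inr a, Inl i, Inl j] = div_mixed a i j z"
proof -
  have ix: "x = 1 \<or> x = 2" for x :: 2 by (rule exhaust_2)
  show ?thesis
    using ix[of a] ix[of i] ix[of j]
    unfolding div_weyl_expand
    by (auto simp: frame_expand deriv_all)
      (simp_all add: A_def w_def rho_def div_mixed_def vth_def tr_def dt_def tau_def field_simps)
qed

lemma div_weyl_hhh: "div_weyl_frame z [Inl i, Inl k, Inl j] = eps i k * div_hor j z"
proof -
  have ix: "x = 1 \<or> x = 2" for x :: 2 by (rule exhaust_2)
  have s: "G 2 1 j z = G 1 2 j z" for j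
    by (rule G_sym[OF z])
  show ?thesis
    using ix[of k] ix[of i] ix[of j]
    unfolding div_weyl_expand
    by (auto simp: frame_expand deriv_all)
      (simp_all add: A_def w_def rho_def div_hor_def trG_def sg_def tr_def dt_def s field_simps)
qed

lemma div_weyl_hhv: "div_weyl_frame z [Inl i, Inl k, Inr a] = - (eps i k * tr z * dt z * vth a z / 4)"
  unfolding div_weyl_expand
  using exhaust_2[of i] exhaust_2[of k] exhaust_2[of a]
  by (auto simp add: frame_expand deriv_all) (simp_all add: field_simps)

lemma div_weyl_vhv: "div_weyl_frame z [Inr a, Inl i, Inr j] = 0"
  unfolding div_weyl_expand
  using exhaust_2[of a] exhaust_2[of i] exhaust_2[of j]
  by (auto simp: frame_expand deriv_all)

lemma div_weyl_vvh: "div_weyl_frame z [Inr a, Inr i, Inl j] = 0"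
  unfolding div_weyl_expand
  using exhaust_2[of a] exhaust_2[of i] exhaust_2[of j]
  by (auto simp: frame_expand deriv_all)

lemma div_weyl_vvv: "div_weyl_frame z [Inr a, Inr i, Inr j] = 0"
  unfolding div_weyl_expand
  by (simp add: frame_expand deriv_all)
lemma div_weyl_hvh: "div_weyl_frame z [Inl i, Inr a, Inl j] = - div_mixed a i j z"
proof -
  have ix: "x = 1 \<or> x = 2" for x :: 2 by (rule exhaust_2)
  show ?thesis
    using ix[of a] ix[of i] ix[of j]
    unfolding div_weyl_expand
    by (auto simp: frame_expand deriv_all)
      (simp_all add: A_def w_def rho_def div_mixed_def vth_def tr_def dt_def tau_def field_simps)
qed

lemma div_weyl_hvv: "div_weyl_frame z [Inl i, Inr a, Inr j] = 0"
  unfolding div_weyl_expand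
  using exhaust_2[of a] exhaust_2[of i] exhaust_2[of j]
  by (auto simp: frame_expand deriv_all)

lemma div_weyl_closed: "div_weyl_frame z as = div_comp (as ! 0) (as ! 1) (as ! 2) z"
proof -
  have "div_weyl_frame z [x, y, v] = div_comp x y v z" for x y v
    by (cases x; cases y; cases v) (simp_all add: div_weyl_vhh div_weyl_hvh div_weyl_hhh div_weyl_hhv div_weyl_vhv div_weyl_hvv div_weyl_vvh div_weyl_vvv)
  from this[of "as ! 0" "as ! 1" "as ! 2"] show ?thesis
    by (simp add: div_weyl_frame_def)
qed

end

end

text \<open>Denominators become rational coefficients, the form suited to deciding ring identities.\<close>

lemma quotient_to_coefficient:
  "(x * y) / numeral n = 1 / numeral n * (x * y)" "(x + y) / numeral n = 1 / numeral n * (x + y)"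
  "(x - y) / numeral n = 1 / numeral n * (x - y)" "(- x) / numeral n = - (1 / numeral n * x)"
  for x y :: real
  by simp_all

context modified_extension
begin

subsection \<open>The Bach tensor\<close>

lemma div_comp_fun:
  "div_comp (Inl i) (Inr a) (Inl j) = (\<lambda>z. - div_mixed a i j z)"
  "div_comp (Inl i) (Inl k) (Inl j) = (\<lambda>z. eps i k * div_hor j z)"
  "div_comp (Inl i) (Inl k) (Inr a) = (\<lambda>z. - (eps i k * tr z * dt z * vth a z / 4))"
  "div_comp (Inr a) x (Inr a') = (\<lambda>z. 0)" "div_comp x (Inr a) (Inr a') = (\<lambda>z. 0)" "div_comp (Inr a) (Inr a') x = (\<lambda>z. 0)"
  by (simp_all add: fun_eq_iff)

text \<open>The part of the horizontal Bach tensor that is linear in \<open>K\<close>; it enters after lowering an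
  index with \<open>eps\<close> and symmetrising.\<close>

definition M :: "2 \<Rightarrow> 2 \<Rightarrow> real^(2 + 2) \<Rightarrow> real" where
  "M i r z = (dt z - tr z * tr z) / 3 * K i r z + tr z / 4 * (K i 1 z * t 1 r z + K i 2 z * t 2 r z)
    + 3 / 4 * tr z * (t i 1 z * K 1 r z + t i 2 z * K 2 r z)
    - (t i 1 z * (K 1 1 z * t 1 r z + K 1 2 z * t 2 r z) + t i 2 z * (K 2 1 z * t 1 r z + K 2 2 z * t 2 r z))"

definition bach_hh :: "2 \<Rightarrow> 2 \<Rightarrow> real^(2 + 2) \<Rightarrow> real" where
  "bach_hh i j z =
    - (tr z * tr z * dt z * dt z / 3 + 5 / 3 * dt z * dt z * dt z) * xi i z * xi j z
    + (13 * tr z * dt z * dt z - tr z * tr z * tr z * dt z) / 6 * (xi i z * tau j z + tau i z * xi j z)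
    + (tr z * tr z * dt z / 2 - 5 * dt z * dt z) * tau i z * tau j z
    - (tr z * tr z * dt z / 8 + dt z * dt z / 2) * f i j z
    + 5 / 8 * tr z * dt z * (t i 1 z * f 1 j z + t i 2 z * f 2 j z + t j 1 z * f 1 i z + t j 2 z * f 2 i z)
    - 3 / 2 * dt z * (t i 1 z * (f 1 1 z * t j 1 z + f 1 2 z * t j 2 z) + t i 2 z * (f 2 1 z * t j 1 z + f 2 2 z * t j 2 z))
    + eps 1 j * M i 1 z + eps 2 j * M i 2 z + eps 1 i * M j 1 z + eps 2 i * M j 2 z"

text \<open>The tensorial part of the horizontal derivative of \<open>div_mixed\<close>, and the tensor \<open>G - A\<close>.\<close>

definition vert :: "2 \<Rightarrow> 2 \<Rightarrow> 2 \<Rightarrow> 2 \<Rightarrow> real^(2 + 2) \<Rightarrow> real" where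
  "vert m a i j z =
     ((tr z * tr z / 4 + dt z / 2) * t i a z * (tau m z * sg j z + f m 1 z * t j 1 z + f m 2 z * t j 2 z)
     + (dt z - tr z * tr z / 4) * t j a z * (tau m z * sg i z + f m 1 z * t i 1 z + f m 2 z * t i 2 z)
     + dt z * dt z / 2 * kd i a * (tau m z * tau j z + f m j z)
     - tr z * dt z / 4 * kd i a * (tau m z * sg j z + f m 1 z * t j 1 z + f m 2 z * t j 2 z)
     - 3 / 4 * tr z * dt z * t i a z * (tau m z * tau j z + f m j z)) / 2"

definition tdiff :: "2 \<Rightarrow> 2 \<Rightarrow> 2 \<Rightarrow> real^(2 + 2) \<Rightarrow> real" where
  "tdiff l i k z = (t l k z * tau i z + t i k z * tau l z) / 2"

context
  fixes z assumes z: "z \<in> U"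
begin

lemma bach_div_comp:
  "bach_frame z p r = (\<Sum>k\<in>UNIV. nab (\<lambda>u as. div_comp (as ! 0) (as ! 1) (as ! 2) u) z [flip k, k, p, r])
     + 1/2 * (\<Sum>k\<in>UNIV. \<Sum>l\<in>UNIV. ricci_frame z (flip k) (flip l) * weyl_comp k p r l z)"
proof -
  have "nab div_weyl_frame z = nab (\<lambda>u as. div_comp (as ! 0) (as ! 1) (as ! 2) u) z"
    by (rule cov_frame_cong[OF z]) (simp add: fun_eq_iff div_weyl_closed)
  then show ?thesis by (simp add: bach_frame_def weyl_closed[OF z])
qed

lemma ver_div_hor: "ver k (div_hor j) z = (tr z * tr z - dt z) / 2 * vb j k z + eps j 1 * vvq 1 k z + eps j 2 * vvq 2 k z
    - trS j k z * beta z / 2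
    + tr z * dt z / 4 * (sg j z * vth k z - tr z * t j k z * th z - f j 1 z * vvth 1 k z - f j 2 z * vvth 2 k z) / 2"
  by (simp add: div_hor_def[abs_def] hbeta_def[abs_def] ver_all[OF z] ver_vq[OF z] ver_beta[OF z])
     (simp add: trS_def field_simps)

lemma hor_div_mixed: "hor h m (div_mixed a i j) z =
      G m i 1 z * div_mixed a 1 j z + G m i 2 z * div_mixed a 2 j z + G m j 1 z * div_mixed a i 1 z + G m j 2 z * div_mixed a i 2 z
    - G m 1 a z * div_mixed 1 i j z - G m 2 a z * div_mixed 2 i j z - vert m a i j z"
proof -
  have ix: "x = 1 \<or> x = 2" for x :: 2 by (rule exhaust_2)
  have T: "hor h l (tau k) z = G l k 1 z * tau 1 z + G l k 2 z * tau 2 z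
    - (tau l z * sg k z + f l 1 z * t k 1 z + f l 2 z * t k 2 z) / 2" for l k
    by (simp add: hor_tau[OF z] sg_def)
  have X: "hor h l (xi k) z = xi 1 z * G l k 1 z + xi 2 z * G l k 2 z - (tau l z * tau k z + f l k z) / 2" for l k
    by (simp add: hor_xi h_def field_simps)
  have C: "hor h m (div_mixed a i j) z = (tr z * tr z / 4 + dt z / 2) * (hor h m (t i a) z * tau j z + t i a z * hor h m (tau j) z)
     + (dt z - tr z * tr z / 4) * (hor h m (t j a) z * tau i z + t j a z * hor h m (tau i) z)
     + dt z * dt z / 2 * kd i a * hor h m (xi j) z - tr z * dt z / 4 * kd i a * hor h m (tau j) z
     - 3 / 4 * tr z * dt z * (hor h m (t i a) z * xi j z + t i a z * hor h m (xi j) z)" for a i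
    unfolding div_mixed_def[abs_def]
    by (simp add: hor_rules[OF z] hor_tr[OF z] hor_dt[OF z]) (simp add: algebra_simps)
  have half: "dt z / 2 = 1 / 2 * dt z" by simp
  note d = div_mixed_def vert_def kd_simps quotient_to_coefficient half
  let ?eq = "\<lambda>a i. hor h m (div_mixed a i j) z =
      G m i 1 z * div_mixed a 1 j z + G m i 2 z * div_mixed a 2 j z + G m j 1 z * div_mixed a i 1 z + G m j 2 z * div_mixed a i 2 z
    - G m 1 a z * div_mixed 1 i j z - G m 2 a z * div_mixed 2 i j z - vert m a i j z"
  have "?eq 1 1" unfolding C X T hor_t[OF z] unfolding d by algebra
  moreover have "?eq 1 2" unfolding C X T hor_t[OF z] unfolding d by algebra
  moreover have "?eq 2 1" unfolding C X T hor_t[OF z] unfolding d by algebra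
  moreover have "?eq 2 2" unfolding C X T hor_t[OF z] unfolding d by algebra
  ultimately show ?thesis
    using ix[of a] ix[of i] by auto
qed

lemmas bach_expand = sum_UNIV_Plus sum_2 fd_walker_frame(1) hor_def[symmetric] div_comp_fun ricci_closed[OF z]
  walker_A_ext[OF z, folded A_def] walker_B_ext[OF z]

text \<open>Each vertical argument lowers the degree along the fibres: no vertical pair survives, the
  mixed part is constant on fibres, the horizontal part is quadratic.\<close>

lemma bach_ff: "bach_frame z (Inr i) (Inr j) = 0"
  unfolding bach_div_comp by (simp add: bach_expand hor_rules[OF z] ver_rules[OF z])

lemma bach_ef: "bach_frame z (Inl i) (Inr j) = tr z * (tr z * tr z - 4 * dt z) * (2 * t i j z - tr z * kd i j) / 6"
  unfolding bach_div_comp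
  using exhaust_2[of i] exhaust_2[of j]
  by (auto simp: bach_expand hor_rules[OF z] ver_all[OF z])
     (simp_all add: vvth_def w_def rho_def tr_def dt_def field_simps)

lemma bach_fe: "bach_frame z (Inr j) (Inl i) = tr z * (tr z * tr z - 4 * dt z) * (2 * t i j z - tr z * kd i j) / 6"
  unfolding bach_div_comp
  using exhaust_2[of i] exhaust_2[of j]
  by (auto simp: bach_expand hor_rules[OF z] ver_all[OF z] div_mixed_def[abs_def])
     (simp_all add: w_def rho_def tr_def dt_def field_simps)

text \<open>The Christoffel symbols have cancelled: only \<open>G - A\<close> acts on \<open>div_mixed\<close>. After unfolding,
  the closed form is an identity of polynomials in the entries of \<open>T\<close>, \<open>\<Phi>\<close>, \<open>K\<close> and in the fibre
  coordinates.\<close>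

lemma bach_ee_step: "bach_frame z (Inl i) (Inl j) =
    - (vert 1 1 i j z + vert 2 2 i j z)
    - (tdiff 1 1 1 z + tdiff 2 1 2 z) * div_mixed 1 i j z - (tdiff 1 2 1 z + tdiff 2 2 2 z) * div_mixed 2 i j z
    + (tdiff 1 i 1 z * div_mixed 1 1 j z + tdiff 1 i 2 z * div_mixed 1 2 j z + tdiff 2 i 1 z * div_mixed 2 1 j z + tdiff 2 i 2 z * div_mixed 2 2 j z)
    + (tdiff 1 j 1 z * div_mixed 1 i 1 z + tdiff 1 j 2 z * div_mixed 1 i 2 z + tdiff 2 j 1 z * div_mixed 2 i 1 z + tdiff 2 j 2 z * div_mixed 2 i 2 z)
    + eps 1 i * ver 1 (div_hor j) z + eps 2 i * ver 2 (div_hor j) z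
    + (ricci_hh 1 1 z * w i j 1 1 z + ricci_hh 1 2 z * w i j 1 2 z + ricci_hh 2 1 z * w i j 2 1 z + ricci_hh 2 2 z * w i j 2 2 z) / 2
    + beta z / 4 * (kd 1 i * (rho 1 1 z * eps j 1 + rho 1 2 z * eps j 2) + kd 2 i * (rho 2 1 z * eps j 1 + rho 2 2 z * eps j 2)
        - kd 1 j * (rho 1 1 z * eps 1 i + rho 1 2 z * eps 2 i) - kd 2 j * (rho 2 1 z * eps 1 i + rho 2 2 z * eps 2 i))"
proof -
  have A: "A l i k z = G l i k z - tdiff l i k z" for l i k
    by (simp add: A_def tdiff_def)
  show ?thesis
    unfolding bach_div_comp
    by (simp add: bach_expand hor_rules[OF z] ver_rules[OF z] hor_div_mixed, unfold A quotient_to_coefficient, algebra)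
qed

lemma bach_ee: "bach_frame z (Inl i) (Inl j) = bach_hh i j z"
proof -
  have s: "f 2 1 z = f 1 2 z" by (rule f_sym[OF z])
  have v: "vth 1 z = tau 2 z + xi 1 z * t 2 1 z - xi 2 z * t 1 1 z"
    "vth 2 z = xi 1 z * t 2 2 z - xi 2 z * t 1 2 z - tau 1 z"
    by (simp_all add: vth_def)
  have vv: "vvth 1 1 z = t 2 1 z + t 2 1 z" "vvth 1 2 z = t 2 2 z - t 1 1 z"
    "vvth 2 1 z = t 2 2 z - t 1 1 z" "vvth 2 2 z = - t 1 2 z - t 1 2 z"
    by (simp_all add: vvth_def)
  note d = bach_hh_def M_def div_mixed_def vert_def tdiff_def w_def rho_def ricci_hh_def beta_def vb_def vvq_def sg_def trS_def vv v
    th_def s eps_simps kd_simps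
  note d' = tr_def dt_def tau_def
  have "bach_frame z (Inl 1) (Inl 1) = bach_hh 1 1 z"
    unfolding bach_ee_step ver_div_hor unfolding d unfolding d' quotient_to_coefficient by algebra
  moreover have "bach_frame z (Inl 1) (Inl 2) = bach_hh 1 2 z"
    unfolding bach_ee_step ver_div_hor unfolding d unfolding d' quotient_to_coefficient by algebra
  moreover have "bach_frame z (Inl 2) (Inl 1) = bach_hh 2 1 z"
    unfolding bach_ee_step ver_div_hor unfolding d unfolding d' quotient_to_coefficient by algebra
  moreover have "bach_frame z (Inl 2) (Inl 2) = bach_hh 2 2 z"
    unfolding bach_ee_step ver_div_hor unfolding d unfolding d' quotient_to_coefficient by algebra
  ultimately show ?thesis
    using exhaust_2[of i] exhaust_2[of j] by auto
qed

end

subsection \<open>When does the Bach tensor vanish?\<close>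

definition trT :: "real^2 \<Rightarrow> real" where "trT x = T x 1 1 + T x 2 2"
definition detT :: "real^2 \<Rightarrow> real" where "detT x = T x 1 1 * T x 2 2 - T x 1 2 * T x 2 1"

definition pt :: "real^2 \<Rightarrow> real \<Rightarrow> real \<Rightarrow> real^(2 + 2)" where
  "pt x y1 y2 = (\<chi> k. case k of Inl i \<Rightarrow> x $ i | Inr i \<Rightarrow> if i = 1 then y1 else y2)"

lemma pt_simps [simp]: "base_pt (pt x y1 y2) = x" "xi 1 (pt x y1 y2) = y1" "xi 2 (pt x y1 y2) = y2"
  by (simp_all add: pt_def base_pt_def xi_def vec_eq_iff)

lemma pt_in_U [simp]: "pt x y1 y2 \<in> U \<longleftrightarrow> x \<in> S"
  by (simp add: U_def)

lemma tr_dt_base: "tr z = trT (base_pt z)" "dt z = detT (base_pt z)"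
  by (simp_all add: tr_def dt_def trT_def detT_def t_def)

lemma smooth_trT: "smooth_on S trT" and smooth_detT: "smooth_on S detT"
  by (simp_all add: trT_def[abs_def] detT_def[abs_def] open_S smooth_T)

lemma pd_trT: "x \<in> S \<Longrightarrow> pd l trT x = 0" and pd_detT: "x \<in> S \<Longrightarrow> pd l detT x = 0"
  using hor_tr[of "pt x 0 0" l] hor_dt[of "pt x 0 0" l]
    hor_pullback[OF smooth_trT, of "pt x 0 0" l] hor_pullback[OF smooth_detT, of "pt x 0 0" l]
  by (simp_all add: tr_dt_base[abs_def])

text \<open>The coordinate fields are triangular combinations of the frame, so the components vanish one
  type after the other, starting with vertical pairs.\<close>

lemma contract2_eq_zero_imp:
  assumes "\<And>y1 y2. contract2 z B y1 y2 = 0"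
  shows "B y1 y2 = 0"
proof -
  have 1: "B (Inr i) (Inr j) = 0" for i j
    using assms[of "Inr i" "Inr j"]
    by (simp add: contract2_def sum_UNIV_Plus walker_frame_entries delta_simps)
  have 2: "B (Inl i) (Inr j) = 0" for i j
    using assms[of "Inl i" "Inr j"]
    by (simp add: contract2_def sum_UNIV_Plus walker_frame_entries delta_simps 1)
  have 3: "B (Inr i) (Inl j) = 0" for i j
    using assms[of "Inr i" "Inl j"]
    by (simp add: contract2_def sum_UNIV_Plus walker_frame_entries delta_simps 1)
  have 4: "B (Inl i) (Inl j) = 0" for i j
    using assms[of "Inl i" "Inl j"]
    by (simp add: contract2_def sum_UNIV_Plus walker_frame_entries delta_simps 1 2 3)
  show ?thesis by (cases y1; cases y2) (simp_all add: 1 2 3 4)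
qed

lemma bach_zero_iff_frame:
  assumes "z \<in> U"
  shows "(\<forall>y1 y2. bach (walker h) z y1 y2 = 0) \<longleftrightarrow> (\<forall>y1 y2. bach_frame z y1 y2 = 0)"
proof
  assume 0: "\<forall>y1 y2. bach (walker h) z y1 y2 = 0"
  show "\<forall>y1 y2. bach_frame z y1 y2 = 0"
    unfolding contract2_bach[OF assms, symmetric] by (simp add: contract2_def 0)
next
  assume "\<forall>y1 y2. bach_frame z y1 y2 = 0"
  then show "\<forall>y1 y2. bach (walker h) z y1 y2 = 0"
    using contract2_eq_zero_imp[of z "bach (walker h) z"] contract2_bach[OF assms] by simp
qed

lemma bach_zero_iff:
  assumes z: "z \<in> U"
  shows "(\<forall>y1 y2. bach (walker h) z y1 y2 = 0) \<longleftrightarrow>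
    (\<forall>i j. tr z * (tr z * tr z - 4 * dt z) * (2 * t i j z - tr z * kd i j) = 0 \<and> bach_hh i j z = 0)"
  (is "_ \<longleftrightarrow> ?R")
proof -
  have "(\<forall>y1 y2. bach_frame z y1 y2 = 0) \<longleftrightarrow> ?R"
  proof
    assume 0: "\<forall>y1 y2. bach_frame z y1 y2 = 0"
    show ?R
    proof (intro allI conjI)
      fix i j
      show "tr z * (tr z * tr z - 4 * dt z) * (2 * t i j z - tr z * kd i j) = 0"
        using bach_ef[OF z, of i j] unfolding 0[rule_format] by simp
      show "bach_hh i j z = 0"
        using bach_ee[OF z, of i j] unfolding 0[rule_format] by simp
    qed
  next
    assume R: ?R
    show "\<forall>y1 y2. bach_frame z y1 y2 = 0"
    proof (intro allI)
      fix y1 y2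
      show "bach_frame z y1 y2 = 0"
        using R by (cases y1; cases y2) (simp_all add: bach_ff[OF z] bach_ef[OF z] bach_fe[OF z] bach_ee[OF z])
    qed
  qed
  then show ?thesis by (simp only: bach_zero_iff_frame[OF z])
qed

text \<open>Subtracting the value at the zero covector leaves the quadratic form in \<open>xi\<close> and \<open>tau\<close>. Contracted
  twice with the vector that \<open>xi\<close> annihilates, it reduces to its \<open>tau \<otimes> tau\<close> coefficient times the squared area of
  \<open>xi\<close> and \<open>tau\<close>, and this area is nonzero for some covector unless \<open>T\<close> is a multiple of the identity.\<close>

lemma scalar_or_nilpotent:
  assumes x: "x \<in> S" and 0: "\<And>z y1 y2. z \<in> U \<Longrightarrow> base_pt z = x \<Longrightarrow> bach (walker h) z y1 y2 = 0"
  shows "(T x 1 2 = 0 \<and> T x 2 1 = 0 \<and> T x 1 1 = T x 2 2) \<or> (trT x = 0 \<and> detT x = 0)"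
proof (rule disjCI)
  assume nn: "\<not> (trT x = 0 \<and> detT x = 0)"
  let ?t = "trT x" and ?d = "detT x"
  let ?k = "?t * ?t * ?d / 2 - 5 * ?d * ?d"
  have R: "?t * (?t * ?t - 4 * ?d) * (2 * T x i j - ?t * kd i j) = 0 \<and> bach_hh i j (pt x y1 y2) = 0" for y1 y2 i j
    using bach_zero_iff[of "pt x y1 y2"] 0[of "pt x y1 y2"] x by (simp add: tr_dt_base t_def)
  \<comment> \<open>the horizontal part at the covector (y1, y2), contracted twice with the vector (y2, -y1)\<close>
  have k: "?k * (y1 * (y1 * T x 2 1 + y2 * T x 2 2) - y2 * (y1 * T x 1 1 + y2 * T x 1 2))\<^sup>2 = 0" for y1 y2
  proof -
    let ?z = "pt x y1 y2" and ?o = "pt x 0 0"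
    have M: "M i r ?z = M i r ?o" for i r
      by (simp add: M_def K_def t_def tr_dt_base)
    have D: "bach_hh i j ?z - bach_hh i j ?o =
      - (?t * ?t * ?d * ?d / 3 + 5 / 3 * ?d * ?d * ?d) * xi i ?z * xi j ?z
      + (13 * ?t * ?d * ?d - ?t * ?t * ?t * ?d) / 6 * (xi i ?z * tau j ?z + tau i ?z * xi j ?z)
      + ?k * tau i ?z * tau j ?z" for i j
      using exhaust_2[of i] exhaust_2[of j]
      by (auto simp: bach_hh_def M f_def t_def tr_dt_base tau_def)
    have Z: "bach_hh i j ?z - bach_hh i j ?o = 0" for i j
      using R by simp
    have "y2 * y2 * (bach_hh 1 1 ?z - bach_hh 1 1 ?o) - 2 * y1 * y2 * (bach_hh 1 2 ?z - bach_hh 1 2 ?o)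
        + y1 * y1 * (bach_hh 2 2 ?z - bach_hh 2 2 ?o) = ?k * (y1 * tau 2 ?z - y2 * tau 1 ?z)\<^sup>2"
      unfolding D by (simp add: power2_eq_square field_simps)
    then show ?thesis
      unfolding Z by (simp add: tau_def t_def)
  qed
  show "T x 1 2 = 0 \<and> T x 2 1 = 0 \<and> T x 1 1 = T x 2 2"
  proof (rule ccontr)
    assume ns: "\<not> (T x 1 2 = 0 \<and> T x 2 1 = 0 \<and> T x 1 1 = T x 2 2)"
    then have "?t * (?t * ?t - 4 * ?d) = 0"
      using R[of 1 2] R[of 2 1] R[of 1 1] by (auto simp: trT_def)
    \<comment> \<open>the area of \<open>xi\<close> and \<open>tau\<close> is a quadratic form in the covector; if it vanished at (1, 0),
      (0, 1) and (1, 1), \<open>T\<close> would be a multiple of the identity\<close>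
    moreover have "?k = 0"
      using ns k[of 1 0] k[of 0 1] k[of 1 1] by auto
    then have "?d * (?t * ?t - 10 * ?d) = 0" by (simp add: algebra_simps)
    ultimately have "?t = 0 \<and> ?d = 0" by auto
    with nn show False by simp
  qed
qed

text \<open>Here \<open>tau\<close> is a multiple of \<open>xi\<close>, and the numerical coefficients in each group of terms add
  up to zero, whatever \<open>\<Phi>\<close> and \<open>K\<close> are.\<close>

lemma bach_zero_scalar:
  assumes z: "z \<in> U" and s: "t 1 2 z = 0" "t 2 1 z = 0" "t 1 1 z = t 2 2 z"
  shows "bach (walker h) z y1 y2 = 0"
proof -
  have "bach_hh i j z = 0" for i j
    using exhaust_2[of i] exhaust_2[of j]
    by (auto simp: bach_hh_def M_def tr_def dt_def tau_def s f_sym[OF z, of 2 1])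
  moreover have "tr z * tr z - 4 * dt z = 0"
    by (simp add: tr_def dt_def s algebra_simps)
  ultimately show ?thesis using bach_zero_iff[OF z] by simp
qed

text \<open>The second derivatives of \<open>T\<close> commute; expressing them through Christoffel symbols twice
  yields the Ricci identity for a parallel endomorphism.\<close>

lemma curvature_commutes:
  assumes x: "x \<in> S"
  shows "T x i 1 * Raff 1 r x + T x i 2 * Raff 2 r x = Raff i 1 x * T x 1 r + Raff i 2 x * T x 2 r"
proof -
  have P: "pd k (\<lambda>u. T u i j) u = \<Gamma> u k i 1 * T u 1 j + \<Gamma> u k i 2 * T u 2 j - \<Gamma> u k 1 j * T u i 1 - \<Gamma> u k 2 j * T u i 2"
    if "u \<in> S" for u k i j
    using parallel[OF that, of k i j] by (simp add: cov_deriv_11_def sum_2 algebra_simps)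
  have e: "fd (\<lambda>u. axis k 1) p u = pd k p u" for k p and u :: "real^2"
    by (simp add: fd_def axis_def if_distrib[where f="\<lambda>t. t * _"] cong: if_cong)
  note rules = fd_rules[OF open_S x, where V="\<lambda>u. axis k 1" for k, unfolded e]
  have PP: "pd l (\<lambda>u. pd k (\<lambda>u. T u i r) u) x =
     pd l (\<lambda>u. \<Gamma> u k i 1) x * T x 1 r + \<Gamma> x k i 1 * pd l (\<lambda>u. T u 1 r) x
     + (pd l (\<lambda>u. \<Gamma> u k i 2) x * T x 2 r + \<Gamma> x k i 2 * pd l (\<lambda>u. T u 2 r) x)
     - (pd l (\<lambda>u. \<Gamma> u k 1 r) x * T x i 1 + \<Gamma> x k 1 r * pd l (\<lambda>u. T u i 1) x)
     - (pd l (\<lambda>u. \<Gamma> u k 2 r) x * T x i 2 + \<Gamma> x k 2 r * pd l (\<lambda>u. T u i 2) x)" for k l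
  proof -
    have "pd l (\<lambda>u. pd k (\<lambda>u. T u i r) u) x = pd l (\<lambda>u. \<Gamma> u k i 1 * T u 1 r + \<Gamma> u k i 2 * T u 2 r
        - \<Gamma> u k 1 r * T u i 1 - \<Gamma> u k 2 r * T u i 2) x"
      by (rule pd_cong_open[OF open_S x]) (rule P)
    then show ?thesis
      by (simp add: rules open_S smooth_\<Gamma> smooth_T)
  qed
  have "pd 1 (\<lambda>u. pd 2 (\<lambda>u. T u i r) u) x = pd 2 (\<lambda>u. pd 1 (\<lambda>u. T u i r) u) x"
    by (rule pd_commute[OF smooth_T open_S x])
  then show ?thesis
    unfolding PP P[OF x] Raff_def by (simp add: algebra_simps)
qed

text \<open>With vanishing trace and determinant only \<open>T K T\<close> is left. Its \<open>\<Phi>\<close> terms contain \<open>T\<^sup>2 = 0\<close>,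
  and in \<open>T R T\<close> the curvature commutes to the front, leaving \<open>T\<^sup>2\<close> again.\<close>

lemma bach_zero_nilpotent:
  assumes z: "z \<in> U" and n: "tr z = 0" "dt z = 0"
  shows "bach (walker h) z y1 y2 = 0"
proof -
  have sq: "t i 1 z * t 1 j z + t i 2 z * t 2 j z = 0" for i j
    using T_square[of i z j] n by simp
  have comm: "t i 1 z * Raff 1 r (base_pt z) + t i 2 z * Raff 2 r (base_pt z)
      = Raff i 1 (base_pt z) * t 1 r z + Raff i 2 (base_pt z) * t 2 r z" for i r
    using curvature_commutes[of "base_pt z" i r] z by (simp add: U_def t_def)
  define u where "u k = f 2 1 z * t k 1 z + f 2 2 z * t k 2 z" for k
  define v where "v k = f 1 1 z * t k 1 z + f 1 2 z * t k 2 z" for k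
  have K: "K k r z = - Raff k r (base_pt z) + (u 1 * t k r z + t 1 r z * u k - v 2 * t k r z - t 2 r z * v k) / 4" for k r
    unfolding K_def K_base_def u_def v_def f_def t_def by (simp add: algebra_simps)
  have tu: "t i 1 z * u 1 + t i 2 z * u 2 = 0" "t i 1 z * v 1 + t i 2 z * v 2 = 0" for i
  proof -
    have "t i 1 z * u 1 + t i 2 z * u 2 = f 2 1 z * (t i 1 z * t 1 1 z + t i 2 z * t 2 1 z)
        + f 2 2 z * (t i 1 z * t 1 2 z + t i 2 z * t 2 2 z)"
      by (simp add: u_def algebra_simps)
    then show "t i 1 z * u 1 + t i 2 z * u 2 = 0" by (simp add: sq)
    have "t i 1 z * v 1 + t i 2 z * v 2 = f 1 1 z * (t i 1 z * t 1 1 z + t i 2 z * t 2 1 z)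
        + f 1 2 z * (t i 1 z * t 1 2 z + t i 2 z * t 2 2 z)"
      by (simp add: v_def algebra_simps)
    then show "t i 1 z * v 1 + t i 2 z * v 2 = 0" by (simp add: sq)
  qed
  have TK: "t i 1 z * K 1 r z + t i 2 z * K 2 r z = - (Raff i 1 (base_pt z) * t 1 r z + Raff i 2 (base_pt z) * t 2 r z)" for i r
  proof -
    have "t i 1 z * K 1 r z + t i 2 z * K 2 r z = - (t i 1 z * Raff 1 r (base_pt z) + t i 2 z * Raff 2 r (base_pt z))
       + ((u 1 - v 2) * (t i 1 z * t 1 r z + t i 2 z * t 2 r z) + t 1 r z * (t i 1 z * u 1 + t i 2 z * u 2)
          - t 2 r z * (t i 1 z * v 1 + t i 2 z * v 2)) / 4"
      unfolding K by (simp add: field_simps)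
    then show ?thesis by (simp add: sq tu comm)
  qed
  have "M i r z = 0" for i r
  proof -
    have "M i r z = - ((t i 1 z * K 1 1 z + t i 2 z * K 2 1 z) * t 1 r z + (t i 1 z * K 1 2 z + t i 2 z * K 2 2 z) * t 2 r z)"
      by (simp add: M_def n algebra_simps)
    also have "\<dots> = Raff i 1 (base_pt z) * (t 1 1 z * t 1 r z + t 1 2 z * t 2 r z)
        + Raff i 2 (base_pt z) * (t 2 1 z * t 1 r z + t 2 2 z * t 2 r z)"
      unfolding TK by (simp add: algebra_simps)
    finally show ?thesis by (simp add: sq)
  qed
  then have "bach_hh i j z = 0" for i j
    by (simp add: bach_hh_def n)
  then show ?thesis using bach_zero_iff[OF z] n by simp
qed

end

section \<open>From charts to the manifold\<close>

lemma pd_chain: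
  fixes p :: "real^'n::finite \<Rightarrow> real" and g :: "real^'m::finite \<Rightarrow> real^'n"
  assumes g: "\<And>b. (\<lambda>u. g u $ b) differentiable (at x)" and p: "p differentiable (at (g x))"
  shows "pd i (\<lambda>u. p (g u)) x = (\<Sum>b\<in>UNIV. pd i (\<lambda>u. g u $ b) x * pd b p (g x))"
proof -
  let ?Dp = "frechet_derivative p (at (g x))"
  define Dg where "Dg v = (\<chi> b. frechet_derivative (\<lambda>u. g u $ b) (at x) v)" for v
  have "((\<lambda>u. g u $ b) has_derivative (\<lambda>v. Dg v $ b)) (at x)" for b
    using g[of b] by (simp add: Dg_def frechet_derivative_works)
  then have Dg: "(g has_derivative Dg) (at x)"
    using has_derivative_componentwise_within[of g Dg x UNIV]
    by (auto simp: Basis_vec_def inner_axis)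
  have Dp: "(p has_derivative ?Dp) (at (g x))"
    using p by (simp add: frechet_derivative_works)
  have lin: "linear ?Dp" using has_derivative_linear[OF Dp] .
  have "pd i (\<lambda>u. p (g u)) x = ?Dp (Dg (axis i 1))"
    by (rule pd_eqI[OF has_derivative_compose[OF Dg Dp]])
  also have "Dg (axis i 1) = (\<Sum>b\<in>UNIV. (Dg (axis i 1) $ b) *\<^sub>R axis b 1)"
    using basis_expansion[of "Dg (axis i 1)"] by (simp add: scalar_mult_eq_scaleR)
  also have "?Dp \<dots> = (\<Sum>b\<in>UNIV. (Dg (axis i 1) $ b) * ?Dp (axis b 1))"
    by (simp add: linear_sum[OF lin] linear_cmul[OF lin])
  finally show ?thesis by (simp add: Dg_def pd_def)
qed

lemma locally_constant_of_pd_zero: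
  fixes p :: "real^'n::finite \<Rightarrow> real"
  assumes p: "smooth_on S p" "open S" and x: "x \<in> S" and 0: "\<And>y i. y \<in> S \<Longrightarrow> pd i p y = 0"
  shows "\<exists>r>0. \<forall>y\<in>ball x r. y \<in> S \<and> p y = p x"
proof -
  obtain r where r: "r > 0" "ball x r \<subseteq> S" using p(2) x openE by blast
  have "(p has_derivative (\<lambda>v. 0)) (at y within ball x r)" if y: "y \<in> ball x r" for y
  proof -
    have D: "(p has_derivative frechet_derivative p (at y)) (at y)"
      using smooth_on_has_derivative[OF p] y r by blast
    have lin: "linear (frechet_derivative p (at y))" using has_derivative_linear[OF D] .
    have "frechet_derivative p (at y) v = 0" for v
    proof -
      have "frechet_derivative p (at y) v = frechet_derivative p (at y) (\<Sum>b\<in>UNIV. (v $ b) *\<^sub>R axis b 1)"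
        using basis_expansion[of v] by (simp add: scalar_mult_eq_scaleR)
      also have "\<dots> = (\<Sum>b\<in>UNIV. v $ b * pd b p y)"
        by (simp add: linear_sum[OF lin] linear_cmul[OF lin] pd_def)
      finally show ?thesis using 0 y r by (simp add: subset_iff)
    qed
    then have "frechet_derivative p (at y) = (\<lambda>v. 0)" by auto
    then show ?thesis using D has_derivative_at_withinI by metis
  qed
  then obtain k where "\<forall>y\<in>ball x r. p y = k"
    using has_derivative_zero_constant[of "ball x r" p] by (auto simp: convex_ball)
  then show ?thesis using r by (intro exI[of _ r]) (auto simp: subset_iff)
qed

subsection \<open>Coordinate changes\<close>

context
  fixes A :: "('a, 'n::finite) chart set"
  assumes atlas: "smooth_atlas A"
begin

lemma chart_inj: "c \<in> A \<Longrightarrow> inj_on (snd c) (fst c)"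
  and chart_open: "c \<in> A \<Longrightarrow> open (snd c ` fst c)"
  and overlap_open: "c \<in> A \<Longrightarrow> d \<in> A \<Longrightarrow> open (snd c ` (fst c \<inter> fst d))"
  and coord_change_smooth: "c \<in> A \<Longrightarrow> d \<in> A \<Longrightarrow>
        smooth_on (snd c ` (fst c \<inter> fst d)) (\<lambda>x. coord_change c d x $ a)"
  using atlas by (auto simp: smooth_atlas_def)

lemma coord_change_apply: "c \<in> A \<Longrightarrow> p \<in> fst c \<Longrightarrow> coord_change c d (snd c p) = snd d p"
  using chart_inj by (simp add: coord_change_def)

lemma jac_cocycle:
  assumes c: "c \<in> A" "d \<in> A" "e \<in> A" and p: "p \<in> fst c" "p \<in> fst d" "p \<in> fst e"
  shows "jac c e (snd c p) i a = (\<Sum>b\<in>UNIV. jac c d (snd c p) i b * jac d e (snd d p) b a)"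
proof -
  let ?W = "snd c ` (fst c \<inter> fst d) \<inter> snd c ` (fst c \<inter> fst e)"
  have W: "open ?W" "snd c p \<in> ?W"
    using overlap_open[OF c(1,2)] overlap_open[OF c(1,3)] p by (simp_all add: open_Int)
  have "pd i (\<lambda>u. coord_change c e u $ a) (snd c p)
      = pd i (\<lambda>u. coord_change d e (coord_change c d u) $ a) (snd c p)"
  proof (rule pd_cong_open[OF W])
    fix y assume "y \<in> ?W"
    then obtain p1 p2 where "p1 \<in> fst c \<inter> fst d" "y = snd c p1" "p2 \<in> fst c \<inter> fst e" "y = snd c p2"
      by (elim IntE imageE) blast
    then have "p1 \<in> fst e" "y = snd c p1" "p1 \<in> fst c" "p1 \<in> fst d"
      using chart_inj[OF c(1)] by (auto simp: inj_on_def)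
    then show "coord_change c e y $ a = coord_change d e (coord_change c d y) $ a"
      using c by (simp add: coord_change_apply)
  qed
  also have "\<dots> = (\<Sum>b\<in>UNIV. pd i (\<lambda>u. coord_change c d u $ b) (snd c p)
      * pd b (\<lambda>u. coord_change d e u $ a) (coord_change c d (snd c p)))"
  proof (rule pd_chain)
    show "(\<lambda>u. coord_change c d u $ b) differentiable at (snd c p)" for b
      by (rule smooth_on_differentiable[OF coord_change_smooth[OF c(1,2)] overlap_open[OF c(1,2)]])
         (use p in auto)
    show "(\<lambda>u. coord_change d e u $ a) differentiable at (coord_change c d (snd c p))"
      by (rule smooth_on_differentiable[OF coord_change_smooth[OF c(2,3)] overlap_open[OF c(2,3)]])
         (use p c in \<open>auto simp: coord_change_apply\<close>)
  qed
  finally show ?thesis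
    using c p by (simp add: jac_def coord_change_apply)
qed

lemma jac_self:
  assumes c: "c \<in> A" and p: "p \<in> fst c"
  shows "jac c c (snd c p) i a = (if i = a then 1 else 0)"
proof -
  have "jac c c (snd c p) i a = pd i (\<lambda>u. u $ a) (snd c p)"
    unfolding jac_def
    by (rule pd_cong_open[OF chart_open[OF c]]) (use p c in \<open>auto simp: coord_change_apply\<close>)
  then show ?thesis by (simp add: pd_component)
qed

text \<open>Every point of the coordinate domain is the image of a covector: prescribe its components in one
  chart and transform them to all others.\<close>

lemma induced_chart_image:
  assumes c: "c \<in> A"
  shows "snd (induced_chart A c) ` fst (induced_chart A c) = {z. base_pt z \<in> snd c ` fst c}"
proof
  show "snd (induced_chart A c) ` fst (induced_chart A c) \<subseteq> {z. base_pt z \<in> snd c ` fst c}"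
    by (auto simp: induced_chart_def base_pt_def)
next
  show "{z. base_pt z \<in> snd c ` fst c} \<subseteq> snd (induced_chart A c) ` fst (induced_chart A c)"
  proof
    fix z :: "real^('n + 'n)" assume "z \<in> {z. base_pt z \<in> snd c ` fst c}"
    then obtain p where p: "p \<in> fst c" "base_pt z = snd c p" by auto
    define \<omega> where "\<omega> d = (if d \<in> A \<and> p \<in> fst d
      then \<chi> i. \<Sum>a\<in>UNIV. jac d c (snd d p) i a * fibre z $ a else 0)" for d
    have "covector_at A p \<omega>"
      unfolding covector_at_def
    proof (intro conjI ballI impI allI)
      fix d e i assume d: "d \<in> A" "e \<in> A" "p \<in> fst d" "p \<in> fst e"
      have "\<omega> d $ i = (\<Sum>a\<in>UNIV. (\<Sum>b\<in>UNIV. jac d e (snd d p) i b * jac e c (snd e p) b a) * fibre z $ a)"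
        using d c p by (simp add: \<omega>_def jac_cocycle[of d e c])
      also have "\<dots> = (\<Sum>b\<in>UNIV. jac d e (snd d p) i b * \<omega> e $ b)"
        using d by (simp add: \<omega>_def sum_distrib_left sum_distrib_right, subst sum.swap) (simp add: mult.assoc)
      finally show "\<omega> d $ i = (\<Sum>a\<in>UNIV. jac d e (snd d p) i a * \<omega> e $ a)" .
    qed (auto simp: \<omega>_def)
    then have q: "(p, \<omega>) \<in> fst (induced_chart A c)"
      using p c by (auto simp: induced_chart_def cotangent_bundle_def points_def)
    have "\<omega> c = fibre z"
      using c p by (simp add: \<omega>_def vec_eq_iff jac_self if_distrib[where f="\<lambda>t. t * _"] cong: if_cong)
    moreover have "z $ k = (case k of Inl i \<Rightarrow> base_pt z $ i | Inr i \<Rightarrow> fibre z $ i)" for k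
      by (cases k) (simp_all add: base_pt_def fibre_def)
    ultimately have "z = snd (induced_chart A c) (p, \<omega>)"
      unfolding vec_eq_iff by (simp add: induced_chart_def p(2)[symmetric] split: sum.split)
    then show "z \<in> snd (induced_chart A c) ` fst (induced_chart A c)"
      using q by (rule image_eqI)
  qed
qed

text \<open>The set where \<open>F\<close> takes a given value and its complement are both open in the atlas topology. The
  hypothesis speaks of balls in the coordinate range, which is what the derivative test provides.\<close>

lemma constant_of_locally_constant:
  fixes F :: "'a \<Rightarrow> 'b"
  assumes conn: "connected_space (atlas_topology A)"
    and loc: "\<And>c p. c \<in> A \<Longrightarrow> p \<in> fst c \<Longrightarrow>
      \<exists>r>0. \<forall>y\<in>ball (snd c p) r. \<exists>p'\<in>fst c. y = snd c p' \<and> F p' = F p"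
    and p: "p \<in> points A" "p' \<in> points A"
  shows "F p = F p'"
proof (rule ccontr)
  assume ne: "F p \<noteq> F p'"
  have op: "openin (atlas_topology A) {x \<in> points A. P (F x)}" for P
    unfolding openin_atlas_topology[OF atlas]
  proof (intro conjI ballI)
    fix c assume c: "c \<in> A"
    show "open (snd c ` ({x \<in> points A. P (F x)} \<inter> fst c))"
      unfolding open_contains_ball
    proof
      fix y assume "y \<in> snd c ` ({x \<in> points A. P (F x)} \<inter> fst c)"
      then obtain x where x: "x \<in> fst c" "P (F x)" "y = snd c x" by auto
      obtain r where r: "r > 0" "\<forall>y'\<in>ball y r. \<exists>p'\<in>fst c. y' = snd c p' \<and> F p' = F x"
        using loc[OF c x(1)] x(3) by auto
      have "ball y r \<subseteq> snd c ` ({x \<in> points A. P (F x)} \<inter> fst c)"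
      proof
        fix y' assume "y' \<in> ball y r"
        then obtain p' where "p' \<in> fst c" "y' = snd c p'" "F p' = F x" using r by blast
        then show "y' \<in> snd c ` ({x \<in> points A. P (F x)} \<inter> fst c)"
          using x c by (auto simp: points_def)
      qed
      then show "\<exists>r>0. ball y r \<subseteq> snd c ` ({x \<in> points A. P (F x)} \<inter> fst c)" using r by blast
    qed
  qed auto
  have top: "topspace (atlas_topology A) \<subseteq> points A"
    using openin_atlas_topology[OF atlas] openin_topspace by blast
  have "topspace (atlas_topology A) \<subseteq> {x \<in> points A. F x = F p} \<union> {x \<in> points A. F x \<noteq> F p}"
    using top by auto
  moreover have "{x \<in> points A. F x = F p} \<inter> {x \<in> points A. F x \<noteq> F p} = {}" by auto
  moreover have "{x \<in> points A. F x = F p} \<noteq> {}" "{x \<in> points A. F x \<noteq> F p} \<noteq> {}"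
    using p ne by auto
  ultimately show False
    using conn op[of "\<lambda>v. v = F p"] op[of "\<lambda>v. v \<noteq> F p"] unfolding connected_space_def by blast
qed

end

subsection \<open>Two-dimensional endomorphisms\<close>

text \<open>The theorem of Cayley and Hamilton for one endomorphism of the plane.\<close>

lemma endo_endo:
  fixes M :: "2 \<Rightarrow> 2 \<Rightarrow> real"
  shows "endo M (endo M v) = (M 1 1 + M 2 2) *\<^sub>R endo M v - (M 1 1 * M 2 2 - M 1 2 * M 2 1) *\<^sub>R v"
proof -
  have "endo M (endo M v) $ k = ((M 1 1 + M 2 2) *\<^sub>R endo M v - (M 1 1 * M 2 2 - M 1 2 * M 2 1) *\<^sub>R v) $ k" for k
    using exhaust_2[of k] by (auto simp: endo_def sum_2 algebra_simps)
  then show ?thesis by (simp add: vec_eq_iff)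
qed

lemma endo_axis: "endo M (axis i 1) $ k = M i k"
  by (simp add: endo_def axis_def if_distrib[where f="\<lambda>t. t * _"] cong: if_cong)

lemma endo_scale: "endo M (r *\<^sub>R v) = r *\<^sub>R endo M v"
  by (simp add: endo_def vec_eq_iff sum_distrib_left mult_ac)

text \<open>With nonzero determinant the endomorphism would be injective, and so would its powers. With
  zero determinant its powers are multiples of itself by powers of the trace.\<close>

lemma nilpotent_trace_det:
  fixes M :: "2 \<Rightarrow> 2 \<Rightarrow> real"
  assumes nil: "\<And>v. (endo M ^^ m) v = 0"
  shows "M 1 1 + M 2 2 = 0 \<and> M 1 1 * M 2 2 - M 1 2 * M 2 1 = 0"
proof -
  let ?t = "M 1 1 + M 2 2" and ?d = "M 1 1 * M 2 2 - M 1 2 * M 2 1"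
  have d: "?d = 0"
  proof (rule ccontr)
    assume ne: "?d \<noteq> 0"
    have inj: "v = 0" if "endo M v = 0" for v
      using endo_endo[of M v] that ne by (simp add: endo_def vec_eq_iff)
    have "v = 0" if "(endo M ^^ n) v = 0" for n v
      using that by (induction n) (auto dest: inj)
    then have "axis 1 1 = (0 :: real^2)" using nil by blast
    then show False by (simp add: axis_eq_0_iff)
  qed
  have pow: "(endo M ^^ Suc n) v = (?t ^ n) *\<^sub>R endo M v" for n v
    by (induction n) (use d in \<open>simp_all add: endo_scale endo_endo\<close>)
  have "?t = 0"
  proof (rule ccontr)
    assume ne: "?t \<noteq> 0"
    have "endo M v = 0" for v
    proof -
      have "(endo M ^^ Suc m) v = endo M ((endo M ^^ m) v)" by simp
      also have "\<dots> = 0" by (simp only: nil) (simp add: endo_def vec_eq_iff)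
      finally show ?thesis using ne unfolding pow by simp
    qed
    then have "M 1 1 = 0" "M 2 2 = 0"
      using endo_axis[of M 1 1] endo_axis[of M 2 2] by simp_all
    then show False using ne by simp
  qed
  with d show ?thesis by blast
qed

theorem theorem3p1:
  fixes A :: "('a, 2) chart set"
    and \<Gamma> :: "('a, 2) chart \<Rightarrow> real^2 \<Rightarrow> 2 \<Rightarrow> 2 \<Rightarrow> 2 \<Rightarrow> real"
    and T \<Phi> :: "('a, 2) chart \<Rightarrow> real^2 \<Rightarrow> 2 \<Rightarrow> 2 \<Rightarrow> real"
  assumes "connected_manifold A"
    and "torsion_free_connection A \<Gamma>"
    and "tensor_11 A T"
    and "parallel_11 A \<Gamma> T"
    and "symmetric_02_tensor A \<Phi>"
  shows "bach_vanishes_on_cotangent_bundle A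
           (\<lambda>c. modified_riemannian_extension (\<Gamma> c) (\<Phi> c) (T c))
         \<longleftrightarrow> multiple_of_identity A T \<or> nilpotent_11 A T"
proof -
  have atlas: "smooth_atlas A" and conn: "connected_space (atlas_topology A)"
    using assms(1) by (auto simp: connected_manifold_def smooth_manifold_def)
  have ext: "modified_extension (snd c ` fst c) (\<Gamma> c) (T c) (\<Phi> c)" if "c \<in> A" for c
  proof
    show "open (snd c ` fst c)" by (rule chart_open[OF atlas that])
    show "smooth_on (snd c ` fst c) (\<lambda>x. \<Gamma> c x i j k)" for i j k
      using assms(2) that by (auto simp: torsion_free_connection_def)
    show "smooth_on (snd c ` fst c) (\<lambda>x. T c x i j)" for i j
      using assms(3) that by (auto simp: tensor_11_def)
    show "smooth_on (snd c ` fst c) (\<lambda>x. \<Phi> c x i j)" for i j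
      using assms(5) that by (auto simp: symmetric_02_tensor_def)
    show "\<Gamma> c x i j k = \<Gamma> c x j i k" if "x \<in> snd c ` fst c" for x i j k
      using assms(2) that \<open>c \<in> A\<close> unfolding torsion_free_connection_def by blast
    show "\<Phi> c x i j = \<Phi> c x j i" if "x \<in> snd c ` fst c" for x i j
      using assms(5) that \<open>c \<in> A\<close> unfolding symmetric_02_tensor_def by blast
    show "cov_deriv_11 (\<Gamma> c) (T c) x k i j = 0" if "x \<in> snd c ` fst c" for x k i j
      using assms(4) that \<open>c \<in> A\<close> unfolding parallel_11_def by blast
  qed
  let ?g = "\<lambda>c. modified_riemannian_extension (\<Gamma> c) (\<Phi> c) (T c)"
  have vanish: "bach_vanishes_on_cotangent_bundle A ?g \<longleftrightarrow>
      (\<forall>c\<in>A. \<forall>z. base_pt z \<in> snd c ` fst c \<longrightarrow> (\<forall>a b. bach (?g c) z a b = 0))"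
    (is "_ \<longleftrightarrow> ?V")
  proof -
    have "(\<forall>q\<in>fst (induced_chart A c). \<forall>a b. bach (?g c) (snd (induced_chart A c) q) a b = 0)
       \<longleftrightarrow> (\<forall>z. base_pt z \<in> snd c ` fst c \<longrightarrow> (\<forall>a b. bach (?g c) z a b = 0))" if "c \<in> A" for c
    proof -
      have "(\<forall>q\<in>fst (induced_chart A c). Q (snd (induced_chart A c) q)) \<longleftrightarrow> (\<forall>z. base_pt z \<in> snd c ` fst c \<longrightarrow> Q z)" for Q
      proof -
        have "(\<forall>q\<in>fst (induced_chart A c). Q (snd (induced_chart A c) q))
            \<longleftrightarrow> (\<forall>z\<in>snd (induced_chart A c) ` fst (induced_chart A c). Q z)"
          by (rule ball_simps(9)[symmetric])
        then show ?thesis unfolding induced_chart_image[OF atlas that] by (simp only: ball_simps(8))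
      qed
      then show ?thesis .
    qed
    then show ?thesis by (simp add: bach_vanishes_on_cotangent_bundle_def)
  qed
  show ?thesis
    unfolding vanish
  proof
    assume V: ?V
    have alt: "(T c x 1 2 = 0 \<and> T c x 2 1 = 0 \<and> T c x 1 1 = T c x 2 2)
        \<or> (T c x 1 1 + T c x 2 2 = 0 \<and> T c x 1 1 * T c x 2 2 - T c x 1 2 * T c x 2 1 = 0)"
      if c: "c \<in> A" and x: "x \<in> snd c ` fst c" for c x
    proof -
      interpret modified_extension "snd c ` fst c" "\<Gamma> c" "T c" "\<Phi> c" by (rule ext[OF c])
      have "bach (walker h) z a1 a2 = 0" if "z \<in> U" "base_pt z = x" for z a1 a2
        using V c that x by (simp add: modified_riemannian_extension_walker[symmetric])
      from scalar_or_nilpotent[OF x this] show ?thesis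
        by (simp add: trT_def detT_def)
    qed
    define P where "P c x = (T c x 1 1 + T c x 2 2, T c x 1 1 * T c x 2 2 - T c x 1 2 * T c x 2 1)" for c x
    \<comment> \<open>trace and determinant do not depend on the chart, since the components are conjugate by the
      Jacobian\<close>
    have inv: "P c (snd c p) = P d (snd d p)" if cd: "c \<in> A" "d \<in> A" "p \<in> fst c" "p \<in> fst d" for c d p
    proof -
      define Mc where "Mc = (\<chi> i k. T c (snd c p) i k)"
      define Md where "Md = (\<chi> i k. T d (snd d p) i k)"
      define J where "J = (\<chi> i k. jac c d (snd c p) i k)"
      define J' where "J' = (\<chi> i k. jac d c (snd d p) i k)"
      have JJ: "J ** J' = mat 1"
        using jac_cocycle[OF atlas cd(1,2,1,3,4,3)] jac_self[OF atlas cd(1,3)]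
        by (simp add: J_def J'_def matrix_matrix_mult_def mat_def vec_eq_iff)
      have "Mc ** J = J ** Md"
        using assms(3) cd by (simp add: tensor_11_def Mc_def Md_def J_def matrix_matrix_mult_def vec_eq_iff)
      then have M: "Mc = J ** Md ** J'"
        using JJ by (metis matrix_mul_assoc matrix_mul_rid)
      have "trace Mc = trace (J' ** (J ** Md))" unfolding M by (rule trace_mul_sym)
      also have "J' ** (J ** Md) = Md"
        using JJ matrix_left_right_inverse[of J J'] by (metis matrix_mul_assoc matrix_mul_lid)
      finally have "trace Mc = trace Md" .
      moreover have "det J * det J' = 1" using JJ by (metis det_mul det_I)
      then have "det Mc = det Md" unfolding M by (simp add: det_mul mult_ac)
      ultimately show ?thesis
        by (simp add: P_def trace_def sum_2 det_2 Mc_def Md_def)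
    qed
    \<comment> \<open>hence they define a function on the surface, by evaluation in any chart around the point\<close>
    define F where "F p = P (SOME c. c \<in> A \<and> p \<in> fst c) ((snd (SOME c. c \<in> A \<and> p \<in> fst c)) p)" for p
    have F: "F p = P c (snd c p)" if "c \<in> A" "p \<in> fst c" for c p
    proof -
      have "(SOME c. c \<in> A \<and> p \<in> fst c) \<in> A \<and> p \<in> fst (SOME c. c \<in> A \<and> p \<in> fst c)"
        by (rule someI[of "\<lambda>c. c \<in> A \<and> p \<in> fst c" c]) (use that in simp)
      then show ?thesis unfolding F_def using inv that by blast
    qed
    have const: "F p = F p'" if "p \<in> points A" "p' \<in> points A" for p p'
    proof (rule constant_of_locally_constant[OF atlas conn _ that])
      fix c p assume c: "c \<in> A" "p \<in> fst c"
      interpret modified_extension "snd c ` fst c" "\<Gamma> c" "T c" "\<Phi> c" by (rule ext[OF c(1)])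
      have x: "snd c p \<in> snd c ` fst c" using c by blast
      obtain r1 where r1: "r1 > 0" "\<forall>y\<in>ball (snd c p) r1. y \<in> snd c ` fst c \<and> trT y = trT (snd c p)"
        using locally_constant_of_pd_zero[OF smooth_trT open_S x pd_trT] by blast
      obtain r2 where r2: "r2 > 0" "\<forall>y\<in>ball (snd c p) r2. y \<in> snd c ` fst c \<and> detT y = detT (snd c p)"
        using locally_constant_of_pd_zero[OF smooth_detT open_S x pd_detT] by blast
      have PF: "F p' = (trT (snd c p'), detT (snd c p'))" if "p' \<in> fst c" for p'
        using F[OF c(1) that] by (simp add: P_def trT_def detT_def)
      have "\<exists>p'\<in>fst c. y = snd c p' \<and> F p' = F p" if y: "y \<in> ball (snd c p) (min r1 r2)" for y
      proof -
        have "y \<in> ball (snd c p) r1" "y \<in> ball (snd c p) r2" using y by simp_all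
        then have yy: "y \<in> snd c ` fst c" "trT y = trT (snd c p)" "detT y = detT (snd c p)"
          using r1(2) r2(2) by blast+
        then obtain p' where "p' \<in> fst c" "y = snd c p'" by blast
        then show ?thesis using yy PF[of p] PF[of p'] c(2) by auto
      qed
      then show "\<exists>r>0. \<forall>y\<in>ball (snd c p) r. \<exists>p'\<in>fst c. y = snd c p' \<and> F p' = F p"
        using r1(1) r2(1) by (intro exI[of _ "min r1 r2"] conjI ballI) simp_all
    qed
    show "multiple_of_identity A T \<or> nilpotent_11 A T"
    proof (cases "\<exists>p\<in>points A. F p \<noteq> (0, 0)")
      case True
      then obtain p0 where p0: "p0 \<in> points A" "F p0 \<noteq> (0, 0)" by blast
      have "endo (T c x) v = (fst (F p0) / 2) *\<^sub>R v" if c: "c \<in> A" and x: "x \<in> snd c ` fst c" for c x v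
      proof -
        obtain p where p: "p \<in> fst c" "x = snd c p" using x by auto
        have P: "P c x = F p0"
          using F[OF c p(1)] const[of p p0] p0 p c by (auto simp: points_def)
        have "T c x 1 1 + T c x 2 2 = fst (F p0)"
          unfolding P[symmetric] by (simp add: P_def)
        moreover have "T c x 1 2 = 0 \<and> T c x 2 1 = 0 \<and> T c x 1 1 = T c x 2 2"
          using alt[OF c x] p0(2) unfolding P[symmetric] by (auto simp: P_def)
        ultimately have "T c x 1 2 = 0" "T c x 2 1 = 0" "T c x 1 1 = fst (F p0) / 2" "T c x 2 2 = fst (F p0) / 2"
          by auto
        then show ?thesis
          by (auto simp: endo_def vec_eq_iff sum_2 forall_2)
      qed
      then show ?thesis unfolding multiple_of_identity_def by blast
    next
      case False
      have "(endo (T c x) ^^ 2) v = 0" if c: "c \<in> A" and x: "x \<in> snd c ` fst c" for c x v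
      proof -
        obtain p where p: "p \<in> fst c" "x = snd c p" using x by auto
        have "P c x = (0, 0)"
          using F[OF c p(1)] False p c by (auto simp: points_def)
        then show ?thesis
          by (simp add: P_def numeral_2_eq_2 endo_endo)
      qed
      then show ?thesis unfolding nilpotent_11_def by blast
    qed
  next
    assume R: "multiple_of_identity A T \<or> nilpotent_11 A T"
    show ?V
    proof (intro ballI allI impI)
      fix c z a b assume c: "c \<in> A" and z: "base_pt z \<in> snd c ` fst c"
      interpret modified_extension "snd c ` fst c" "\<Gamma> c" "T c" "\<Phi> c" by (rule ext[OF c])
      have zU: "z \<in> U" using z by (simp add: U_def)
      from R have "bach (walker h) z a b = 0"
      proof
        assume "multiple_of_identity A T"
        then obtain r where r: "\<And>v. endo (T c (base_pt z)) v = r *\<^sub>R v"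
          using c z unfolding multiple_of_identity_def by blast
        have "T c (base_pt z) i k = r * axis i 1 $ k" for i k
          using endo_axis[of "T c (base_pt z)" i k] unfolding r by simp
        then show ?thesis
          by (intro bach_zero_scalar[OF zU]) (simp_all add: t_def axis_def)
      next
        assume "nilpotent_11 A T"
        then obtain m where "\<And>v. (endo (T c (base_pt z)) ^^ m) v = 0"
          using c z unfolding nilpotent_11_def by blast
        from nilpotent_trace_det[OF this] show ?thesis
          by (intro bach_zero_nilpotent[OF zU]) (simp_all add: tr_def dt_def t_def)
      qed
      then show "bach (?g c) z a b = 0"
        by (simp add: modified_riemannian_extension_walker)
    qed
  qed
qed

end
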